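(* Let $W$ be a vector space over $\mathbb{C}$, $\Gamma$ a subgroup of $\mathbb{C}^\times$ and $V$ a $\mathcal{Y}_\Gamma$-closed quasi local subspace of $\mathcal{E}(W)$ containing $1_W$. Then $(V,\{\mathcal{Y}_\alpha\}_{\alpha\in\Gamma},1_W)$ carries the structure of a $\Gamma$-vertex algebra with $W$ a quasi module, where $Y^W_\alpha(a(x),x_0)=a(x_0)$ for $a(x)\in V$, $\alpha\in\Gamma$. Furthermore, for any quasi local subset $S$ of $\mathcal{E}(W)$, $\langle S\rangle_\Gamma$ is a $\Gamma$-vertex algebra with $W$ as a quasi module.
   Context: All vector spaces are over $\mathbb{C}$; $x,x_0,x_1,x_2$ are commuting formal variables; $U((x))$ is the space of lower truncated Laurent series, $U((x_1))((x_2))=(U((x_1)))((x_2))$, $U((x_1,x_2))=U[[x_1,x_2]][x_1^{-1},x_2^{-1}]$. $\delta(z)=\sum_{n\in\mathbb{Z}}z^n$; integer powers of a binomial are expanded in nonnegative powers of the second-written term. For a vector space $W$, $\mathcal{E}(W)=\operatorname{Hom}(W,W((x)))$, and $1_W\in\mathcal{E}(W)$ is the identity operator viewed as a constant series. Compatibility: an ordered pair $(a(x),b(x))$ in $\mathcal{E}(W)$ is compatible if there is a nonzero polynomial $f(x_1,x_2)\in\mathbb{C}[x_1,x_2]$ with $f(x_1,x_2)a(x_1)b(x_2)\in \operatorname{Hom}(W,W((x_1,x_2)))$. A subspace is pairwise compatible if every ordered pair in it is compatible. Partial operations: for a compatible pair $(a(x),b(x))$, such an $f$, and $\alpha\in\mathbb{C}^\times$,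 define $a(x)_{(\alpha,n)}b(x)$ ($n\in\mathbb{Z}$) by $$\mathcal{Y}_\alpha(a(x),x_0)b(x)=\sum_{n\in\mathbb{Z}}\bigl(a(x)_{(\alpha,n)}b(x)\bigr)x_0^{-n-1}=\iota_{x,x_0}\bigl(f(x_0+\alpha x,x)^{-1}\bigr)\,\bigl(f(x_1,x)a(x_1)b(x)\bigr)\big|_{x_1=\alpha x+x_0},$$ where $\iota_{x,x_0}(f(x_0+\alpha x,x)^{-1})$ is the inverse of the nonzero polynomial $f(x_0+\alpha x,x)$ in the field $\mathbb{C}((x))((x_0))$ and in the substitution powers of $\alpha x+x_0$ are expanded in nonnegative powers of $x_0$. This is independent of the choice of $f$, and $a(x)_{(\alpha,n)}b(x)\in\mathcal{E}(W)$. Quasi locality: $a(x),b(x)\in\mathcal{E}(W)$ are mutually quasi local if there is a nonzero polynomial $f(x_1,x_2)$ with $f(x_1,x_2)a(x_1)b(x_2)=f(x_1,x_2)b(x_2)a(x_1)$. A subset (subspace) of $\mathcal{E}(W)$ is quasi local if any two of its elements (possibly equal) are mutually quasi local. Any quasi local subspace is pairwise compatible. For a subgroup $\Gamma$ of $\mathbb{C}^\times$, a pairwise compatible subspace $U$ of $\mathcal{E}(W)$ is $\mathcal{Y}_\Gamma$-closed if $a(x)_{(\alpha,n)}b(x)\in U$ for all $a(x),b(x)\in U$, $\alpha\in\Gamma$, $n\in\mathbb{Z}$. For a quasi local subset $S$, $\langle S\rangle_\Gamma$ denotes the smallest $\mathcal{Y}_\Gamma$-closed quasi local subspace of $\mathcal{E}(W)$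 containing $S$ and $1_W$ (it exists). $\Gamma$-vertex algebra (for $\Gamma\subset\mathbb{C}^\times$ a subgroup): a vector space $V$ with linear maps $Y_\alpha:V\to\operatorname{Hom}(V,V((x)))$, $\alpha\in\Gamma$, and a vector $\mathbf 1\in V$ such that for $\alpha,\beta\in\Gamma$, $u,v\in V$: $Y_\alpha(\mathbf 1,x)=1$; $Y_\alpha(v,x)\mathbf 1\in V[[x]]$; $\lim_{x\to 0}Y_1(v,x)\mathbf 1=v$; and $$x_0^{-1}\delta\left(\tfrac{x_1-\beta^{-1}\alpha x_2}{x_0}\right)Y_\alpha(u,x_1)Y_\beta(v,x_2)-x_0^{-1}\delta\left(\tfrac{-\beta^{-1}\alpha x_2+x_1}{x_0}\right)Y_\beta(v,x_2)Y_\alpha(u,x_1)=x_1^{-1}\delta\left(\tfrac{\beta^{-1}\alpha x_2+x_0}{x_1}\right)Y_\beta(Y_{\beta^{-1}\alpha}(u,x_0)v,x_2).$$ A quasi module for a $\Gamma$-vertex algebra $V$ is a vector space $W$ with linear maps $Y^W_\alpha:V\to\operatorname{Hom}(W,W((x)))$, $\alpha\in\Gamma$, such that $Y^W_\alpha(\mathbf 1,x)=1_W$ and for any $u,v\in V$ there is a nonzero polynomial $f(x_1,x_2)$ such that for all $\alpha,\beta\in\Gamma$ $$x_0^{-1}\delta\left(\tfrac{x_1-\beta^{-1}\alpha x_2}{x_0}\right)f(x_1,x_2)Y^W_\alpha(u,x_1)Y^W_\beta(v,x_2)-x_0^{-1}\delta\left(\tfrac{-\beta^{-1}\alpha x_2+x_1}{x_0}\right)f(x_1,x_2)Y^W_\beta(v,x_2)Y^W_\alpha(u,x_1)$$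 $$=x_1^{-1}\delta\left(\tfrac{\beta^{-1}\alpha x_2+x_0}{x_1}\right)f(x_1,x_2)Y^W_\beta(Y_{\beta^{-1}\alpha}(u,x_0)v,x_2).$$ *)

theory Defs
  imports
    "HOL-Computational_Algebra.Formal_Laurent_Series"
    "HOL-Algebra.Group"
    "HOL-Library.Function_Algebras"
    "HOL-Library.Product_Plus"
    "HOL-Library.Groups_Big_Fun"
begin

section \<open>Formal series\<close>

text \<open>
  A doubly infinite formal series with coefficients in a vector space is the function
  mapping an exponent to the coefficient; exponents range over \<open>int\<close> for one variable, and over
  \<open>int \<times> int\<close> and \<open>int \<times> int \<times> int\<close> for two and three variables. A vector space is a locale
  instance \<open>vector_space s\<close> for the scalar multiplication \<open>s\<close>, possibly together with a subspace
  that serves as its carrier.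
\<close>

definition series_scale :: "('a \<Rightarrow> 'u \<Rightarrow> 'u) \<Rightarrow> 'a \<Rightarrow> ('i \<Rightarrow> 'u) \<Rightarrow> 'i \<Rightarrow> 'u" where
  "series_scale s c g = (\<lambda>k. s c (g k))"

text \<open>
  The Cauchy product. \<open>Sum_any\<close> is the sum of a function of finite support; every product
  formed below has only finitely many nonzero contributions to each coefficient.
\<close>

definition series_mult ::
    "('a \<Rightarrow> 'u \<Rightarrow> 'u) \<Rightarrow> ('i::ab_group_add \<Rightarrow> 'a) \<Rightarrow> ('i \<Rightarrow> 'u::comm_monoid_add) \<Rightarrow> 'i \<Rightarrow> 'u" where
  "series_mult s F G k = (\<Sum>i. s (F i) (G (k - i)))"

definition const_series :: "'u::zero \<Rightarrow> int \<Rightarrow> 'u" where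
  "const_series u = (\<lambda>n. if n = 0 then u else 0)"

text \<open>\<open>U((x))\<close>\<close>

definition laurent :: "'u::zero set \<Rightarrow> (int \<Rightarrow> 'u) set" where
  "laurent U = {g. (\<forall>n. g n \<in> U) \<and> (\<exists>N. \<forall>n<N. g n = 0)}"

text \<open>\<open>U((x\<^sub>1, x\<^sub>2))\<close>, for \<open>U\<close> the whole type\<close>

definition laurent2 :: "(int \<times> int \<Rightarrow> 'u::zero) set" where
  "laurent2 = {g. \<exists>N. \<forall>p q. p < N \<or> q < N \<longrightarrow> g (p, q) = 0}"

text \<open>
  Polynomials \<open>f(x\<^sub>1, x\<^sub>2)\<close> are elements of \<open>\<complex>[x\<^sub>1][x\<^sub>2]\<close>: the outer variable is \<open>x\<^sub>2\<close>.
\<close>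

definition poly_series :: "complex poly poly \<Rightarrow> int \<times> int \<Rightarrow> complex" where
  "poly_series f =
    (\<lambda>(p, q). if p \<ge> 0 \<and> q \<ge> 0 then coeff (coeff f (nat q)) (nat p) else 0)"

text \<open>
  The coefficient of \<open>X\<^sup>p Y\<^sup>q\<close> in \<open>(c X + d Y)\<^sup>n\<close>, expanded in nonnegative powers of \<open>Y\<close>.
\<close>

definition binom_series :: "complex \<Rightarrow> complex \<Rightarrow> int \<Rightarrow> int \<times> int \<Rightarrow> complex" where
  "binom_series c d n = (\<lambda>(p, q).
    if q \<ge> 0 \<and> p + q = n then (of_int n gchoose nat q) * c powi p * d ^ nat q else 0)"

text \<open>
  The three delta functions of the Jacobi identity, as series in \<open>(x\<^sub>0, x\<^sub>1, x\<^sub>2)\<close>: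
  \<open>x\<^sub>0\<^sup>-\<^sup>1 \<delta>((x\<^sub>1 - \<gamma> x\<^sub>2) / x\<^sub>0)\<close>, \<open>x\<^sub>0\<^sup>-\<^sup>1 \<delta>((-\<gamma> x\<^sub>2 + x\<^sub>1) / x\<^sub>0)\<close> and
  \<open>x\<^sub>1\<^sup>-\<^sup>1 \<delta>((\<gamma> x\<^sub>2 + x\<^sub>0) / x\<^sub>1)\<close>, where \<open>x\<^sub>0\<^sup>-\<^sup>1 \<delta>(z / x\<^sub>0)\<close> is the sum of all
  \<open>z\<^sup>n x\<^sub>0\<^sup>-\<^sup>n\<^sup>-\<^sup>1\<close>.
\<close>

definition delta_fst :: "complex \<Rightarrow> int \<times> int \<times> int \<Rightarrow> complex" where
  "delta_fst \<gamma> = (\<lambda>(k, l, m). binom_series 1 (- \<gamma>) (- k - 1) (l, m))"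

definition delta_snd :: "complex \<Rightarrow> int \<times> int \<times> int \<Rightarrow> complex" where
  "delta_snd \<gamma> = (\<lambda>(k, l, m). binom_series (- \<gamma>) 1 (- k - 1) (m, l))"

definition delta_trd :: "complex \<Rightarrow> int \<times> int \<times> int \<Rightarrow> complex" where
  "delta_trd \<gamma> = (\<lambda>(k, l, m). binom_series \<gamma> 1 (- l - 1) (m, k))"

text \<open>
  Series in \<open>(x\<^sub>1, x\<^sub>2)\<close>, respectively \<open>(x\<^sub>0, x\<^sub>2)\<close>, as series in \<open>(x\<^sub>0, x\<^sub>1, x\<^sub>2)\<close>.
\<close>

definition in_x1_x2 :: "(int \<times> int \<Rightarrow> 'u::zero) \<Rightarrow> int \<times> int \<times> int \<Rightarrow> 'u" where
  "in_x1_x2 A = (\<lambda>(k, l, m). if k = 0 then A (l, m) else 0)"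

definition in_x0_x2 :: "(int \<times> int \<Rightarrow> 'u::zero) \<Rightarrow> int \<times> int \<times> int \<Rightarrow> 'u" where
  "in_x0_x2 C = (\<lambda>(k, l, m). if l = 0 then C (k, m) else 0)"


section \<open>The space \<open>\<E>(W)\<close>\<close>

definition linear_on ::
    "(complex \<Rightarrow> 'u \<Rightarrow> 'u) \<Rightarrow> (complex \<Rightarrow> 't \<Rightarrow> 't) \<Rightarrow> 'u set \<Rightarrow> ('u::plus \<Rightarrow> 't::plus) \<Rightarrow> bool" where
  "linear_on s t U T \<longleftrightarrow>
    (\<forall>u\<in>U. \<forall>v\<in>U. T (u + v) = T u + T v) \<and> (\<forall>c. \<forall>u\<in>U. T (s c u) = t c (T u))"

text \<open>\<open>Hom(U, U((x)))\<close>; only the values on \<open>U\<close> matter.\<close>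

definition hom_laurent ::
    "(complex \<Rightarrow> 'u \<Rightarrow> 'u) \<Rightarrow> 'u set \<Rightarrow> ('u::ab_group_add \<Rightarrow> int \<Rightarrow> 'u) set" where
  "hom_laurent s U = {T. linear_on s (series_scale s) U T \<and> (\<forall>u\<in>U. T u \<in> laurent U)}"

definition E_space :: "(complex \<Rightarrow> 'w \<Rightarrow> 'w) \<Rightarrow> ('w::ab_group_add \<Rightarrow> int \<Rightarrow> 'w) set" where
  "E_space s = hom_laurent s UNIV"

definition E_scale ::
    "(complex \<Rightarrow> 'w \<Rightarrow> 'w) \<Rightarrow> complex \<Rightarrow> ('w \<Rightarrow> int \<Rightarrow> 'w) \<Rightarrow> 'w \<Rightarrow> int \<Rightarrow> 'w" where
  "E_scale s c a = (\<lambda>w. series_scale s c (a w))"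

text \<open>\<open>a(x\<^sub>1) b(x\<^sub>2) w\<close> and \<open>b(x\<^sub>2) a(x\<^sub>1) w\<close>, both as series in \<open>(x\<^sub>1, x\<^sub>2)\<close>\<close>

definition prod_ab :: "('w \<Rightarrow> int \<Rightarrow> 'w) \<Rightarrow> ('w \<Rightarrow> int \<Rightarrow> 'w) \<Rightarrow> 'w \<Rightarrow> int \<times> int \<Rightarrow> 'w" where
  "prod_ab a b w = (\<lambda>(p, q). a (b w q) p)"

definition prod_ba :: "('w \<Rightarrow> int \<Rightarrow> 'w) \<Rightarrow> ('w \<Rightarrow> int \<Rightarrow> 'w) \<Rightarrow> 'w \<Rightarrow> int \<times> int \<Rightarrow> 'w" where
  "prod_ba a b w = (\<lambda>(p, q). b (a w p) q)"

definition compat_poly ::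
    "(complex \<Rightarrow> 'w \<Rightarrow> 'w) \<Rightarrow> ('w::ab_group_add \<Rightarrow> int \<Rightarrow> 'w) \<Rightarrow> ('w \<Rightarrow> int \<Rightarrow> 'w) \<Rightarrow>
      complex poly poly \<Rightarrow> bool" where
  "compat_poly s a b f \<longleftrightarrow>
    f \<noteq> 0 \<and> (\<forall>w. series_mult s (poly_series f) (prod_ab a b w) \<in> laurent2)"

definition compatible ::
    "(complex \<Rightarrow> 'w \<Rightarrow> 'w) \<Rightarrow> ('w::ab_group_add \<Rightarrow> int \<Rightarrow> 'w) \<Rightarrow> ('w \<Rightarrow> int \<Rightarrow> 'w) \<Rightarrow> bool" where
  "compatible s a b \<longleftrightarrow> (\<exists>f. compat_poly s a b f)"

definition pairwise_compatible ::
    "(complex \<Rightarrow> 'w \<Rightarrow> 'w) \<Rightarrow> ('w::ab_group_add \<Rightarrow> int \<Rightarrow> 'w) set \<Rightarrow> bool" where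
  "pairwise_compatible s U \<longleftrightarrow> (\<forall>a\<in>U. \<forall>b\<in>U. compatible s a b)"

definition mutually_quasi_local ::
    "(complex \<Rightarrow> 'w \<Rightarrow> 'w) \<Rightarrow> ('w::ab_group_add \<Rightarrow> int \<Rightarrow> 'w) \<Rightarrow> ('w \<Rightarrow> int \<Rightarrow> 'w) \<Rightarrow> bool" where
  "mutually_quasi_local s a b \<longleftrightarrow> (\<exists>f. f \<noteq> 0 \<and>
    (\<forall>w. series_mult s (poly_series f) (prod_ab a b w) =
          series_mult s (poly_series f) (prod_ba a b w)))"

definition quasi_local ::
    "(complex \<Rightarrow> 'w \<Rightarrow> 'w) \<Rightarrow> ('w::ab_group_add \<Rightarrow> int \<Rightarrow> 'w) set \<Rightarrow> bool" where
  "quasi_local s S \<longleftrightarrow> S \<subseteq> E_space s \<and> (\<forall>a\<in>S. \<forall>b\<in>S. mutually_quasi_local s a b)"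


section \<open>The operations \<open>\<Y>\<^sub>\<alpha>\<close>\<close>

text \<open>
  \<open>\<complex>((x))((x\<^sub>0))\<close> is the field \<open>complex fls fls\<close>: the outer variable is \<open>x\<^sub>0\<close>. The polynomial
  \<open>f(x\<^sub>0 + \<alpha> x, x)\<close> in this field:
\<close>

definition poly_shift :: "complex \<Rightarrow> complex poly poly \<Rightarrow> complex fls fls" where
  "poly_shift \<alpha> f =
    poly (map_poly
      (\<lambda>p. poly (map_poly (\<lambda>c. fls_const (fls_const c)) p)
             (fls_X + fls_const (fls_const \<alpha> * fls_X))) f)
      (fls_const fls_X)"

text \<open>\<open>\<iota>\<^sub>x\<^sub>,\<^sub>x\<^sub>0(f(x\<^sub>0 + \<alpha> x, x)\<^sup>-\<^sup>1)\<close> as a series in \<open>(x\<^sub>0, x)\<close>\<close>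

definition iota_inverse :: "complex \<Rightarrow> complex poly poly \<Rightarrow> int \<times> int \<Rightarrow> complex" where
  "iota_inverse \<alpha> f = (\<lambda>(i, j). fls_nth (fls_nth (inverse (poly_shift \<alpha> f)) i) j)"

text \<open>
  \<open>g(x\<^sub>1, x)\<close> at \<open>x\<^sub>1 = \<alpha> x + x\<^sub>0\<close> as a series in \<open>(x\<^sub>0, x)\<close>: the coefficient \<open>g (p, q)\<close> is
  multiplied by the coefficient of \<open>x\<^sup>m\<^sup>-\<^sup>q x\<^sub>0\<^sup>i\<close> in \<open>(\<alpha> x + x\<^sub>0)\<^sup>p\<close>.
\<close>

definition subst_shift ::
    "(complex \<Rightarrow> 'w \<Rightarrow> 'w) \<Rightarrow> complex \<Rightarrow> (int \<times> int \<Rightarrow> 'w::comm_monoid_add) \<Rightarrow> int \<times> int \<Rightarrow> 'w" where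
  "subst_shift s \<alpha> g = (\<lambda>(i, m). \<Sum>pq. s (binom_series \<alpha> 1 (fst pq) (m - snd pq, i)) (g pq))"

text \<open>\<open>\<Y>\<^sub>\<alpha>(a(x), x\<^sub>0) b(x) w\<close> as a series in \<open>(x\<^sub>0, x)\<close>, computed with the polynomial \<open>f\<close>\<close>

definition Y_series ::
    "(complex \<Rightarrow> 'w \<Rightarrow> 'w) \<Rightarrow> complex poly poly \<Rightarrow> complex \<Rightarrow>
      ('w::ab_group_add \<Rightarrow> int \<Rightarrow> 'w) \<Rightarrow> ('w \<Rightarrow> int \<Rightarrow> 'w) \<Rightarrow> 'w \<Rightarrow> int \<times> int \<Rightarrow> 'w" where
  "Y_series s f \<alpha> a b w =
    series_mult s (iota_inverse \<alpha> f)
      (subst_shift s \<alpha> (series_mult s (poly_series f) (prod_ab a b w)))"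

text \<open>\<open>a(x)\<^sub>(\<^sub>\<alpha>\<^sub>,\<^sub>n\<^sub>) b(x)\<close>; for a compatible pair it does not depend on the chosen \<open>f\<close>.\<close>

definition nth_prod ::
    "(complex \<Rightarrow> 'w \<Rightarrow> 'w) \<Rightarrow> complex \<Rightarrow> int \<Rightarrow>
      ('w::ab_group_add \<Rightarrow> int \<Rightarrow> 'w) \<Rightarrow> ('w \<Rightarrow> int \<Rightarrow> 'w) \<Rightarrow> 'w \<Rightarrow> int \<Rightarrow> 'w" where
  "nth_prod s \<alpha> n a b =
    (\<lambda>w m. Y_series s (SOME f. compat_poly s a b f) \<alpha> a b w (- n - 1, m))"

text \<open>\<open>\<Y>\<^sub>\<alpha>(a(x), x\<^sub>0) b(x)\<close> as a series in \<open>x\<^sub>0\<close> with coefficients in \<open>\<E>(W)\<close>\<close>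

definition Y_op ::
    "(complex \<Rightarrow> 'w \<Rightarrow> 'w) \<Rightarrow> complex \<Rightarrow>
      ('w::ab_group_add \<Rightarrow> int \<Rightarrow> 'w) \<Rightarrow> ('w \<Rightarrow> int \<Rightarrow> 'w) \<Rightarrow> int \<Rightarrow> 'w \<Rightarrow> int \<Rightarrow> 'w" where
  "Y_op s \<alpha> a b = (\<lambda>k. nth_prod s \<alpha> (- k - 1) a b)"

definition Y_closed ::
    "(complex \<Rightarrow> 'w \<Rightarrow> 'w) \<Rightarrow> complex set \<Rightarrow> ('w::ab_group_add \<Rightarrow> int \<Rightarrow> 'w) set \<Rightarrow> bool" where
  "Y_closed s \<Gamma> U \<longleftrightarrow>
    U \<subseteq> E_space s \<and> module.subspace (E_scale s) U \<and> pairwise_compatible s U \<and>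
    (\<forall>a\<in>U. \<forall>b\<in>U. \<forall>\<alpha>\<in>\<Gamma>. \<forall>n. nth_prod s \<alpha> n a b \<in> U)"

definition generated ::
    "(complex \<Rightarrow> 'w \<Rightarrow> 'w) \<Rightarrow> complex set \<Rightarrow> ('w::ab_group_add \<Rightarrow> int \<Rightarrow> 'w) set \<Rightarrow>
      ('w \<Rightarrow> int \<Rightarrow> 'w) set" where
  "generated s \<Gamma> S = (LEAST U. Y_closed s \<Gamma> U \<and> quasi_local s U \<and> S \<subseteq> U \<and> const_series \<in> U)"


section \<open>\<open>\<Gamma>\<close>-vertex algebras and quasi modules\<close>

definition Cx :: "complex monoid" where
  "Cx = \<lparr>carrier = - {0}, monoid.mult = (*), one = 1\<rparr>"

text \<open>
  The vector space is the subspace \<open>V\<close>. The coefficient of \<open>x\<^sup>n\<close> in \<open>Y\<^sub>\<alpha>(u, x) v\<close> is \<open>Y \<alpha> u v n\<close>.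
\<close>

locale gamma_vertex_algebra = vector_space s
  for s :: "complex \<Rightarrow> 'v::ab_group_add \<Rightarrow> 'v" +
  fixes \<Gamma> :: "complex set"
    and V :: "'v set"
    and Y :: "complex \<Rightarrow> 'v \<Rightarrow> 'v \<Rightarrow> int \<Rightarrow> 'v"
    and vac :: 'v
  assumes subgroup_Cx: "subgroup \<Gamma> Cx"
    and subspace_V: "subspace V"
    and vac_in_V: "vac \<in> V"
    and Y_hom: "\<alpha> \<in> \<Gamma> \<Longrightarrow> u \<in> V \<Longrightarrow> Y \<alpha> u \<in> hom_laurent s V"
    and Y_linear: "\<alpha> \<in> \<Gamma> \<Longrightarrow> v \<in> V \<Longrightarrow> linear_on s (series_scale s) V (\<lambda>u. Y \<alpha> u v)"
    and Y_vac: "\<alpha> \<in> \<Gamma> \<Longrightarrow> v \<in> V \<Longrightarrow> Y \<alpha> vac v = const_series v"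
    and creation: "\<alpha> \<in> \<Gamma> \<Longrightarrow> v \<in> V \<Longrightarrow> n < 0 \<Longrightarrow> Y \<alpha> v vac n = 0"
    and creation_limit: "v \<in> V \<Longrightarrow> Y 1 v vac 0 = v"
    and jacobi: "\<alpha> \<in> \<Gamma> \<Longrightarrow> \<beta> \<in> \<Gamma> \<Longrightarrow> u \<in> V \<Longrightarrow> v \<in> V \<Longrightarrow> w \<in> V \<Longrightarrow>
      series_mult s (delta_fst (inverse \<beta> * \<alpha>)) (in_x1_x2 (prod_ab (Y \<alpha> u) (Y \<beta> v) w))
      - series_mult s (delta_snd (inverse \<beta> * \<alpha>)) (in_x1_x2 (prod_ba (Y \<alpha> u) (Y \<beta> v) w))
      = series_mult s (delta_trd (inverse \<beta> * \<alpha>))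
          (in_x0_x2 (\<lambda>(k, m). Y \<beta> (Y (inverse \<beta> * \<alpha>) u v k) w m))"

locale gamma_quasi_module = gamma_vertex_algebra s \<Gamma> V Y vac + W: vector_space t
  for s :: "complex \<Rightarrow> 'v::ab_group_add \<Rightarrow> 'v"
    and \<Gamma> :: "complex set"
    and V :: "'v set"
    and Y :: "complex \<Rightarrow> 'v \<Rightarrow> 'v \<Rightarrow> int \<Rightarrow> 'v"
    and vac :: 'v
    and t :: "complex \<Rightarrow> 'w::ab_group_add \<Rightarrow> 'w" +
  fixes YW :: "complex \<Rightarrow> 'v \<Rightarrow> 'w \<Rightarrow> int \<Rightarrow> 'w"
  assumes YW_hom: "\<alpha> \<in> \<Gamma> \<Longrightarrow> u \<in> V \<Longrightarrow> YW \<alpha> u \<in> hom_laurent t UNIV"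
    and YW_linear: "\<alpha> \<in> \<Gamma> \<Longrightarrow> linear_on s (series_scale t) V (\<lambda>u. YW \<alpha> u w)"
    and YW_vac: "\<alpha> \<in> \<Gamma> \<Longrightarrow> YW \<alpha> vac w = const_series w"
    and quasi_jacobi: "u \<in> V \<Longrightarrow> v \<in> V \<Longrightarrow> \<exists>f. f \<noteq> 0 \<and> (\<forall>\<alpha>\<in>\<Gamma>. \<forall>\<beta>\<in>\<Gamma>. \<forall>w.
      series_mult t (delta_fst (inverse \<beta> * \<alpha>))
        (series_mult t (in_x1_x2 (poly_series f)) (in_x1_x2 (prod_ab (YW \<alpha> u) (YW \<beta> v) w)))
      - series_mult t (delta_snd (inverse \<beta> * \<alpha>))
        (series_mult t (in_x1_x2 (poly_series f)) (in_x1_x2 (prod_ba (YW \<alpha> u) (YW \<beta> v) w)))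
      = series_mult t (delta_trd (inverse \<beta> * \<alpha>))
        (series_mult t (in_x1_x2 (poly_series f))
          (in_x0_x2 (\<lambda>(k, m). YW \<beta> (Y (inverse \<beta> * \<alpha>) u v k) w m))))"

end

theory Submission
  imports Defs
begin

text \<open>
  The substitution \<open>x\<^sub>1 = \<alpha> x + x\<^sub>0\<close> in the definition of \<open>\<Y>\<^sub>\<alpha>\<close> is semilinear over polynomials,
  so it extends uniquely to all series that a nonzero polynomial moves into \<open>W((x\<^sub>1, x))\<close>, and
  \<open>\<Y>\<^sub>\<alpha>(a, x\<^sub>0) b\<close> is the value of the extension at \<open>a(x\<^sub>1) b(x)\<close>. For three pairwise quasi local
  operators \<open>a\<close>, \<open>b\<close>, \<open>c\<close>, multiplication by the three locality polynomials moves
  \<open>a(y\<^sub>1) b(y\<^sub>2) c(x) w\<close> into \<open>W((y\<^sub>1, y\<^sub>2, x))\<close>, whatever the order of the factors. Substituting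
  \<open>y\<^sub>1 = \<alpha> x + x\<^sub>1\<close>, \<open>y\<^sub>2 = \<beta> x + x\<^sub>2\<close> gives both products \<open>\<Y>\<^sub>\<alpha>(a, x\<^sub>1) \<Y>\<^sub>\<beta>(b, x\<^sub>2) c\<close> and
  \<open>\<Y>\<^sub>\<beta>(b, x\<^sub>2) \<Y>\<^sub>\<alpha>(a, x\<^sub>1) c\<close>, and \<open>x\<^sub>1 = \<beta>\<^sup>-\<^sup>1 \<alpha> x\<^sub>2 + x\<^sub>0\<close> gives the iterate. The substituted polynomials
  are monomials in \<open>x\<^sub>1\<close>, \<open>x\<^sub>2\<close>, \<open>x\<^sub>1 - \<beta>\<^sup>-\<^sup>1 \<alpha> x\<^sub>2\<close> times a unit of \<open>\<complex>((x))[[x\<^sub>1, x\<^sub>2]]\<close>; after cancellation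
  this is commutativity and associativity up to a power of \<open>x\<^sub>1 - \<beta>\<^sup>-\<^sup>1 \<alpha> x\<^sub>2\<close>, which is equivalent to
  the Jacobi identity. The quasi module identity needs only two operators. The closure of \<open>S\<close> exists
  by Dong's lemma: a maximal quasi local set is closed under all the operations.
\<close>

section \<open>Polynomials acting on formal series\<close>

text \<open>Polynomials can be cancelled only inside an iterated Laurent space, and the two products
  lie in different ones: x_2 is the outer variable of the first, x_1 of the second. They become
  comparable only after the locality polynomials have removed the negative powers of both variables,
  which is why a polynomial stays in front until the last moment. For the same reason the commutator
  in Dong's lemma need not vanish; its coefficients are only annihilated by polynomials. The
  exponent of x_1 - \<beta>^-1 \<alpha> x_2 is the multiplicity of a linear factor in the locality
  polynomial of \<open>a\<close> and \<open>b\<close>, so it does not depend on the vector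
  \<open>w\<close>. This uniformity lets identities proved for each \<open>w\<close> be read as
  identities of series with coefficients in E(W), as the Jacobi identity requires. Inverse power
  series are met only where \<open>Y_op\<close> is related to its definition; from then on
  \<open>Y_op\<close> is characterised by a polynomial equation together with uniqueness.\<close>

definition poly_act ::
    "('r \<Rightarrow> 'm \<Rightarrow> 'm) \<Rightarrow> 'r::comm_ring_1 poly \<Rightarrow> (int \<Rightarrow> 'm::ab_group_add) \<Rightarrow> int \<Rightarrow> 'm" where
  "poly_act s p g = (\<lambda>k. \<Sum>i\<le>degree p. s (coeff p i) (g (k - int i)))"

context module
begin

lemma poly_act_eq:
  assumes "degree p \<le> n"
  shows "poly_act scale p g k = (\<Sum>i\<le>n. scale (coeff p i) (g (k - int i)))"
  unfolding poly_act_def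
  by (rule sum.mono_neutral_left) (use assms in \<open>auto simp: coeff_eq_0 not_le\<close>)

lemma poly_act_0 [simp]: "poly_act scale 0 g = 0"
  by (auto simp: poly_act_def)

lemma poly_act_pCons:
  "poly_act scale (pCons a p) g = (\<lambda>k. scale a (g k) + poly_act scale p g (k - 1))"
proof
  fix k
  have "poly_act scale (pCons a p) g k
      = (\<Sum>i\<le>Suc (degree p). scale (coeff (pCons a p) i) (g (k - int i)))"
    by (rule poly_act_eq) (rule degree_pCons_le)
  also have "\<dots> = scale a (g k) + poly_act scale p g (k - 1)"
    unfolding poly_act_def sum.atMost_Suc_shift by (simp add: algebra_simps)
  finally show "poly_act scale (pCons a p) g k = scale a (g k) + poly_act scale p g (k - 1)" .
qed

lemma poly_act_add_right:
  "poly_act scale p (g + h) = poly_act scale p g + poly_act scale p h"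
  by (auto simp: poly_act_def scale_right_distrib sum.distrib)

lemma poly_act_add_left:
  "poly_act scale (p + q) g = poly_act scale p g + poly_act scale q g"
proof
  fix k
  let ?n = "max (degree p) (degree q)"
  have "poly_act scale (p + q) g k = (\<Sum>i\<le>?n. scale (coeff (p + q) i) (g (k - int i)))"
    by (rule poly_act_eq) (rule degree_add_le_max)
  also have "\<dots> = poly_act scale p g k + poly_act scale q g k"
    by (simp add: poly_act_eq[of p ?n] poly_act_eq[of q ?n] scale_left_distrib sum.distrib)
  finally show "poly_act scale (p + q) g k = (poly_act scale p g + poly_act scale q g) k"
    by simp
qed

lemma poly_act_smult: "poly_act scale (smult a p) g = (\<lambda>k. scale a (poly_act scale p g k))"
proof
  fix k
  have "poly_act scale (smult a p) g k = (\<Sum>i\<le>degree p. scale (coeff (smult a p) i) (g (k - int i)))"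
    by (rule poly_act_eq) (rule degree_smult_le)
  then show "poly_act scale (smult a p) g k = scale a (poly_act scale p g k)"
    by (simp add: poly_act_def scale_sum_right)
qed

lemma poly_act_mult: "poly_act scale p (poly_act scale q g) = poly_act scale (p * q) g"
  by (induction p) (auto simp: poly_act_pCons mult_pCons_left poly_act_add_left poly_act_smult fun_eq_iff)

text \<open>Polynomials over the scalar ring act again as on a module, so all facts about
  \<open>poly_act s\<close> may be reused with \<open>poly_act s\<close> in the place of
  \<open>s\<close>. Several variables arise by iteration, without new proofs.\<close>

lemma module_poly_act: "module (poly_act scale)"
  by (rule module.intro)
    (auto simp: poly_act_add_right poly_act_add_left poly_act_mult one_pCons poly_act_pCons)

end

lemma module_pointwise:
  assumes "module s"
  shows "module (\<lambda>c g k. s c (g k))"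
  using assms by (simp add: module_def fun_eq_iff)

text \<open>The coefficient at \<open>k\<close> only sees coefficients at indices up to
  \<open>k\<close>. Stability of the range and stability of lower truncation are both instances, the
  latter with \<open>M = {0}\<close>.\<close>

lemma poly_act_mem:
  assumes "module s" "\<And>r m. m \<in> M \<Longrightarrow> s r m \<in> M" "\<And>m n. m \<in> M \<Longrightarrow> n \<in> M \<Longrightarrow> m + n \<in> M" "0 \<in> M"
    and "\<And>i. i \<le> k \<Longrightarrow> g i \<in> M"
  shows "poly_act s p g k \<in> M"
proof -
  have "(\<Sum>i\<in>A. s (coeff p i) (g (k - int i))) \<in> M" if "finite A" for A
    using that by (induction A rule: finite_induct) (auto intro!: assms)
  then show ?thesis by (auto simp: poly_act_def)
qed

context module
begin

lemma subspace_all_coeffs: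
  assumes "subspace M"
  shows "module.subspace (poly_act scale) {g. \<forall>k. g k \<in> M}"
  using assms by (auto simp: module.subspace_def[OF module_poly_act] subspace_def
      intro!: poly_act_mem module_axioms)

lemma subspace_low_coeffs: "module.subspace (poly_act scale) {g. \<forall>k<N. g k = 0}"
proof -
  have "poly_act scale p g k \<in> {0}" if "\<forall>k<N. g k = 0" "k < N" for p g k
    using that by (intro poly_act_mem) (auto intro: module_axioms)
  then show ?thesis by (auto simp: module.subspace_def[OF module_poly_act])
qed

text \<open>Lower truncation means that some bound exists. The series with bound \<open>N\<close>
  form a subspace that grows as \<open>N\<close> decreases, and \<open>laurent\<close> and
  \<open>trunc2\<close> are unions of this kind.\<close>

lemma subspace_directed_UN:
  fixes A :: "int \<Rightarrow> 'b set"
  assumes sub: "\<And>N. subspace (A N)" and dir: "\<And>N N'. N' \<le> N \<Longrightarrow> A N \<subseteq> A N'"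
  shows "subspace (\<Union>N. A N)"
proof (rule subspaceI)
  show "0 \<in> (\<Union>N. A N)" using subspace_0[OF sub] by auto
  fix x y assume "x \<in> (\<Union>N. A N)" "y \<in> (\<Union>N. A N)"
  then obtain N N' where "x \<in> A N" "y \<in> A N'" by auto
  then have "x \<in> A (min N N')" "y \<in> A (min N N')"
    using dir[of "min N N'" N] dir[of "min N N'" N'] by auto
  then show "x + y \<in> (\<Union>N. A N)" using subspace_add[OF sub] by auto
next
  fix c x assume "x \<in> (\<Union>N. A N)"
  then show "c *s x \<in> (\<Union>N. A N)" using subspace_scale[OF sub] by auto
qed

lemma subspace_laurent:
  assumes "subspace M"
  shows "module.subspace (poly_act scale) (laurent M)"
proof -
  have "laurent M = (\<Union>N. {g. \<forall>k. g k \<in> M} \<inter> {g. \<forall>k<N. g k = 0})" by (auto simp: laurent_def)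
  moreover have "module.subspace (poly_act scale) \<dots>"
  proof (rule module.subspace_directed_UN[OF module_poly_act])
    fix N N' :: int assume "N' \<le> N"
    then show "{g. \<forall>k. g k \<in> M} \<inter> {g. \<forall>k<N. g k = 0} \<subseteq> {g. \<forall>k. g k \<in> M} \<inter> {g. \<forall>k<N'. g k = 0}"
      by (auto dest: less_le_trans)
  qed (intro module.subspace_inter module_poly_act subspace_all_coeffs subspace_low_coeffs assms)
  ultimately show ?thesis by simp
qed

end

text \<open>The product of the lowest terms does not cancel.\<close>

lemma poly_act_inj:
  assumes s: "module s" and inj: "\<And>r m. m \<in> M \<Longrightarrow> s r m = 0 \<Longrightarrow> r = 0 \<or> m = 0"
    and g: "g \<in> laurent M" and 0: "poly_act s p g = 0"
  shows "p = 0 \<or> g = 0"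
proof (rule ccontr)
  assume "\<not> ?thesis"
  then have p: "p \<noteq> 0" and "g \<noteq> 0" by auto
  from \<open>g \<noteq> 0\<close> obtain k0 where k0: "g k0 \<noteq> 0" by (auto simp: fun_eq_iff)
  from g obtain N where N: "\<And>n. n < N \<Longrightarrow> g n = 0" and M: "\<And>n. g n \<in> M" by (auto simp: laurent_def)
  define d where "d = (LEAST n::nat. g (N + int n) \<noteq> 0)"
  have "g (N + int (nat (k0 - N))) \<noteq> 0" using k0 N[of k0] by (cases "k0 < N") auto
  then have d: "g (N + int d) \<noteq> 0" unfolding d_def by (rule LeastI)
  have low: "g n = 0" if "n < N + int d" for n
  proof (cases "n < N")
    case False
    then have "nat (n - N) < d" using that by linarith
    then have "\<not> g (N + int (nat (n - N))) \<noteq> 0" unfolding d_def by (rule not_less_Least)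
    then show ?thesis using False by simp
  qed (use N in auto)
  define e where "e = (LEAST i. coeff p i \<noteq> 0)"
  have "\<exists>i. coeff p i \<noteq> 0" using p by (auto simp: poly_eq_iff)
  then have e: "coeff p e \<noteq> 0" unfolding e_def by (rule LeastI_ex)
  have lowp: "coeff p i = 0" if "i < e" for i using that not_less_Least unfolding e_def by blast
  have "poly_act s p g (N + int d + int e)
      = (\<Sum>i\<in>{..max e (degree p)}. s (coeff p i) (g (N + int d + int e - int i)))"
    by (rule module.poly_act_eq[OF s]) simp
  also have "\<dots> = (\<Sum>i\<in>{e}. s (coeff p i) (g (N + int d + int e - int i)))"
  proof (rule sum.mono_neutral_right)
    show "\<forall>i\<in>{..max e (degree p)} - {e}. s (coeff p i) (g (N + int d + int e - int i)) = 0"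
    proof
      fix i assume "i \<in> {..max e (degree p)} - {e}"
      then consider "i < e" | "e < i" by fastforce
      then show "s (coeff p i) (g (N + int d + int e - int i)) = 0"
        by cases (simp_all add: lowp low module.scale_zero_right[OF s] module.scale_zero_left[OF s])
    qed
  qed auto
  finally have "s (coeff p e) (g (N + int d)) = 0" using 0 by simp
  then show False using inj[OF M] e d by blast
qed

text \<open>Division by a polynomial with invertible constant term does not enlarge the range of
  the coefficients.\<close>

lemma poly_act_mem_cancel:
  assumes s: "module s" and cl: "\<And>r m. m \<in> M \<Longrightarrow> s r m \<in> M"
    "\<And>m n. m \<in> M \<Longrightarrow> n \<in> M \<Longrightarrow> m - n \<in> M" "0 \<in> M"
    and inv: "\<And>m. m \<in> M0 \<Longrightarrow> s (coeff p 0) m \<in> M \<Longrightarrow> m \<in> M"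
    and g: "g \<in> laurent M0" and mem: "\<And>k. k < K \<Longrightarrow> poly_act s p g k \<in> M" and k: "k < K"
  shows "g k \<in> M"
proof -
  from g obtain N where N: "\<And>n. n < N \<Longrightarrow> g n = 0" and M: "\<And>n. g n \<in> M0" by (auto simp: laurent_def)
  have add: "m + n \<in> M" if "m \<in> M" "n \<in> M" for m n
    using cl(2)[OF that(1) cl(2)[OF cl(3) that(2)]] by simp
  have "g (N + int n) \<in> M" if "N + int n < K" for n
    using that
  proof (induction n rule: less_induct)
    case (less n)
    obtain a q where p: "p = pCons a q" by (cases p)
    have low: "g i \<in> M" if "i < N + int n" for i
    proof (cases "i < N")
      case False
      then show ?thesis using less.IH[of "nat (i - N)"] that less.prems by auto
    qed (use N cl in auto)
    \<comment> \<open>The difference is the constant coefficient of \<open>p\<close> applied to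
      \<open>g (N + int n)\<close>; the subtracted term only involves lower coefficients, which are
      in \<open>M\<close> by induction.\<close>
    have "poly_act s p g (N + int n) - poly_act s q g (N + int n - 1) \<in> M"
      by (rule cl) (auto intro!: mem less.prems poly_act_mem low simp: s cl add)
    then show ?case using inv[OF M] by (simp add: p module.poly_act_pCons[OF s])
  qed
  from this[of "nat (k - N)"] show ?thesis using k N[of k] cl(3) by (cases "k < N") auto
qed

lemma poly_act_linear:
  assumes "module s" "module t" "\<And>r m. L (s r m) = t r (L m)" "\<And>m n. L (m + n) = L m + L n" "L 0 = 0"
  shows "poly_act t p (\<lambda>k. L (g k)) = (\<lambda>k. L (poly_act s p g k))"
proof
  fix k
  show "poly_act t p (\<lambda>k. L (g k)) k = L (poly_act s p g k)"
  proof (induction p arbitrary: k)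
    case (pCons a p)
    then show ?case by (simp add: assms module.poly_act_pCons)
  qed (simp add: assms module.poly_act_0)
qed

subsection \<open>Evaluation of polynomials in two variables\<close>

text \<open>The value at x_1 = \<open>u\<close>, x_2 = \<open>v\<close>. The embedding
  \<open>c\<close> of the scalars is a parameter, so that the values may lie in polynomial rings in
  any number of variables or in the Laurent field.\<close>

definition poly2 ::
    "(complex \<Rightarrow> 'r) \<Rightarrow> 'r \<Rightarrow> 'r \<Rightarrow> complex poly poly \<Rightarrow> 'r::comm_ring_1" where
  "poly2 c u v f = poly (map_poly (\<lambda>p. poly (map_poly c p) u) f) v"

lemma poly2_0 [simp]: "poly2 c u v 0 = 0"
  by (simp add: poly2_def)

lemma poly2_pCons:
  assumes "c 0 = 0"
  shows "poly2 c u v (pCons p f) = poly (map_poly c p) u + v * poly2 c u v f"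
  by (simp add: poly2_def map_poly_pCons assms)

definition scalar_hom :: "(complex \<Rightarrow> 'r::comm_ring_1) \<Rightarrow> bool" where
  "scalar_hom c \<longleftrightarrow> c 0 = 0 \<and> c 1 = 1 \<and> (\<forall>x y. c (x + y) = c x + c y) \<and> (\<forall>x y. c (x * y) = c x * c y)"

text \<open>
  A relation that is compatible with addition and with the scalars and the values of the two
  variables is compatible with every polynomial. Partially defined semilinear maps are handled
  through their graphs.
\<close>

lemma poly2_semilinear:
  assumes S: "module S" and S': "module S'" and c0: "c 0 = 0" and c0': "c' 0 = 0"
    and add: "\<And>x y x' y'. R x x' \<Longrightarrow> R y y' \<Longrightarrow> R (x + y) (x' + y')"
    and sc: "\<And>a x x'. R x x' \<Longrightarrow> R (S (c a) x) (S' (c' a) x')"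
    and u: "\<And>x x'. R x x' \<Longrightarrow> R (S u x) (S' u' x')"
    and v: "\<And>x x'. R x x' \<Longrightarrow> R (S v x) (S' v' x')"
    and R: "R x x'"
  shows "R (S (poly2 c u v f) x) (S' (poly2 c' u' v' f) x')"
proof -
  have R0: "R 0 0"
    using sc[OF R, of 0] by (simp add: c0 c0' module.scale_zero_left[OF S] module.scale_zero_left[OF S'])
  have 1: "R (S (poly (map_poly c p) u) x) (S' (poly (map_poly c' p) u') x')" for p
  proof (induction p)
    case (pCons a p)
    then show ?case
      using add[OF sc[OF R, of a] u[OF pCons.IH]]
      by (simp add: map_poly_pCons c0 c0' module.scale_left_distrib[OF S]
          module.scale_left_distrib[OF S'] module.scale_scale[OF S] module.scale_scale[OF S'])
  qed (simp add: R0 module.scale_zero_left[OF S] module.scale_zero_left[OF S'])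
  show ?thesis
  proof (induction f)
    case (pCons p f)
    then show ?case
      using add[OF 1[of p] v[OF pCons.IH]]
      by (simp add: poly2_pCons c0 c0' module.scale_left_distrib[OF S]
          module.scale_left_distrib[OF S'] module.scale_scale[OF S] module.scale_scale[OF S'])
  qed (simp add: R0 module.scale_zero_left[OF S] module.scale_zero_left[OF S'])
qed

lemma module_mult: "module ((*) :: 'r::comm_ring_1 \<Rightarrow> 'r \<Rightarrow> 'r)"
  by (rule module.intro) (auto simp: algebra_simps)

lemma poly2_hom:
  assumes "\<And>x y. \<psi> (x + y) = \<psi> x + \<psi> y" "\<And>x y. \<psi> (x * y) = \<psi> x * \<psi> y" "c 0 = 0"
  shows "\<psi> (poly2 c u v f) = poly2 (\<lambda>a. \<psi> (c a)) (\<psi> u) (\<psi> v) f"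
proof -
  have "\<psi> 0 = 0" using assms(1)[of 0 0] by simp
  have "\<psi> (poly (map_poly c p) u) = poly (map_poly (\<lambda>a. \<psi> (c a)) p) (\<psi> u)" for p
    by (induction p) (auto simp: map_poly_pCons assms \<open>\<psi> 0 = 0\<close>)
  then show ?thesis
    by (induction f) (auto simp: poly2_pCons assms \<open>\<psi> 0 = 0\<close>)
qed

abbreviation cst2 :: "complex \<Rightarrow> complex poly poly" where "cst2 a \<equiv> [:[:a:]:]"
abbreviation cst3 :: "complex \<Rightarrow> complex poly poly poly" where "cst3 a \<equiv> [:[:[:a:]:]:]"

text \<open>A polynomial is its own value at the two variables. Through this rewriting
  \<open>poly2_semilinear\<close> extends a statement about scalars and variables to every
  polynomial; most facts about polynomial actions below are proved in this way.\<close>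

lemma poly2_id [simp]: "poly2 cst2 [:[:0, 1:]:] [:0, 1:] f = f"
proof -
  have "poly (map_poly cst2 p) [:[:0, 1:]:] = [:p:]" for p :: "complex poly"
    by (induction p) (auto simp: map_poly_pCons)
  then show ?thesis by (induction f) (auto simp: poly2_pCons)
qed

lemma poly2_add: "poly2 c u v (f + g) = poly2 c u v f + poly2 c u v g" if "scalar_hom c"
proof -
  have c: "c 0 = 0" "c (x + y) = c x + c y" for x y using that by (auto simp: scalar_hom_def)
  have 1: "poly (map_poly c (p + q)) u = poly (map_poly c p) u + poly (map_poly c q) u" for p q
  proof -
    have "map_poly c (p + q) = map_poly c p + map_poly c q"
      by (rule poly_eqI) (simp add: coeff_map_poly c)
    then show ?thesis by simp
  qed
  have "map_poly (\<lambda>p. poly (map_poly c p) u) (f + g) 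
     = map_poly (\<lambda>p. poly (map_poly c p) u) f + map_poly (\<lambda>p. poly (map_poly c p) u) g"
    by (rule poly_eqI) (simp add: coeff_map_poly c 1)
  then show ?thesis by (simp add: poly2_def)
qed

lemma poly2_mult: "poly2 c u v (f * g) = poly2 c u v f * poly2 c u v g" if "scalar_hom c"
proof -
  have c: "c 0 = 0" "c 1 = 1" "c (x + y) = c x + c y" "c (x * y) = c x * c y" for x y
    using that by (auto simp: scalar_hom_def)
  have 1: "poly (map_poly c (smult a p)) u = c a * poly (map_poly c p) u" for a p
    by (induction p) (auto simp: map_poly_pCons c distrib_left mult.assoc mult.left_commute)
  have 2: "poly2 c u v ([:[:0, 1:]:] * h) = u * poly2 c u v h" for h
    by (induction h) (auto simp: poly2_pCons c map_poly_pCons distrib_left mult.left_commute)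
  have 3: "poly2 c u v (cst2 a * h) = c a * poly2 c u v h" for a h
    by (induction h) (auto simp: poly2_pCons c 1 distrib_left mult.left_commute)
  have 4: "poly2 c u v ([:0, 1:] * h) = v * poly2 c u v h" for h
    by (simp add: poly2_pCons c)
  \<comment> \<open>Evaluation is itself a semilinear map, so multiplication by \<open>f\<close> is
    assembled from the facts 2, 3, 4 about multiplication by variables and scalars.\<close>
  have "poly2 c u v f * poly2 c u v g = poly2 c u v (poly2 cst2 [:[:0, 1:]:] [:0, 1:] f * g)"
    by (rule poly2_semilinear[OF module_mult module_mult, where R = "\<lambda>x y. y = poly2 c u v x"])
      (simp_all add: c poly2_add[OF that] 2 3 4 del: mult_pCons_left)
  then show ?thesis by simp
qed

lemma poly2_1: "poly2 c u v 1 = 1" if "scalar_hom c"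
  using that by (simp add: poly2_def one_pCons map_poly_pCons scalar_hom_def)

lemma poly2_power: "poly2 c u v (f ^ n) = poly2 c u v f ^ n" if "scalar_hom c"
  by (induction n) (auto simp: poly2_1 poly2_mult that)

lemma scalar_hom_const [simp]:
  "scalar_hom (\<lambda>a. a)" "scalar_hom (\<lambda>a. [:a:])" "scalar_hom cst2" "scalar_hom cst3"
  by (auto simp: scalar_hom_def one_pCons)

lemma poly2_poly2:
  assumes "scalar_hom c"
  shows "poly2 c u v (poly2 cst2 u' v' f) = poly2 c (poly2 c u v u') (poly2 c u v v') f"
proof -
  have "poly2 c u v (cst2 a) = c a" for a
    using assms by (simp add: poly2_pCons map_poly_pCons scalar_hom_def)
  then show ?thesis
    using poly2_hom[of "poly2 c u v" cst2 u' v' f] by (simp add: poly2_add poly2_mult assms)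
qed

text \<open>
  Series in two or three variables are used in curried form; the outermost polynomial variable
  acts by shifting the first index.
\<close>

abbreviation act2 where "act2 s \<equiv> poly_act (poly_act s)"
abbreviation act3 where "act3 s \<equiv> poly_act (poly_act (poly_act s))"

text \<open>Bounded below jointly in both variables, whereas in \<open>laurent_laurent\<close> the
  bound on the inner index may depend on the outer one. Substitution is defined on the former;
  cancellation works in the latter.\<close>

definition trunc2 :: "(int \<Rightarrow> int \<Rightarrow> 'u::zero) set" where
  "trunc2 = {g. \<exists>N. \<forall>i j. i < N \<or> j < N \<longrightarrow> g i j = 0}"

definition trunc3 :: "(int \<Rightarrow> int \<Rightarrow> int \<Rightarrow> 'u::zero) set" where
  "trunc3 = {g. \<exists>N. \<forall>i j k. i < N \<or> j < N \<or> k < N \<longrightarrow> g i j k = 0}"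

abbreviation laurent_laurent :: "(int \<Rightarrow> int \<Rightarrow> 'u::zero) set" where
  "laurent_laurent \<equiv> laurent (laurent UNIV)"

text \<open>The substitution \<open>x\<^sub>1 = \<alpha> x + x\<^sub>0\<close> takes a series indexed by \<open>(x, x\<^sub>1)\<close> to one
  indexed by \<open>(x\<^sub>0, x)\<close>.\<close>

definition bcoef :: "complex \<Rightarrow> int \<Rightarrow> int \<Rightarrow> complex" where
  "bcoef \<alpha> p i = (if i \<ge> 0 then (of_int p gchoose nat i) * \<alpha> powi (p - i) else 0)"

text \<open>\<open>bcoef \<alpha> p i\<close> is the coefficient of x^(p-i) x_0^i in (\<alpha> x +
  x_0)^p. Substitution preserves the total degree, which forces the exponent
  \<open>m + i - p\<close> of x and leaves one summation index.\<close>

definition subst ::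
    "(complex \<Rightarrow> 'u \<Rightarrow> 'u) \<Rightarrow> complex \<Rightarrow> (int \<Rightarrow> int \<Rightarrow> 'u::comm_monoid_add) \<Rightarrow> int \<Rightarrow> int \<Rightarrow> 'u" where
  "subst s \<alpha> g = (\<lambda>i m. \<Sum>p. s (bcoef \<alpha> p i) (g (m + i - p) p))"

text \<open>In the result the outer variable is x_0 and the inner one is x, matching the index order
  of \<open>subst\<close>.\<close>

definition poly_subst :: "complex \<Rightarrow> complex poly poly \<Rightarrow> complex poly poly" where
  "poly_subst \<alpha> f = poly2 cst2 [:[:0, \<alpha>:], 1:] [:[:0, 1:]:] f"

lemma bcoef_neg: "i < 0 \<Longrightarrow> bcoef \<alpha> p i = 0"
  by (simp add: bcoef_def)

text \<open>Pascal's rule, that is, multiplication of (\<alpha> x + x_0)^p by one more factor. Since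
  \<open>p\<close> may be negative, powers of \<alpha> with negative exponents occur, and \<alpha>
  has to be invertible.\<close>

lemma bcoef_Suc:
  assumes "\<alpha> \<noteq> 0"
  shows "bcoef \<alpha> (p + 1) i = \<alpha> * bcoef \<alpha> p i + bcoef \<alpha> p (i - 1)"
proof -
  consider "i < 0" | "i = 0" | "i > 0" by linarith
  then show ?thesis
  proof cases
    case 3
    then obtain n where n: "i = int (Suc n)" by (metis pos_int_cases Suc_pred')
    have "(of_int p + 1 :: complex) gchoose Suc n = (of_int p gchoose n) + (of_int p gchoose Suc n)"
      by (rule gbinomial_Suc_Suc)
    moreover have "\<alpha> powi (p + 1 - i) = \<alpha> * \<alpha> powi (p - i)" "\<alpha> powi (p - (i - 1)) = \<alpha> * \<alpha> powi (p - i)"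
      using assms by (auto simp: power_int_add_1' [symmetric] algebra_simps simp flip: power_int_add_1')
    moreover have "nat i = Suc n" "nat (i - 1) = n" using n by auto
    ultimately show ?thesis using 3 by (simp add: bcoef_def algebra_simps)
  qed (use assms in \<open>auto simp: bcoef_def power_int_add_1'\<close>)
qed

lemma scalar_zero_iff:
  assumes "module (s :: complex \<Rightarrow> 'u::ab_group_add \<Rightarrow> 'u)"
  shows "s c u = 0 \<longleftrightarrow> c = 0 \<or> u = 0"
  using assms module_iff_vector_space vector_space.scale_eq_0_iff by blast

section \<open>Cancellation, and the semilinear substitution in two variables\<close>

locale cspace = module s for s :: "complex \<Rightarrow> 'u::ab_group_add \<Rightarrow> 'u"
begin

sublocale P1: module "poly_act s" by (rule module_poly_act)
sublocale P2: module "act2 s" by (rule P1.module_poly_act)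
sublocale P3: module "act3 s" by (rule P2.module_poly_act)

lemmas act_simps = poly_act_pCons P1.poly_act_pCons P2.poly_act_pCons

lemma subspace_laurent_laurent: "P2.subspace laurent_laurent"
  by (intro P1.subspace_laurent subspace_laurent subspace_UNIV)

lemma subspace_trunc2: "P2.subspace trunc2"
proof -
  let ?A = "\<lambda>N. {g. \<forall>i<N. g i = 0} \<inter> {g. \<forall>i. g i \<in> {h. \<forall>j<N. h j = (0::'u)}}"
  have "trunc2 = (\<Union>N. ?A N)" by (auto simp: trunc2_def fun_eq_iff)
  moreover have "P2.subspace \<dots>"
  proof (rule P2.subspace_directed_UN)
    fix N N' :: int assume "N' \<le> N"
    then show "?A N \<subseteq> ?A N'" by (auto dest: less_le_trans)
  qed (intro P2.subspace_inter P1.subspace_low_coeffs P1.subspace_all_coeffs subspace_low_coeffs)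
  ultimately show ?thesis by simp
qed

lemma act2_inj:
  assumes "act2 s p g = 0" "g \<in> laurent_laurent"
  shows "p = 0 \<or> g = 0"
  using assms
  by (intro poly_act_inj[OF P1.module_axioms _ assms(2,1)] poly_act_inj[OF module_axioms])
    (auto simp: scalar_zero_iff[OF module_axioms])

lemma act3_inj:
  assumes "act3 s p g = 0" "g \<in> laurent laurent_laurent"
  shows "p = 0 \<or> g = 0"
  using assms
  by (intro poly_act_inj[OF P2.module_axioms _ assms(2,1)] act2_inj) auto

text \<open>The two indices get separate bounds because a preceding substitution in another variable
  moves one of them and not the other.\<close>

lemma subst_eq2:
  assumes g: "\<And>i j. i < M \<or> j < N \<Longrightarrow> g i j = 0" and A: "finite A" "{N..m + i - M} \<subseteq> A"
  shows "subst s \<alpha> g i m = (\<Sum>p\<in>A. s (bcoef \<alpha> p i) (g (m + i - p) p))"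
  unfolding subst_def
proof (rule Sum_any.expand_superset[OF A(1)])
  show "{p. s (bcoef \<alpha> p i) (g (m + i - p) p) \<noteq> 0} \<subseteq> A"
  proof
    fix p assume "p \<in> {p. s (bcoef \<alpha> p i) (g (m + i - p) p) \<noteq> 0}"
    then have "g (m + i - p) p \<noteq> 0" by auto
    then have "p \<in> {N..m + i - M}" using g[of "m + i - p" p] by (cases "p < N \<or> m + i - p < M") auto
    then show "p \<in> A" using A by auto
  qed
qed

lemma subst_eq:
  assumes "\<And>i j. i < N \<or> j < N \<Longrightarrow> g i j = 0" "finite A" "{N..m + i - N} \<subseteq> A"
  shows "subst s \<alpha> g i m = (\<Sum>p\<in>A. s (bcoef \<alpha> p i) (g (m + i - p) p))"
  by (rule subst_eq2[OF assms])

lemma subst_neg: "i < 0 \<Longrightarrow> subst s \<alpha> g i m = 0"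
  by (simp add: subst_def bcoef_neg)

lemma subst_low:
  assumes "\<And>i j. i < N \<or> j < N \<Longrightarrow> g i j = 0" "m + i < 2 * N"
  shows "subst s \<alpha> g i m = 0"
  by (subst subst_eq[of N g "{}"]) (use assms in auto)

text \<open>The bound \<open>2 * N - i\<close> on the inner exponent depends on the outer one:
  negative powers of \<alpha> x + x_0 have infinitely many terms. So the image leaves
  \<open>trunc2\<close>, but stays where polynomials can be cancelled.\<close>

lemma subst_in_laurent_laurent:
  assumes "g \<in> trunc2"
  shows "subst s \<alpha> g \<in> laurent_laurent"
proof -
  obtain N where N: "\<And>i j. i < N \<or> j < N \<Longrightarrow> g i j = 0" using assms by (auto simp: trunc2_def)
  have "\<forall>m < 2 * N - i. subst s \<alpha> g i m = 0" for i
    by (auto intro!: subst_low[OF N])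
  moreover have "\<forall>i < 0. subst s \<alpha> g i = 0"
    by (auto simp: fun_eq_iff subst_neg)
  ultimately show ?thesis by (auto simp: laurent_def)
qed

lemma trunc2_common:
  assumes "g \<in> trunc2" "h \<in> trunc2"
  obtains N where "\<And>i j. i < N \<or> j < N \<Longrightarrow> g i j = 0" "\<And>i j. i < N \<or> j < N \<Longrightarrow> h i j = 0"
proof -
  obtain N N' where "\<forall>i j. i < N \<or> j < N \<longrightarrow> g i j = 0" "\<forall>i j. i < N' \<or> j < N' \<longrightarrow> h i j = 0"
    using assms unfolding trunc2_def by blast
  then show ?thesis by (intro that[of "min N N'"]) auto
qed

lemma subst_add:
  assumes "g \<in> trunc2" "h \<in> trunc2"
  shows "subst s \<alpha> (g + h) = subst s \<alpha> g + subst s \<alpha> h"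
proof (intro ext)
  fix i m
  obtain N where N: "\<And>i j. i < N \<or> j < N \<Longrightarrow> g i j = 0" "\<And>i j. i < N \<or> j < N \<Longrightarrow> h i j = 0"
    using trunc2_common[OF assms] by blast
  have "subst s \<alpha> f i m = (\<Sum>p\<in>{N..m + i - N}. s (bcoef \<alpha> p i) (f (m + i - p) p))"
    if "f = g \<or> f = h \<or> f = g + h" for f
    by (rule subst_eq) (use N that in \<open>auto\<close>)
  then show "subst s \<alpha> (g + h) i m = (subst s \<alpha> g + subst s \<alpha> h) i m"
    by (simp add: scale_right_distrib sum.distrib)
qed

lemma subst_linear:
  assumes t: "module t" and L: "\<And>r m. L (s r m) = t r (L m)" "\<And>m n. L (m + n) = L m + L n"
    and g: "g \<in> trunc2"
  shows "subst t \<alpha> (\<lambda>i j. L (g i j)) = (\<lambda>i j. L (subst s \<alpha> g i j))"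
proof (intro ext)
  fix i m
  interpret T: cspace t using t by (simp add: cspace_def)
  have L0: "L 0 = 0" using L(2)[of 0 0] by simp
  obtain N where N: "\<And>i j. i < N \<or> j < N \<Longrightarrow> g i j = 0" using g by (auto simp: trunc2_def)
  have "subst t \<alpha> (\<lambda>i j. L (g i j)) i m = (\<Sum>p\<in>{N..m + i - N}. t (bcoef \<alpha> p i) (L (g (m + i - p) p)))"
    by (rule T.subst_eq) (use N L0 in auto)
  also have "\<dots> = (\<Sum>p\<in>{N..m + i - N}. L (s (bcoef \<alpha> p i) (g (m + i - p) p)))"
    by (simp add: L)
  also have "\<dots> = L (\<Sum>p\<in>{N..m + i - N}. s (bcoef \<alpha> p i) (g (m + i - p) p))"
    by (rule sum_comp_morphism[of L, unfolded comp_def]) (use L L0 in auto)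
  also have "\<dots> = L (subst s \<alpha> g i m)"
    by (subst subst_eq[of N]) (use N in auto)
  finally show "subst t \<alpha> (\<lambda>i j. L (g i j)) i m = L (subst s \<alpha> g i m)" .
qed

lemma subst_outer: "subst s \<alpha> (\<lambda>q p. g (q - 1) p) = (\<lambda>i m. subst s \<alpha> g i (m - 1))"
  by (simp add: subst_def algebra_simps fun_eq_iff)

lemma subst_inner:
  assumes "\<alpha> \<noteq> 0" and "g \<in> trunc2"
  shows "subst s \<alpha> (\<lambda>q p. g q (p - 1)) = (\<lambda>i m. s \<alpha> (subst s \<alpha> g i (m - 1)) + subst s \<alpha> g (i - 1) m)"
proof (intro ext)
  fix i m
  obtain N where N: "\<And>i j. i < N \<or> j < N \<Longrightarrow> g i j = 0" using assms by (auto simp: trunc2_def)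
  let ?A = "{N..m + i - 1 - N}"
  have "subst s \<alpha> (\<lambda>q p. g q (p - 1)) i m
      = (\<Sum>p\<in>{N..m + i - N}. s (bcoef \<alpha> p i) (g (m + i - p) (p - 1)))"
    by (rule subst_eq) (use N in auto)
  also have "\<dots> = (\<Sum>p\<in>{N - 1..m + i - N - 1}. s (bcoef \<alpha> (p + 1) i) (g (m + i - 1 - p) p))"
    by (rule sum.reindex_bij_witness[of _ "\<lambda>p. p + 1" "\<lambda>p. p - 1"]) (auto simp: algebra_simps)
  also have "\<dots> = (\<Sum>p\<in>?A. s (bcoef \<alpha> (p + 1) i) (g (m + i - 1 - p) p))"
    by (rule sum.mono_neutral_right) (use N in auto)
  also have "\<dots> = s \<alpha> (\<Sum>p\<in>?A. s (bcoef \<alpha> p i) (g (m - 1 + i - p) p))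
      + (\<Sum>p\<in>?A. s (bcoef \<alpha> p (i - 1)) (g (m + (i - 1) - p) p))"
    using assms(1) by (simp add: bcoef_Suc scale_left_distrib sum.distrib scale_sum_right algebra_simps)
  also have "\<dots> = s \<alpha> (subst s \<alpha> g i (m - 1)) + subst s \<alpha> g (i - 1) m"
    by (subst (1 2) subst_eq[where A = ?A and N = N]) (use N in auto)
  finally show "subst s \<alpha> (\<lambda>q p. g q (p - 1)) i m
      = s \<alpha> (subst s \<alpha> g i (m - 1)) + subst s \<alpha> g (i - 1) m" .
qed

lemma trunc2_shift:
  assumes "g \<in> trunc2"
  shows "(\<lambda>q p. g (q - 1) p) \<in> trunc2" "(\<lambda>q p. g q (p - 1)) \<in> trunc2" "(\<lambda>q p. s c (g q p)) \<in> trunc2"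
proof -
  have "act2 s [:0, 1:] g \<in> trunc2" "act2 s [:[:0, 1:]:] g \<in> trunc2" "act2 s (cst2 c) g \<in> trunc2"
    using assms by (auto intro: P2.subspace_scale[OF subspace_trunc2])
  then show "(\<lambda>q p. g (q - 1) p) \<in> trunc2" "(\<lambda>q p. g q (p - 1)) \<in> trunc2" "(\<lambda>q p. s c (g q p)) \<in> trunc2"
    by (simp_all add: act_simps)
qed

lemma subst_scale: "g \<in> trunc2 \<Longrightarrow> subst s \<alpha> (\<lambda>q p. s c (g q p)) = (\<lambda>i m. s c (subst s \<alpha> g i m))"
  by (rule subst_linear[OF module_axioms]) (auto simp: scale_right_distrib mult.commute)

lemma subst_act2:
  assumes "\<alpha> \<noteq> 0" "g \<in> trunc2"
  shows "act2 s (poly_subst \<alpha> f) (subst s \<alpha> g) = subst s \<alpha> (act2 s f g)"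
proof -
  let ?R = "\<lambda>x y. x \<in> trunc2 \<and> y = subst s \<alpha> x"
  have "?R (act2 s (poly2 cst2 [:[:0, 1:]:] [:0, 1:] f) g) (act2 s (poly_subst \<alpha> f) (subst s \<alpha> g))"
    unfolding poly_subst_def
    by (rule poly2_semilinear[OF P2.module_axioms P2.module_axioms, where R = ?R])
      (use assms in \<open>auto simp: act_simps subst_add P2.subspace_add[OF subspace_trunc2]
        subst_outer subst_inner subst_scale trunc2_shift fun_eq_iff\<close>)
  then show ?thesis by simp
qed

lemma act2_linear:
  assumes "module t" "\<And>r m. L (s r m) = t r (L m)" "\<And>m n. L (m + n) = L m + L n"
  shows "act2 t p (\<lambda>i j. L (g i j)) = (\<lambda>i j. L (act2 s p g i j))"
proof -
  have L0: "L 0 = 0" using assms(3)[of 0 0] by simp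
  have 1: "poly_act t p (\<lambda>k. L (g k)) = (\<lambda>k. L (poly_act s p g k))" for p g
    by (rule poly_act_linear) (use assms L0 module_axioms in auto)
  show ?thesis
    by (rule poly_act_linear[where L = "\<lambda>g k. L (g k)" and s = "poly_act s" and t = "poly_act t"])
      (auto simp: 1 L0 assms module.module_poly_act P1.module_axioms fun_eq_iff)
qed

end

subsection \<open>Nonvanishing after substitution\<close>

text \<open>At (\<alpha> x + x_1, \<beta> x + x_2) the lowest term of \<open>f\<close> is its value
  at (\<alpha> x, \<beta> x). It vanishes exactly when \<open>f\<close> is divisible by x_2 -
  (\<beta>/\<alpha>) x_1, so the full power of this factor is split off. Its exponent
  \<open>k\<close> later becomes the exponent in weak commutativity.\<close>

lemma poly2_factor:
  assumes \<alpha>: "\<alpha> \<noteq> 0" "\<beta> \<noteq> 0" and f: "f \<noteq> 0"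
  obtains k f0 where "f = [:[:0, - (\<beta> / \<alpha>):], 1:] ^ k * f0"
    "poly2 (\<lambda>a. [:a:]) [:0, \<alpha>:] [:0, \<beta>:] f0 \<noteq> 0"
proof -
  let ?c = "[:0, \<beta> / \<alpha>:]"
  obtain f0 where f0: "f = [:- ?c, 1:] ^ order ?c f * f0" "\<not> [:- ?c, 1:] dvd f0"
    using order_decomp[OF f] by blast
  have "poly (map_poly (\<lambda>a. [:a:]) p) [:0, 1:] = p" for p :: "complex poly"
    by (induction p) (auto simp: map_poly_pCons)
  then have "poly2 (\<lambda>a. [:a:]) [:0, 1:] ?c f0 = poly f0 ?c"
    by (simp add: poly2_def)
  \<comment> \<open>Rescaling the variable by \<alpha> carries the point (x, (\<beta>/\<alpha>) x)
    to (\<alpha> x, \<beta> x).\<close>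
  moreover have "pcompose (poly2 (\<lambda>a. [:a:]) [:0, 1:] ?c f0) [:0, \<alpha>:]
      = poly2 (\<lambda>a. [:a:]) [:0, \<alpha>:] [:0, \<beta>:] f0"
    using \<alpha> by (subst poly2_hom) (auto simp: pcompose_add pcompose_mult pcompose_pCons)
  moreover have "poly f0 ?c \<noteq> 0" using f0(2) by (simp add: poly_eq_0_iff_dvd)
  ultimately have "poly2 (\<lambda>a. [:a:]) [:0, \<alpha>:] [:0, \<beta>:] f0 \<noteq> 0"
    using \<alpha> pcompose_eq_0[of "poly f0 ?c" "[:0, \<alpha>:]"] by auto
  with f0(1) show ?thesis by (intro that[of "order ?c f" f0]) auto
qed

text \<open>Here \<psi> plays the role of setting the new variables to 0. This may kill
  \<open>f\<close>, but only through the linear factor of \<open>poly2_factor\<close>, and that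
  factor takes the value v - (\<beta>/\<alpha>) u, which the last hypothesis keeps away from
  0.\<close>

lemma poly2_nonzero:
  fixes \<psi> :: "'r::idom \<Rightarrow> complex poly"
  assumes \<alpha>: "\<alpha> \<noteq> 0" "\<beta> \<noteq> 0" and f: "f \<noteq> 0"
    and \<psi>: "\<And>x y. \<psi> (x + y) = \<psi> x + \<psi> y" "\<And>x y. \<psi> (x * y) = \<psi> x * \<psi> y" "\<And>a. \<psi> (c a) = [:a:]"
    and c: "scalar_hom c"
    and uv: "\<psi> u = [:0, \<alpha>:]" "\<psi> v = [:0, \<beta>:]" "v \<noteq> c (\<beta> / \<alpha>) * u"
  shows "poly2 c u v f \<noteq> 0"
proof -
  obtain k f0 where f0: "f = [:[:0, - (\<beta> / \<alpha>):], 1:] ^ k * f0"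
    "poly2 (\<lambda>a. [:a:]) [:0, \<alpha>:] [:0, \<beta>:] f0 \<noteq> 0" using poly2_factor[OF \<alpha> f] by blast
  have c0: "c 0 = 0" "c (- x) = - c x" for x
    using c minus_unique[of "c x" "c (- x)"] unfolding scalar_hom_def
    by (auto, metis add.right_inverse)
  have "\<psi> (poly2 c u v f0) \<noteq> 0"
    using f0(2) by (subst poly2_hom) (auto simp: \<psi> c0 uv)
  moreover have "\<psi> 0 = 0" using \<psi>(1)[of 0 0] by simp
  ultimately have "poly2 c u v f0 \<noteq> 0" by auto
  moreover have "poly2 c u v [:[:0, - (\<beta> / \<alpha>):], 1:] = v - c (\<beta> / \<alpha>) * u"
    using c by (simp add: poly2_pCons c0 map_poly_pCons) (simp add: scalar_hom_def)
  ultimately show ?thesis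
    using uv(3) by (simp add: f0(1) poly2_mult[OF c] poly2_power[OF c])
qed

lemma poly_subst_eq_0_iff [simp]: "poly_subst \<alpha> f = 0 \<longleftrightarrow> f = 0" if "\<alpha> \<noteq> 0"
proof
  show "f = 0" if "poly_subst \<alpha> f = 0"
  proof (rule ccontr)
    assume "f \<noteq> 0"
    have "poly_subst \<alpha> f \<noteq> 0"
      unfolding poly_subst_def
      by (rule poly2_nonzero[where \<psi> = "\<lambda>p. coeff p 0" and \<alpha> = \<alpha> and \<beta> = 1])
        (use \<open>\<alpha> \<noteq> 0\<close> \<open>f \<noteq> 0\<close> in \<open>auto simp: coeff_mult_0\<close>)
    then show False using that by simp
  qed
qed (simp add: poly_subst_def)

lemma poly_subst_mult: "poly_subst \<alpha> (f * g) = poly_subst \<alpha> f * poly_subst \<alpha> g"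
  by (simp add: poly_subst_def poly2_mult)

section \<open>The operations \<open>\<Y>\<^sub>\<alpha>\<close> as partial substitutions\<close>

text \<open>
  The substitution \<open>x\<^sub>1 = \<alpha> x + x\<^sub>0\<close> extends uniquely from \<open>U((x\<^sub>1, x))\<close> to the series that are
  moved into \<open>U((x\<^sub>1, x))\<close> by a nonzero polynomial; \<open>\<Y>\<^sub>\<alpha>(a, x\<^sub>0) b\<close> is the value of this
  extension at \<open>a(x\<^sub>1) b(x)\<close>.
\<close>

definition subst_rel ::
    "(complex \<Rightarrow> 'u \<Rightarrow> 'u) \<Rightarrow> complex \<Rightarrow> (int \<Rightarrow> int \<Rightarrow> 'u::ab_group_add) \<Rightarrow> (int \<Rightarrow> int \<Rightarrow> 'u) \<Rightarrow> bool" where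
  "subst_rel s \<alpha> g Z \<longleftrightarrow> Z \<in> laurent_laurent \<and>
    (\<exists>f. f \<noteq> 0 \<and> act2 s f g \<in> trunc2 \<and> act2 s (poly_subst \<alpha> f) Z = subst s \<alpha> (act2 s f g))"

context cspace
begin

lemma subst_rel_laurent: "subst_rel s \<alpha> g Z \<Longrightarrow> Z \<in> laurent_laurent"
  by (simp add: subst_rel_def)

lemma subst_rel_add:
  assumes \<alpha>: "\<alpha> \<noteq> 0" and "subst_rel s \<alpha> g Z" "subst_rel s \<alpha> g' Z'"
  shows "subst_rel s \<alpha> (g + g') (Z + Z')"
proof -
  obtain f f' where f: "f \<noteq> 0" "act2 s f g \<in> trunc2" "act2 s (poly_subst \<alpha> f) Z = subst s \<alpha> (act2 s f g)"
    and f': "f' \<noteq> 0" "act2 s f' g' \<in> trunc2" "act2 s (poly_subst \<alpha> f') Z' = subst s \<alpha> (act2 s f' g')"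
    and Z: "Z \<in> laurent_laurent" "Z' \<in> laurent_laurent"
    using assms by (auto simp: subst_rel_def)
  have eq: "act2 s (f * f') (g + g') = act2 s f' (act2 s f g) + act2 s f (act2 s f' g')"
    by (simp add: P2.scale_right_distrib mult.commute)
  have "act2 s (poly_subst \<alpha> (f * f')) (Z + Z')
      = act2 s (poly_subst \<alpha> f') (act2 s (poly_subst \<alpha> f) Z)
        + act2 s (poly_subst \<alpha> f) (act2 s (poly_subst \<alpha> f') Z')"
    by (simp add: P2.scale_right_distrib mult.commute poly_subst_mult)
  also have "\<dots> = subst s \<alpha> (act2 s (f * f') (g + g'))"
    unfolding eq by (simp add: f f' \<alpha> subst_act2 subst_add P2.subspace_scale[OF subspace_trunc2] del: P2.scale_scale)
  finally show ?thesis
    using f f' Z P2.subspace_add[OF subspace_laurent_laurent]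
    unfolding subst_rel_def eq[symmetric]
    by (intro conjI exI[of _ "f * f'"]) (auto simp: eq P2.subspace_add[OF subspace_trunc2]
        P2.subspace_scale[OF subspace_trunc2] simp del: P2.scale_scale)
qed

lemma subst_rel_act2:
  assumes \<alpha>: "\<alpha> \<noteq> 0" and "subst_rel s \<alpha> g Z"
  shows "subst_rel s \<alpha> (act2 s p g) (act2 s (poly_subst \<alpha> p) Z)"
proof -
  obtain f where f: "f \<noteq> 0" "act2 s f g \<in> trunc2" "act2 s (poly_subst \<alpha> f) Z = subst s \<alpha> (act2 s f g)"
    and Z: "Z \<in> laurent_laurent"
    using assms by (auto simp: subst_rel_def)
  have eq: "act2 s f (act2 s p g) = act2 s p (act2 s f g)" by (simp add: mult.commute)
  have "act2 s (poly_subst \<alpha> f) (act2 s (poly_subst \<alpha> p) Z)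
      = act2 s (poly_subst \<alpha> p) (act2 s (poly_subst \<alpha> f) Z)"
    by (simp add: mult.commute)
  also have "\<dots> = subst s \<alpha> (act2 s f (act2 s p g))"
    unfolding eq by (simp add: f \<alpha> subst_act2 del: P2.scale_scale)
  finally show ?thesis
    using f Z unfolding subst_rel_def
    by (intro conjI exI[of _ f] P2.subspace_scale[OF subspace_laurent_laurent])
      (auto simp: eq P2.subspace_scale[OF subspace_trunc2] simp del: P2.scale_scale)
qed

lemma subst_rel_trunc2:
  assumes "g \<in> trunc2"
  shows "subst_rel s \<alpha> g (subst s \<alpha> g)"
  unfolding subst_rel_def using assms
  by (intro conjI subst_in_laurent_laurent exI[of _ 1]) (auto simp: poly_subst_def poly2_1)

lemma subst_rel_unique:
  assumes \<alpha>: "\<alpha> \<noteq> 0" and Z: "subst_rel s \<alpha> g Z" "subst_rel s \<alpha> g Z'"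
  shows "Z = Z'"
proof -
  \<comment> \<open>Linearity makes \<open>Z - Z'\<close> a value at the zero series, where the
    polynomial can be cancelled by \<open>act2_inj\<close>.\<close>
  have "subst_rel s \<alpha> (g + act2 s (cst2 (- 1)) g) (Z + act2 s (poly_subst \<alpha> (cst2 (- 1))) Z')"
    by (intro subst_rel_add subst_rel_act2 \<alpha> Z)
  moreover have "act2 s (cst2 (- 1)) g = - g" for g by (simp add: act_simps fun_eq_iff)
  moreover have "poly_subst \<alpha> (cst2 (- 1)) = cst2 (- 1)"
    by (simp add: poly_subst_def poly2_pCons map_poly_pCons)
  ultimately have "subst_rel s \<alpha> 0 (Z - Z')" by simp
  then obtain f where f: "f \<noteq> 0" "act2 s (poly_subst \<alpha> f) (Z - Z') = subst s \<alpha> 0"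
    "Z - Z' \<in> laurent_laurent" by (auto simp: subst_rel_def)
  have "subst s \<alpha> 0 = 0" by (simp add: subst_def fun_eq_iff)
  with f act2_inj[of "poly_subst \<alpha> f" "Z - Z'"] \<alpha> show ?thesis by auto
qed

lemma subst_rel_eq_subst:
  assumes "\<alpha> \<noteq> 0" "subst_rel s \<alpha> g Z" "g \<in> trunc2"
  shows "Z = subst s \<alpha> g"
  using subst_rel_unique[OF assms(1,2) subst_rel_trunc2[OF assms(3)]] .

text \<open>The same polynomial serves before and after applying \<open>L\<close> to the
  coefficients. The cases of interest are multiplication by a scalar and a fixed coefficient of an
  operator standing to the left.\<close>

lemma subst_rel_linear:
  assumes t: "module t" and L: "\<And>r m. L (s r m) = t r (L m)" "\<And>m n. L (m + n) = L m + L n"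
    and Z: "subst_rel s \<alpha> g Z"
  shows "subst_rel t \<alpha> (\<lambda>i j. L (g i j)) (\<lambda>i j. L (Z i j))"
proof -
  have L0: "L 0 = 0" using L(2)[of 0 0] by simp
  obtain f where f: "f \<noteq> 0" "act2 s f g \<in> trunc2" "act2 s (poly_subst \<alpha> f) Z = subst s \<alpha> (act2 s f g)"
    and Z: "Z \<in> laurent_laurent"
    using Z by (auto simp: subst_rel_def)
  note act = act2_linear[OF t L]
  have "(\<lambda>i j. L (g i j)) \<in> trunc2" if "g \<in> trunc2" for g :: "int \<Rightarrow> int \<Rightarrow> 'u"
  proof -
    obtain N where "\<forall>i j. i < N \<or> j < N \<longrightarrow> g i j = 0" using \<open>g \<in> trunc2\<close> unfolding trunc2_def by blast
    then have "\<forall>i j. i < N \<or> j < N \<longrightarrow> L (g i j) = 0" by (simp add: L0)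
    then show ?thesis unfolding trunc2_def by blast
  qed
  moreover have "(\<lambda>i j. L (Z i j)) \<in> laurent_laurent"
  proof -
    obtain N where N: "\<forall>i<N. Z i = 0" using Z by (auto simp: laurent_def)
    have "\<exists>N. \<forall>j<N. L (Z i j) = 0" for i
    proof -
      obtain N where "\<forall>j<N. Z i j = 0" using Z unfolding laurent_def by blast
      then have "\<forall>j<N. L (Z i j) = 0" by (simp add: L0)
      then show ?thesis by blast
    qed
    moreover have "\<forall>i<N. (\<lambda>j. L (Z i j)) = 0" using N by (auto simp: L0)
    ultimately show ?thesis by (auto simp: laurent_def)
  qed
  ultimately show ?thesis
    using f unfolding subst_rel_def
    by (intro conjI exI[of _ f]) (auto simp: act subst_linear[OF t L])
qed

end

subsection \<open>Translation to curried series\<close>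

lemma sum_fun_apply: "(\<Sum>x\<in>A. f x) y = (\<Sum>x\<in>A. f x y)"
  by (induction A rule: infinite_finite_induct) auto

text \<open>No finiteness is assumed: the two supports correspond under \<open>h\<close>, so both
  sums fall back to the default value 0 together.\<close>

lemma Sum_any_reindex_inj:
  assumes "inj h" "\<And>x. g x \<noteq> 0 \<Longrightarrow> x \<in> range h"
  shows "Sum_any g = Sum_any (\<lambda>y. g (h y))"
proof -
  have eq: "{x. g x \<noteq> 0} = h ` {y. g (h y) \<noteq> 0}" using assms(2) by auto
  have inj: "inj_on h {y. g (h y) \<noteq> 0}" using assms(1) inj_on_subset by blast
  show ?thesis
    unfolding Sum_any.expand_set eq by (simp add: sum.reindex[OF inj])
qed

context cspace
begin

lemma series_mult_poly_series:
  "series_mult s (poly_series f) g (p, q) = act2 s f (\<lambda>q p. g (p, q)) q p"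
proof -
  let ?A = "SIGMA j:{..degree f}. {..degree (coeff f j)}"
  let ?h = "\<lambda>(j, i). (int i, int j)"
  have inj: "inj_on ?h ?A" by (auto simp: inj_on_def)
  have "series_mult s (poly_series f) g (p, q)
      = (\<Sum>ij\<in>?h ` ?A. s (poly_series f ij) (g ((p, q) - ij)))"
    unfolding series_mult_def
  proof (rule Sum_any.expand_superset)
    show "{ij. s (poly_series f ij) (g ((p, q) - ij)) \<noteq> 0} \<subseteq> ?h ` ?A"
    proof (clarsimp, goal_cases)
      case (1 i j)
      then have "poly_series f (i, j) \<noteq> 0" by auto
      then have ij: "i \<ge> 0" "j \<ge> 0" "coeff (coeff f (nat j)) (nat i) \<noteq> 0"
        by (auto simp: poly_series_def split: if_splits)
      then have "nat i \<le> degree (coeff f (nat j))" "nat j \<le> degree f"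
        by (auto intro!: le_degree)
      then show ?case using ij by (intro image_eqI[of _ _ "(nat j, nat i)"]) auto
    qed
  qed auto
  also have "\<dots> = (\<Sum>(j, i)\<in>?A. s (coeff (coeff f j) i) (g (p - int i, q - int j)))"
    by (subst sum.reindex[OF inj]) (auto simp: poly_series_def intro!: sum.cong)
  also have "\<dots> = act2 s f (\<lambda>q p. g (p, q)) q p"
    by (simp add: sum.Sigma[symmetric] poly_act_def sum_fun_apply)
  finally show ?thesis .
qed

lemma subst_shift_eq: "subst_shift s \<alpha> g (i, m) = subst s \<alpha> (\<lambda>q p. g (p, q)) i m"
proof -
  let ?h = "\<lambda>p. (p, m + i - p)"
  have "subst_shift s \<alpha> g (i, m) = (\<Sum>p. s (binom_series \<alpha> 1 (fst (?h p)) (m - snd (?h p), i)) (g (?h p)))"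
    unfolding subst_shift_def prod.case
    by (rule Sum_any_reindex_inj) (auto simp: inj_def binom_series_def split: if_splits)
  also have "\<dots> = subst s \<alpha> (\<lambda>q p. g (p, q)) i m"
    unfolding subst_def by (rule Sum_any.cong) (auto simp: binom_series_def bcoef_def)
  finally show ?thesis .
qed

text \<open>The action of the field C((x))((x_0)) on series, in curried form; it turns the inverse
  in the definition of \<open>Y_op\<close> into an equation for the action of a polynomial.\<close>

definition conv :: "(int \<Rightarrow> int \<Rightarrow> complex) \<Rightarrow> (int \<Rightarrow> int \<Rightarrow> 'u) \<Rightarrow> int \<Rightarrow> int \<Rightarrow> 'u" where
  "conv I G = (\<lambda>i m. series_mult s (case_prod I) (case_prod G) (i, m))"

lemma laurent_common:
  assumes "finite A" "\<And>x. x \<in> A \<Longrightarrow> g x \<in> laurent UNIV"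
  obtains B where "\<And>x n. x \<in> A \<Longrightarrow> n < B \<Longrightarrow> g x n = 0"
proof -
  have "\<exists>B. \<forall>x\<in>A. \<forall>n<B. g x n = 0"
    using assms
  proof (induction A rule: finite_induct)
    case (insert y A)
    obtain B where "\<forall>x\<in>A. \<forall>n<B. g x n = 0" using insert by auto
    moreover obtain B' where "\<forall>n<B'. g y n = 0" using insert.prems[of y] by (auto simp: laurent_def)
    ultimately show ?case by (intro exI[of _ "min B B'"]) auto
  qed auto
  then show ?thesis using that by blast
qed

text \<open>For a given outer exponent \<open>i\<close> only finitely many outer exponents of the
  factors contribute, so their inner bounds can be merged into one \<open>B\<close>, which depends
  on \<open>i\<close> but not on \<open>m\<close>.\<close>

lemma conv_support:
  assumes I: "I \<in> laurent_laurent" "\<And>i. i < N \<Longrightarrow> I i = 0" and G: "G \<in> laurent_laurent" "\<And>i. i < M \<Longrightarrow> G i = 0"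
  obtains B where "\<And>m. {k. s (case_prod I k) (case_prod G ((i, m) - k)) \<noteq> 0} \<subseteq> {N..i - M} \<times> {B..m - B}"
proof -
  obtain B where B: "\<And>x n. x \<in> {N..i - M} \<Longrightarrow> n < B \<Longrightarrow> I x n = 0"
    by (rule laurent_common[of "{N..i - M}" I]) (use I in \<open>auto simp: laurent_def\<close>)
  obtain B' where B': "\<And>x n. x \<in> {N..i - M} \<Longrightarrow> n < B' \<Longrightarrow> G (i - x) n = 0"
    by (rule laurent_common[of "{N..i - M}" "\<lambda>x. G (i - x)"]) (use G in \<open>auto simp: laurent_def\<close>)
  have "{k. s (case_prod I k) (case_prod G ((i, m) - k)) \<noteq> 0} \<subseteq> {N..i - M} \<times> {min B B'..m - min B B'}" for m
  proof
    fix k assume "k \<in> {k. s (case_prod I k) (case_prod G ((i, m) - k)) \<noteq> 0}"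
    moreover obtain x n where k: "k = (x, n)" by fastforce
    ultimately have nz: "I x n \<noteq> 0" "G (i - x) (m - n) \<noteq> 0" by auto
    have x: "x \<in> {N..i - M}"
      using nz I(2)[of x] G(2)[of "i - x"] by (cases "x < N"; cases "i - x < M") auto
    have "n \<ge> B" "m - n \<ge> B'" using nz B[OF x, of n] B'[OF x, of "m - n"] by force+
    then show "k \<in> {N..i - M} \<times> {min B B'..m - min B B'}" using x k by auto
  qed
  then show ?thesis using that by blast
qed

lemma laurent_laurent_bound: "Z \<in> laurent_laurent \<Longrightarrow> \<exists>N. \<forall>i<N. Z i = 0"
  by (auto simp: laurent_def)

lemma conv_finite:
  assumes I: "I \<in> laurent_laurent" and G: "G \<in> laurent_laurent"
  shows "finite {k. s (case_prod I k) (case_prod G ((i, m) - k)) \<noteq> 0}"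
proof -
  obtain N where N: "\<forall>i<N. I i = 0" using laurent_laurent_bound[OF I] by blast
  obtain M where M: "\<forall>i<M. G i = 0" using laurent_laurent_bound[OF G] by blast
  obtain B where "\<And>m. {k. s (case_prod I k) (case_prod G ((i, m) - k)) \<noteq> 0} \<subseteq> {N..i - M} \<times> {B..m - B}"
    using conv_support[OF I _ G, where N = N and M = M and i = i] N M by blast
  then show ?thesis by (rule finite_subset) auto
qed

lemma conv_low:
  assumes I: "I \<in> laurent_laurent" "\<And>i. i < N \<Longrightarrow> I i = 0" and G: "G \<in> laurent_laurent" "\<And>i. i < M \<Longrightarrow> G i = 0"
    and i: "i < N + M"
  shows "conv I G i = 0"
proof
  fix m
  obtain B where B: "\<And>m. {k. s (case_prod I k) (case_prod G ((i, m) - k)) \<noteq> 0} \<subseteq> {N..i - M} \<times> {B..m - B}"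
    using conv_support[OF I G, where i = i] by blast
  then have "{k. s (case_prod I k) (case_prod G ((i, m) - k)) \<noteq> 0} = {}" using i B[of m] by auto
  then show "conv I G i m = 0 m"
    by (simp only: conv_def series_mult_def Sum_any.expand_set sum.empty zero_fun_apply)
qed

lemma conv_in_laurent_laurent:
  assumes I: "I \<in> laurent_laurent" and G: "G \<in> laurent_laurent"
  shows "conv I G \<in> laurent_laurent"
proof -
  obtain N where N: "\<forall>i<N. I i = 0" using laurent_laurent_bound[OF I] by blast
  obtain M where M: "\<forall>i<M. G i = 0" using laurent_laurent_bound[OF G] by blast
  have "\<forall>i<N + M. conv I G i = 0" using conv_low[OF I _ G] N M by blast
  moreover have "\<exists>B. \<forall>m<B. conv I G i m = 0" for i
  proof -
    obtain B where B: "\<And>m. {k. s (case_prod I k) (case_prod G ((i, m) - k)) \<noteq> 0} \<subseteq> {N..i - M} \<times> {B..m - B}"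
      using conv_support[OF I _ G, where N = N and M = M and i = i] N M by blast
    have "conv I G i m = 0" if "m < 2 * B" for m
    proof -
      have "{k. s (case_prod I k) (case_prod G ((i, m) - k)) \<noteq> 0} = {}" using that B[of m] by auto
      then show ?thesis by (simp only: conv_def series_mult_def Sum_any.expand_set sum.empty)
    qed
    then show ?thesis by blast
  qed
  ultimately show ?thesis by (auto simp: laurent_def)
qed

lemma conv_add:
  assumes "I \<in> laurent_laurent" "J \<in> laurent_laurent" "G \<in> laurent_laurent"
  shows "conv (I + J) G = conv I G + conv J G"
proof (intro ext)
  fix i m
  have "s (case_prod (I + J) k) (case_prod G ((i, m) - k))
      = s (case_prod I k) (case_prod G ((i, m) - k)) + s (case_prod J k) (case_prod G ((i, m) - k))" for k
    by (cases k) (simp add: scale_left_distrib)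
  then show "conv (I + J) G i m = (conv I G + conv J G) i m"
    by (simp add: conv_def series_mult_def Sum_any.distrib conv_finite assms)
qed

lemma conv_scale:
  assumes "I \<in> laurent_laurent" "G \<in> laurent_laurent"
  shows "conv (\<lambda>i j. c * I i j) G = (\<lambda>i j. s c (conv I G i j))"
proof (intro ext)
  fix i m
  let ?f = "\<lambda>k. s (case_prod I k) (case_prod G ((i, m) - k))"
  have "conv (\<lambda>i j. c * I i j) G i m = (\<Sum>k\<in>{k. ?f k \<noteq> 0}. s c (?f k))"
    unfolding conv_def series_mult_def
    by (subst Sum_any.expand_superset[OF conv_finite[OF assms, of i m]])
      (auto simp: split_beta simp flip: scale_scale)
  then show "conv (\<lambda>i j. c * I i j) G i m = s c (conv I G i m)"
    by (simp add: conv_def series_mult_def Sum_any.expand_set scale_sum_right)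
qed

lemma conv_shift:
  "conv (\<lambda>i j. I (i - x) (j - y)) G = (\<lambda>i j. conv I G (i - x) (j - y))"
  unfolding conv_def series_mult_def
  by (intro ext, rule Sum_any.reindex_cong[where l = "\<lambda>k. k + (x, y)"])
    (auto simp: fun_eq_iff algebra_simps intro!: o_bij[of "\<lambda>k. k - (x, y)"])

lemma act2_conv:
  assumes "I \<in> laurent_laurent" "G \<in> laurent_laurent"
  shows "act2 s f (conv I G) = conv (act2 (*) f I) G"
proof -
  interpret C: cspace "(*)" by (simp add: cspace_def module_mult)
  let ?R = "\<lambda>x y. x \<in> laurent_laurent \<and> y = conv x G"
  have sub: "act2 (*) p x \<in> laurent_laurent" if "x \<in> laurent_laurent" for p and x :: "int \<Rightarrow> int \<Rightarrow> complex"
    by (rule C.P2.subspace_scale[OF C.subspace_laurent_laurent that])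
  have "?R (act2 (*) (poly2 cst2 [:[:0, 1:]:] [:0, 1:] f) I) (act2 s (poly2 cst2 [:[:0, 1:]:] [:0, 1:] f) (conv I G))"
  proof (rule poly2_semilinear[OF C.P2.module_axioms P2.module_axioms, where R = ?R], goal_cases)
    case (3 x y x' y')
    then show ?case using assms by (auto simp: conv_add C.P2.subspace_add[OF C.subspace_laurent_laurent])
  next
    case (4 a x x')
    then show ?case using assms sub[of x "cst2 a"] by (simp add: conv_scale act_simps C.act_simps)
  next
    case (5 x x')
    then show ?case using sub[of x "[:[:0, 1:]:]"] conv_shift[of x 0 1] by (simp add: act_simps C.act_simps)
  next
    case (6 x x')
    then show ?case using sub[of x "[:0, 1:]"] conv_shift[of x 1 0] by (simp add: act_simps C.act_simps)
  qed (use assms in auto)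
  then show ?thesis by simp
qed

lemma conv_one: "conv (\<lambda>i j. if i = 0 \<and> j = 0 then 1 else 0) G = G"
proof (intro ext)
  fix i m
  show "conv (\<lambda>i j. if i = 0 \<and> j = 0 then 1 else 0) G i m = G i m"
    unfolding conv_def series_mult_def
    by (subst Sum_any.expand_superset[of "{(0, 0)}"]) (auto split: if_splits)
qed

end

definition fls_coeffs :: "complex fls fls \<Rightarrow> int \<Rightarrow> int \<Rightarrow> complex" where
  "fls_coeffs X = (\<lambda>i j. fls_nth (fls_nth X i) j)"

lemma fls_coeffs_in_laurent_laurent: "fls_coeffs X \<in> laurent_laurent"
proof -
  have "\<exists>N. \<forall>n<N. fls_nth Y n = 0" for Y :: "complex fls"
    using fls_eq0_below_subdegree by blast
  moreover have "\<forall>n<fls_subdegree X. (\<lambda>j. fls_nth (fls_nth X n) j) = 0" by (simp add: fun_eq_iff)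
  ultimately show ?thesis unfolding laurent_def fls_coeffs_def by blast
qed

text \<open>Multiplication by the field element f(x_0 + \<alpha> x, x) is the action of the
  polynomial \<open>poly_subst \<alpha> f\<close> on coefficients. This is the link between the
  field of the definition and the polynomial actions of the proof.\<close>

lemma fls_coeffs_poly_shift: "act2 (*) (poly_subst \<alpha> f) (fls_coeffs X) = fls_coeffs (poly_shift \<alpha> f * X)"
proof -
  interpret C: cspace "(*) :: complex \<Rightarrow> complex \<Rightarrow> complex" by (simp add: cspace_def module_mult)
  let ?R = "\<lambda>x y. y = fls_coeffs x"
  have shift: "poly_shift \<alpha> f = poly2 (\<lambda>c. fls_const (fls_const c)) (fls_X + fls_const (fls_const \<alpha> * fls_X)) (fls_const fls_X) f"
    by (simp add: poly_shift_def poly2_def)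
  show ?thesis
    unfolding shift poly_subst_def
    by (rule poly2_semilinear[OF module_mult C.P2.module_axioms, where R = ?R])
      (auto simp: fls_coeffs_def C.act_simps fun_eq_iff distrib_right mult.assoc fls_X_times_conv_shift(1))
qed

lemma poly_shift_nonzero: "\<alpha> \<noteq> 0 \<Longrightarrow> f \<noteq> 0 \<Longrightarrow> poly_shift \<alpha> f \<noteq> 0"
proof
  interpret C: cspace "(*) :: complex \<Rightarrow> complex \<Rightarrow> complex" by (simp add: cspace_def module_mult)
  assume "\<alpha> \<noteq> 0" "f \<noteq> 0" "poly_shift \<alpha> f = 0"
  then have "act2 (*) (poly_subst \<alpha> f) (fls_coeffs 1) = 0"
    by (simp add: fls_coeffs_poly_shift) (simp add: fls_coeffs_def fun_eq_iff)
  then have "fls_coeffs 1 = 0"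
    using C.act2_inj[of "poly_subst \<alpha> f" "fls_coeffs 1"] fls_coeffs_in_laurent_laurent \<open>\<alpha> \<noteq> 0\<close> \<open>f \<noteq> 0\<close>
    by (simp only: poly_subst_eq_0_iff simp_thms)
  from fun_cong[OF fun_cong[OF this, of 0], of 0] show False by (simp add: fls_coeffs_def)
qed

section \<open>Vertex operators as values of the partial substitution\<close>

lemma E_spaceD:
  assumes "a \<in> E_space s"
  shows "a (u + v) = a u + a v" "a (s c u) n = s c (a u n)" "\<exists>N. \<forall>n<N. a u n = 0"
  using assms by (auto simp: E_space_def hom_laurent_def linear_on_def series_scale_def laurent_def)

lemma E_space_zero: "a \<in> E_space s \<Longrightarrow> a 0 = 0"
  using E_spaceD(1)[of a s 0 0] by simp

lemma E_spaceI:
  assumes "\<And>u v n. a (u + v) n = a u n + a v n" "\<And>c u n. a (s c u) n = s c (a u n)" "\<And>u. \<exists>N. \<forall>n<N. a u n = 0"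
  shows "a \<in> E_space s"
  using assms by (auto simp: E_space_def hom_laurent_def linear_on_def series_scale_def laurent_def)

context cspace
begin

lemma compat_poly_iff:
  "compat_poly s a b f \<longleftrightarrow> f \<noteq> 0 \<and> (\<forall>w. act2 s f (\<lambda>q p. a (b w q) p) \<in> trunc2)"
proof -
  have "series_mult s (poly_series f) (prod_ab a b w) \<in> laurent2
      \<longleftrightarrow> act2 s f (\<lambda>q p. a (b w q) p) \<in> trunc2" for w
    unfolding laurent2_def trunc2_def
    by (simp add: series_mult_poly_series prod_ab_def) blast
  then show ?thesis by (simp add: compat_poly_def)
qed

lemma Y_series_eq:
  "Y_series s f \<alpha> a b w (i, m)
    = conv (fls_coeffs (inverse (poly_shift \<alpha> f))) (subst s \<alpha> (act2 s f (\<lambda>q p. a (b w q) p))) i m"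
proof -
  have "subst_shift s \<alpha> (series_mult s (poly_series f) (prod_ab a b w))
      = case_prod (subst s \<alpha> (act2 s f (\<lambda>q p. a (b w q) p)))"
    by (auto simp: fun_eq_iff subst_shift_eq series_mult_poly_series prod_ab_def)
  moreover have "iota_inverse \<alpha> f = case_prod (fls_coeffs (inverse (poly_shift \<alpha> f)))"
    by (auto simp: fun_eq_iff iota_inverse_def fls_coeffs_def)
  ultimately show ?thesis by (simp add: Y_series_def conv_def)
qed

lemma Y_op_eq: "Y_op s \<alpha> a b i w m = Y_series s (SOME f. compat_poly s a b f) \<alpha> a b w (i, m)"
  by (simp add: Y_op_def nth_prod_def)

text \<open>Multiplying by \<open>poly_subst \<alpha> f\<close> undoes the inverse in the
  definition. Together with \<open>subst_rel_unique\<close> this characterises \<open>Y_op\<close>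
  without reference to the chosen polynomial.\<close>

lemma Y_op_subst_rel:
  assumes \<alpha>: "\<alpha> \<noteq> 0" and c: "compatible s a b"
  shows "subst_rel s \<alpha> (\<lambda>q p. a (b w q) p) (\<lambda>i. Y_op s \<alpha> a b i w)"
proof -
  define f where "f = (SOME f. compat_poly s a b f)"
  have "compat_poly s a b f" unfolding f_def using c by (auto simp: compatible_def intro: someI)
  then have f: "f \<noteq> 0" "act2 s f (\<lambda>q p. a (b w q) p) \<in> trunc2" by (auto simp: compat_poly_iff)
  let ?G = "subst s \<alpha> (act2 s f (\<lambda>q p. a (b w q) p))"
  let ?I = "fls_coeffs (inverse (poly_shift \<alpha> f))"
  have Y: "(\<lambda>i. Y_op s \<alpha> a b i w) = conv ?I ?G"
    by (simp add: fun_eq_iff Y_op_eq Y_series_eq f_def)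
  have LL: "?I \<in> laurent_laurent" "?G \<in> laurent_laurent"
    using fls_coeffs_in_laurent_laurent subst_in_laurent_laurent[OF f(2)] by auto
  have one: "fls_coeffs 1 = (\<lambda>i j. if i = 0 \<and> j = 0 then 1 else 0)"
    by (auto simp: fls_coeffs_def fun_eq_iff)
  have "act2 s (poly_subst \<alpha> f) (conv ?I ?G) = ?G"
    using poly_shift_nonzero[OF \<alpha> f(1)]
    by (simp add: act2_conv[OF LL] fls_coeffs_poly_shift one conv_one)
  then show ?thesis
    unfolding subst_rel_def Y using f conv_in_laurent_laurent[OF LL] by blast
qed

text \<open>A substituted series starts at x_0^0, so the order of the inverse of the shifted
  polynomial is a lower bound. It depends on the polynomial only and is therefore uniform in
  \<open>w\<close>.\<close>

lemma Y_op_low: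
  assumes "compatible s a b"
  shows "\<exists>N. \<forall>i<N. Y_op s \<alpha> a b i = 0"
proof -
  define f where "f = (SOME f. compat_poly s a b f)"
  have "compat_poly s a b f" unfolding f_def using assms by (auto simp: compatible_def intro: someI)
  then have f: "act2 s f (\<lambda>q p. a (b w q) p) \<in> trunc2" for w by (auto simp: compat_poly_iff)
  let ?G = "\<lambda>w. subst s \<alpha> (act2 s f (\<lambda>q p. a (b w q) p))"
  let ?I = "fls_coeffs (inverse (poly_shift \<alpha> f))"
  obtain N where N: "\<forall>i<N. ?I i = 0" using laurent_laurent_bound[OF fls_coeffs_in_laurent_laurent] by blast
  have "conv ?I (?G w) i = 0" if "i < N" for i w
    by (rule conv_low[OF fls_coeffs_in_laurent_laurent _ subst_in_laurent_laurent[OF f], where N = N and M = 0])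
      (use N that in \<open>auto simp: subst_neg fun_eq_iff\<close>)
  then have "\<forall>i<N. Y_op s \<alpha> a b i = 0"
    by (auto simp: fun_eq_iff Y_op_eq Y_series_eq f_def)
  then show ?thesis by blast
qed

lemma Y_op_in_E_space:
  assumes \<alpha>: "\<alpha> \<noteq> 0" and c: "compatible s a b" and ab: "a \<in> E_space s" "b \<in> E_space s"
  shows "Y_op s \<alpha> a b i \<in> E_space s"
proof (rule E_spaceI)
  note rel = Y_op_subst_rel[OF \<alpha> c]
  fix u v c n
  have "(\<lambda>i. Y_op s \<alpha> a b i (u + v)) = (\<lambda>i. Y_op s \<alpha> a b i u) + (\<lambda>i. Y_op s \<alpha> a b i v)"
    using subst_rel_add[OF \<alpha> rel[of u] rel[of v]]
    by (intro subst_rel_unique[OF \<alpha> rel]) (simp add: E_spaceD[OF ab(1)] E_spaceD[OF ab(2)] plus_fun_def)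
  then show "Y_op s \<alpha> a b i (u + v) n = Y_op s \<alpha> a b i u n + Y_op s \<alpha> a b i v n"
    by (simp add: fun_eq_iff)
  have "(\<lambda>i. Y_op s \<alpha> a b i (s c u)) = (\<lambda>i n. s c (Y_op s \<alpha> a b i u n))"
    using subst_rel_linear[OF module_axioms _ _ rel[of u], of "s c"]
    by (intro subst_rel_unique[OF \<alpha> rel])
      (simp add: E_spaceD[OF ab(1)] E_spaceD[OF ab(2)] scale_right_distrib mult.commute)
  then show "Y_op s \<alpha> a b i (s c u) n = s c (Y_op s \<alpha> a b i u n)"
    by (simp add: fun_eq_iff)
  show "\<exists>N. \<forall>n<N. Y_op s \<alpha> a b i u n = 0"
    using subst_rel_laurent[OF rel[of u]] by (auto simp: laurent_def)
qed

end

section \<open>Products of three operators\<close>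

text \<open>The linear form \<open>a x + b y + c z\<close>, where \<open>x\<close>, \<open>y\<close>, \<open>z\<close> shift the first, second and
  third index.\<close>

definition lin3 :: "complex \<Rightarrow> complex \<Rightarrow> complex \<Rightarrow> complex poly poly poly" where
  "lin3 a b c = [:[:[:0, c:], [:b:]:], cst2 a:]"

text \<open>The locality polynomials of (a,b), (a,c) and (b,c) at three common points. A
  substitution changes only the points, so the whole product is carried along by rewriting linear
  forms.\<close>

definition tri where
  "tri f g h y1 y2 y3 = poly2 cst3 y1 y2 f * poly2 cst3 y1 y3 g * poly2 cst3 y2 y3 h"

text \<open>The operator applied first has the outermost index, as lower truncation of an iterated
  product demands; the order is x, y_2, y_1.\<close>

definition triple :: "('w \<Rightarrow> int \<Rightarrow> 'w) \<Rightarrow> ('w \<Rightarrow> int \<Rightarrow> 'w) \<Rightarrow> ('w \<Rightarrow> int \<Rightarrow> 'w) \<Rightarrow> 'w \<Rightarrow> int \<Rightarrow> int \<Rightarrow> int \<Rightarrow> 'w" where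
  "triple a b c w = (\<lambda>q p2 p1. a (b (c w q) p2) p1)"

definition locality_poly ::
    "(complex \<Rightarrow> 'w \<Rightarrow> 'w) \<Rightarrow> complex poly poly \<Rightarrow> ('w::ab_group_add \<Rightarrow> int \<Rightarrow> 'w) \<Rightarrow> ('w \<Rightarrow> int \<Rightarrow> 'w) \<Rightarrow> bool" where
  "locality_poly s f a b \<longleftrightarrow> f \<noteq> 0 \<and>
    (\<forall>w. act2 s f (\<lambda>q p. a (b w q) p) = act2 s f (\<lambda>q p. b (a w p) q))"

definition poly_swap :: "complex poly poly \<Rightarrow> complex poly poly" where
  "poly_swap f = poly2 cst2 [:0, 1:] [:[:0, 1:]:] f"

lemma poly2_poly_swap [simp]: "scalar_hom c \<Longrightarrow> poly2 c u v (poly_swap f) = poly2 c v u f"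
  by (simp add: poly_swap_def poly2_poly2) (simp add: poly2_pCons map_poly_pCons scalar_hom_def)

lemma poly_swap_eq_0_iff [simp]: "poly_swap f = 0 \<longleftrightarrow> f = 0"
proof
  have "poly2 cst2 [:0, 1:] [:[:0, 1:]:] (poly_swap f) = f" by (simp only: poly2_poly_swap scalar_hom_const poly2_id)
  moreover assume "poly_swap f = 0"
  ultimately show "f = 0" by (simp only: poly2_0)
qed (simp add: poly_swap_def)

context cspace
begin

lemma module_series_scale: "module (series_scale s)"
  using module_pointwise[OF module_axioms] by (simp add: series_scale_def[abs_def])

lemma cspace_series_scale: "cspace (series_scale s)"
  by (simp add: cspace_def module_series_scale)

lemma act3_lin3:
  "act3 s (lin3 a b c) T = (\<lambda>i j k. s a (T (i - 1) j k) + s b (T i (j - 1) k) + s c (T i j (k - 1)))"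
  by (simp add: lin3_def act_simps fun_eq_iff algebra_simps)

lemma act3_cst3: "act3 s (cst3 a) T = (\<lambda>i j k. s a (T i j k))"
  by (simp add: act_simps fun_eq_iff)

lemma act3_act3_commute: "act3 s p (act3 s q T) = act3 s q (act3 s p T)"
  by (simp add: mult.commute)

lemmas semilinear3 = poly2_semilinear[OF P3.module_axioms P3.module_axioms, where c = cst3 and c' = cst3]
lemmas semilinear23 = poly2_semilinear[OF P2.module_axioms P3.module_axioms, where c = cst2 and c' = cst3]
lemmas semilinear32 = poly2_semilinear[OF P3.module_axioms P2.module_axioms, where c = cst3 and c' = cst2]

text \<open>This and the next three lemmas let a polynomial in two variables act on a series in
  three, either with one index as a spectator or underneath an operator applied to the coefficients.
  They transport the locality of a pair into a product of three operators.\<close>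

lemma act3_bystander_first:
  "act3 s (poly2 cst3 (lin3 0 0 1) (lin3 0 1 0) f) T q = act2 s f (T q)"
proof -
  have "act2 s (poly2 cst2 [:[:0, 1:]:] [:0, 1:] f) (T q) = act3 s (poly2 cst3 (lin3 0 0 1) (lin3 0 1 0) f) T q"
    by (rule semilinear32[where R = "\<lambda>x y. y = x q"]) (auto simp: act3_lin3 act3_cst3 act_simps)
  then show ?thesis by simp
qed

lemma act3_bystander_middle:
  "(\<lambda>q p1. act3 s (poly2 cst3 (lin3 0 0 1) (lin3 1 0 0) f) T q p2 p1) = act2 s f (\<lambda>q p1. T q p2 p1)"
proof -
  have "act2 s (poly2 cst2 [:[:0, 1:]:] [:0, 1:] f) (\<lambda>q p1. T q p2 p1)
      = (\<lambda>q p1. act3 s (poly2 cst3 (lin3 0 0 1) (lin3 1 0 0) f) T q p2 p1)"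
    by (rule semilinear32[where R = "\<lambda>x y. y = (\<lambda>q p1. x q p2 p1)"])
      (auto simp: act3_lin3 act3_cst3 act_simps fun_eq_iff)
  then show ?thesis by simp
qed

lemma act3_map_inner:
  assumes a: "a \<in> E_space s"
  shows "act3 s (poly2 cst3 (lin3 0 1 0) (lin3 1 0 0) f) (\<lambda>q p2. a (g q p2)) = (\<lambda>q p2. a (act2 s f g q p2))"
proof -
  have "act3 s (poly2 cst3 (lin3 0 1 0) (lin3 1 0 0) f) (\<lambda>q p2. a (g q p2))
      = (\<lambda>q p2. a (act2 s (poly2 cst2 [:[:0, 1:]:] [:0, 1:] f) g q p2))"
    by (rule semilinear23[where R = "\<lambda>x y. y = (\<lambda>q p2. a (x q p2))"])
      (auto simp: act3_lin3 act3_cst3 act_simps fun_eq_iff E_spaceD[OF a])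
  then show ?thesis by simp
qed

lemma act3_map_middle:
  assumes b: "b \<in> E_space s"
  shows "act3 s (poly2 cst3 (lin3 0 0 1) (lin3 1 0 0) f) (\<lambda>q p2 p1. b (g q p1) p2)
    = (\<lambda>q p2 p1. b (act2 s f g q p1) p2)"
proof -
  have "act3 s (poly2 cst3 (lin3 0 0 1) (lin3 1 0 0) f) (\<lambda>q p2 p1. b (g q p1) p2)
      = (\<lambda>q p2 p1. b (act2 s (poly2 cst2 [:[:0, 1:]:] [:0, 1:] f) g q p1) p2)"
    by (rule semilinear23[where R = "\<lambda>x y. y = (\<lambda>q p2 p1. b (x q p1) p2)"])
      (auto simp: act3_lin3 act3_cst3 act_simps fun_eq_iff E_spaceD[OF b])
  then show ?thesis by simp
qed

lemma act3_flip_inner: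
  "act3 s (poly2 cst3 (lin3 a b c) (lin3 a' b' c') f) (\<lambda>i j k. T i k j)
    = (\<lambda>i j k. act3 s (poly2 cst3 (lin3 a c b) (lin3 a' c' b') f) T i k j)"
  by (rule semilinear3[where R = "\<lambda>x y. y = (\<lambda>i j k. x i k j)"])
    (auto simp: act3_lin3 act3_cst3 fun_eq_iff)

lemma act3_flip_outer:
  "act3 s (poly2 cst3 (lin3 a b c) (lin3 a' b' c') f) (\<lambda>i j k. T j i k)
    = (\<lambda>i j k. act3 s (poly2 cst3 (lin3 b a c) (lin3 b' a' c') f) T j i k)"
  by (rule semilinear3[where R = "\<lambda>x y. y = (\<lambda>i j k. x j i k)"])
    (auto simp: act3_lin3 act3_cst3 fun_eq_iff)

lemma act3_tri:
  "act3 s (tri f g h y1 y2 y3) T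
    = act3 s (poly2 cst3 y1 y2 f) (act3 s (poly2 cst3 y1 y3 g) (act3 s (poly2 cst3 y2 y3 h) T))"
  by (simp add: tri_def mult.assoc)

lemma act3_tri_flip_inner:
  "act3 s (tri f g h (lin3 a b c) (lin3 a' b' c') (lin3 a'' b'' c'')) (\<lambda>i j k. T i k j)
    = (\<lambda>i j k. act3 s (tri f g h (lin3 a c b) (lin3 a' c' b') (lin3 a'' c'' b'')) T i k j)"
proof -
  let ?H = "act3 s (poly2 cst3 (lin3 a' c' b') (lin3 a'' c'' b'') h) T"
  let ?G = "act3 s (poly2 cst3 (lin3 a c b) (lin3 a'' c'' b'') g) ?H"
  show ?thesis
    unfolding act3_tri act3_flip_inner[where T = T] act3_flip_inner[where T = ?H] act3_flip_inner[where T = ?G] ..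
qed

lemma act3_tri_flip_outer:
  "act3 s (tri f g h (lin3 a b c) (lin3 a' b' c') (lin3 a'' b'' c'')) (\<lambda>i j k. T j i k)
    = (\<lambda>i j k. act3 s (tri f g h (lin3 b a c) (lin3 b' a' c') (lin3 b'' a'' c'')) T j i k)"
proof -
  let ?H = "act3 s (poly2 cst3 (lin3 b' a' c') (lin3 b'' a'' c'') h) T"
  let ?G = "act3 s (poly2 cst3 (lin3 b a c) (lin3 b'' a'' c'') g) ?H"
  show ?thesis
    unfolding act3_tri act3_flip_outer[where T = T] act3_flip_outer[where T = ?H] act3_flip_outer[where T = ?G] ..
qed

lemma act3_low:
  assumes "\<And>i. i < N \<Longrightarrow> T i = 0" "i < N"
  shows "act3 s p T i = 0"
  using P3.subspace_scale[OF P2.subspace_low_coeffs, of T N p] assms by auto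

lemma act3_low_middle:
  assumes "\<And>i j. j < N \<Longrightarrow> T i j = 0" "j < N"
  shows "act3 s p T i j = 0"
  using P3.subspace_scale[OF P2.subspace_all_coeffs[OF P1.subspace_low_coeffs], of T N p] assms by auto

lemma act3_low_inner:
  assumes "\<And>i j k. k < N \<Longrightarrow> T i j k = 0" "k < N"
  shows "act3 s p T i j k = 0"
  using P3.subspace_scale[OF P2.subspace_all_coeffs[OF P1.subspace_all_coeffs[OF subspace_low_coeffs]], of T N p]
    assms by auto

lemma act2_low:
  assumes "\<And>i. i < N \<Longrightarrow> T i = 0" "i < N"
  shows "act2 s p T i = 0"
  using P2.subspace_scale[OF P1.subspace_low_coeffs, of T N p] assms by auto

lemma act2_low_inner:
  assumes "\<And>i j. j < N \<Longrightarrow> T i j = 0" "j < N"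
  shows "act2 s p T i j = 0"
  using P2.subspace_scale[OF P1.subspace_all_coeffs[OF subspace_low_coeffs], of T N p] assms by auto

lemma trunc2_values_scale:
  assumes "T \<in> trunc2"
  shows "act3 s p T \<in> trunc2"
proof -
  obtain N where "\<forall>i j. i < N \<or> j < N \<longrightarrow> T i j = 0" using assms unfolding trunc2_def by blast
  then have "\<And>i. i < N \<Longrightarrow> T i = 0" "\<And>i j. j < N \<Longrightarrow> T i j = 0" by (auto simp: fun_eq_iff)
  from act3_low[of N T, OF this(1)] act3_low_middle[of N T, OF this(2)]
  have "\<forall>i j. i < N \<or> j < N \<longrightarrow> act3 s p T i j = 0" by simp
  then show ?thesis unfolding trunc2_def by blast
qed

subsection \<open>Locality\<close>

lemma mutually_quasi_local_iff: "mutually_quasi_local s a b \<longleftrightarrow> (\<exists>f. locality_poly s f a b)"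
  unfolding mutually_quasi_local_def locality_poly_def
  by (intro ex_cong1 conj_cong refl all_cong1)
    (auto simp: fun_eq_iff series_mult_poly_series prod_ab_def prod_ba_def)

lemma act2_flip: "act2 s (poly_swap f) (\<lambda>i j. g j i) = (\<lambda>i j. act2 s f g j i)"
proof -
  have "act2 s (poly_swap f) (\<lambda>i j. g j i) = (\<lambda>i j. act2 s (poly2 cst2 [:[:0, 1:]:] [:0, 1:] f) g j i)"
    unfolding poly_swap_def
    by (rule poly2_semilinear[OF P2.module_axioms P2.module_axioms, where R = "\<lambda>x y. y = (\<lambda>i j. x j i)"])
      (auto simp: act_simps fun_eq_iff)
  then show ?thesis by simp
qed

lemma locality_poly_swap:
  assumes "locality_poly s f a b"
  shows "locality_poly s (poly_swap f) b a"
proof -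
  have "act2 s (poly_swap f) (\<lambda>q p. b (a w q) p) = act2 s (poly_swap f) (\<lambda>q p. a (b w p) q)" for w
    using assms act2_flip[of f "\<lambda>q p. a (b w q) p"] act2_flip[of f "\<lambda>q p. b (a w p) q"]
    by (simp add: locality_poly_def)
  then show ?thesis using assms by (simp add: locality_poly_def)
qed

lemma mutually_quasi_local_sym: "mutually_quasi_local s a b \<Longrightarrow> mutually_quasi_local s b a"
  using locality_poly_swap by (auto simp: mutually_quasi_local_iff)

lemma locality_poly_compat:
  assumes "locality_poly s f a b" and ab: "a \<in> E_space s" "b \<in> E_space s"
  shows "compat_poly s a b f"
proof -
  have "act2 s f (\<lambda>q p. a (b w q) p) \<in> trunc2" for w
  proof -
    let ?g = "\<lambda>q p. a (b w q) p"
    have eq: "act2 s f ?g = act2 s f (\<lambda>q p. b (a w p) q)" using assms by (simp add: locality_poly_def)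
    obtain N M where N: "\<forall>n<N. b w n = 0" and M: "\<forall>n<M. a w n = 0"
      using E_spaceD(3)[OF ab(2)] E_spaceD(3)[OF ab(1)] by blast
    \<comment> \<open>The operator applied first supplies the bound on its own exponent:
      \<open>b\<close> as the product stands, and \<open>a\<close> after the exchange allowed by
      locality.\<close>
    have 1: "act2 s f ?g i = 0" if "i < N" for i
      by (rule act2_low[OF _ that]) (simp add: N E_space_zero[OF ab(1)] fun_eq_iff)
    have 2: "act2 s f ?g i j = 0" if "j < M" for i j
      unfolding eq by (rule act2_low_inner[OF _ that]) (simp add: M E_space_zero[OF ab(2)])
    have "\<forall>i j. i < min N M \<or> j < min N M \<longrightarrow> act2 s f ?g i j = 0"
      using 1 2 by auto
    then show ?thesis unfolding trunc2_def by blast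
  qed
  then show ?thesis using assms by (simp add: compat_poly_iff locality_poly_def)
qed

lemma quasi_local_compatible:
  assumes "mutually_quasi_local s a b" "a \<in> E_space s" "b \<in> E_space s"
  shows "compatible s a b"
  using assms locality_poly_compat unfolding compatible_def mutually_quasi_local_iff by blast

text \<open>With the three locality polynomials in front, the operators may be reordered, which moves
  each of the variables to the rightmost position in turn.\<close>

context
  fixes a b c :: "'u \<Rightarrow> int \<Rightarrow> 'u" and f g h
  assumes abc: "a \<in> E_space s" "b \<in> E_space s" "c \<in> E_space s"
    and loc: "locality_poly s f a b" "locality_poly s g a c" "locality_poly s h b c"
begin

private abbreviation "F \<equiv> poly2 cst3 (lin3 0 0 1) (lin3 0 1 0) f"
private abbreviation "G \<equiv> poly2 cst3 (lin3 0 0 1) (lin3 1 0 0) g"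
private abbreviation "H \<equiv> poly2 cst3 (lin3 0 1 0) (lin3 1 0 0) h"

private lemma H_bc: "act3 s H (\<lambda>q p2 p1. a (b (c w q) p2) p1) = act3 s H (\<lambda>q p2 p1. a (c (b w p2) q) p1)"
  using act3_map_inner[OF abc(1), of h "\<lambda>q p2. b (c w q) p2"] act3_map_inner[OF abc(1), of h "\<lambda>q p2. c (b w p2) q"] loc(3)
  by (simp add: locality_poly_def)

private lemma F_ab: "act3 s F (\<lambda>q p2 p1. a (b (c w q) p2) p1) = act3 s F (\<lambda>q p2 p1. b (a (c w q) p1) p2)"
  using act3_bystander_first[of f "\<lambda>q p2 p1. a (b (c w q) p2) p1"]
    act3_bystander_first[of f "\<lambda>q p2 p1. b (a (c w q) p1) p2"] loc(1)
  by (simp add: locality_poly_def fun_eq_iff)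

private lemma G_ac: "act3 s G (\<lambda>q p2 p1. b (a (c w q) p1) p2) = act3 s G (\<lambda>q p2 p1. b (c (a w p1) q) p2)"
  using act3_map_middle[OF abc(2), of g "\<lambda>q p1. a (c w q) p1"] act3_map_middle[OF abc(2), of g "\<lambda>q p1. c (a w p1) q"] loc(2)
  by (simp add: locality_poly_def)

private lemma G_ac': "act3 s G (\<lambda>q p2 p1. a (c (b w p2) q) p1) = act3 s G (\<lambda>q p2 p1. c (a (b w p2) p1) q)"
proof -
  have "(\<lambda>q p1. act3 s G (\<lambda>q p2 p1. a (c (b w p2) q) p1) q p2 p1)
      = (\<lambda>q p1. act3 s G (\<lambda>q p2 p1. c (a (b w p2) p1) q) q p2 p1)" for p2
    unfolding act3_bystander_middle using loc(2) by (simp add: locality_poly_def)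
  then show ?thesis by (simp add: fun_eq_iff)
qed

lemma tri_rotate:
  "act3 s (tri f g h (lin3 0 0 1) (lin3 0 1 0) (lin3 1 0 0)) (triple a b c w)
    = act3 s (tri f g h (lin3 0 0 1) (lin3 0 1 0) (lin3 1 0 0)) (\<lambda>q p2 p1. c (a (b w p2) p1) q)"
proof -
  \<comment> \<open>The polynomial of the pair about to be exchanged has to stand innermost; the
    three polynomials commute, so each is brought there in turn.\<close>
  have "act3 s F (act3 s G (act3 s H (triple a b c w)))
      = act3 s F (act3 s H (act3 s G (\<lambda>q p2 p1. a (c (b w p2) q) p1)))"
    unfolding triple_def H_bc by (simp only: act3_act3_commute[of G H])
  also have "\<dots> = act3 s F (act3 s G (act3 s H (\<lambda>q p2 p1. c (a (b w p2) p1) q)))"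
    unfolding G_ac' by (simp only: act3_act3_commute[of G H])
  finally show ?thesis by (simp only: act3_tri)
qed

lemma tri_flip:
  "act3 s (tri f g h (lin3 0 0 1) (lin3 0 1 0) (lin3 1 0 0)) (triple a b c w)
    = (\<lambda>q p2 p1. act3 s (tri (poly_swap f) h g (lin3 0 0 1) (lin3 0 1 0) (lin3 1 0 0)) (triple b a c w) q p1 p2)"
proof -
  have "act3 s F (act3 s G (act3 s H (triple a b c w)))
      = act3 s G (act3 s H (act3 s F (triple a b c w)))"
    by (simp add: mult_ac)
  also have "\<dots> = act3 s G (act3 s H (act3 s F (\<lambda>q p2 p1. triple b a c w q p1 p2)))"
    unfolding triple_def F_ab ..
  also have "\<dots> = act3 s F (act3 s H (act3 s G (\<lambda>q p2 p1. triple b a c w q p1 p2)))"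
    by (simp add: mult_ac)
  also have "\<dots> = act3 s (tri (poly_swap f) h g (lin3 0 1 0) (lin3 0 0 1) (lin3 1 0 0)) (\<lambda>q p2 p1. triple b a c w q p1 p2)"
    by (simp only: act3_tri poly2_poly_swap scalar_hom_const)
  also have "\<dots> = (\<lambda>q p2 p1. act3 s (tri (poly_swap f) h g (lin3 0 0 1) (lin3 0 1 0) (lin3 1 0 0)) (triple b a c w) q p1 p2)"
    by (rule act3_tri_flip_inner)
  finally show ?thesis by (simp only: act3_tri)
qed

lemma tri_trunc3:
  "act3 s (tri f g h (lin3 0 0 1) (lin3 0 1 0) (lin3 1 0 0)) (triple a b c w) \<in> trunc3"
proof -
  let ?T = "act3 s (tri f g h (lin3 0 0 1) (lin3 0 1 0) (lin3 1 0 0)) (triple a b c w)"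
  note E0 = E_space_zero[OF abc(1)] E_space_zero[OF abc(2)] E_space_zero[OF abc(3)]
  obtain N1 N2 N3 where N: "\<forall>n<N1. a w n = 0" "\<forall>n<N2. b w n = 0" "\<forall>n<N3. c w n = 0"
    using E_spaceD(3)[OF abc(1)] E_spaceD(3)[OF abc(2)] E_spaceD(3)[OF abc(3)] by metis
  have 3: "?T i = 0" if "i < N3" for i
    by (rule act3_low[OF _ that]) (simp add: triple_def N E0 fun_eq_iff)
  have 2: "?T i j = 0" if "j < N2" for i j
    unfolding tri_rotate by (rule act3_low_middle[OF _ that]) (simp add: N E0 fun_eq_iff)
  have "?T = act3 s H (act3 s F (act3 s G (\<lambda>q p2 p1. b (a (c w q) p1) p2)))"
  proof -
    have "?T = act3 s G (act3 s H (act3 s F (\<lambda>q p2 p1. a (b (c w q) p2) p1)))"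
      by (simp add: act3_tri triple_def mult_ac)
    then show ?thesis unfolding F_ab by (simp add: mult_ac)
  qed
  then have T1: "?T = act3 s H (act3 s F (act3 s G (\<lambda>q p2 p1. b (c (a w p1) q) p2)))"
    unfolding G_ac .
  have 1: "?T i j k = 0" if "k < N1" for i j k
    unfolding T1 P3.scale_scale by (rule act3_low_inner[OF _ that]) (simp add: N E0)
  let ?N = "min N1 (min N2 N3)"
  have "\<forall>i j k. i < ?N \<or> j < ?N \<or> k < ?N \<longrightarrow> ?T i j k = 0"
    using 1 2 3 by simp
  then show ?thesis unfolding trunc3_def by blast
qed

end

end

subsection \<open>Iterated substitutions\<close>

text \<open>With y = \<gamma> x_2 + x_0, the left side is the coefficient of x_0^i x_2^j in
  (\<gamma>\<beta> x + y)^p (\<beta> x + x_2)^q, and the right side the same coefficient when z =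
  \<beta> x + x_2 is kept together in (\<gamma> z + x_0)^p z^q. The calculation is trinomial
  revision followed by Vandermonde convolution.\<close>

lemma bcoef_compose:
  assumes "\<beta> \<noteq> 0" "\<gamma> \<noteq> 0"
  shows "(\<Sum>l\<in>{0..i + j}. bcoef \<gamma> l i * bcoef (\<gamma> * \<beta>) p l * bcoef \<beta> q (i + j - l))
    = bcoef \<gamma> p i * bcoef \<beta> (p + q - i) j"
proof (cases "i \<ge> 0 \<and> j \<ge> 0")
  case True
  then obtain a b where ab: "i = int a" "j = int b" by (auto elim!: nonneg_int_cases)
  have low: "bcoef \<gamma> l i = 0" if l: "0 \<le> l" "l < i" for l
  proof -
    obtain m where "l = int m" using nonneg_int_cases[OF l(1)] by blast
    then show ?thesis using l ab by (simp add: bcoef_def flip: binomial_gbinomial)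
  qed
  have "(\<Sum>l\<in>{0..i + j}. bcoef \<gamma> l i * bcoef (\<gamma> * \<beta>) p l * bcoef \<beta> q (i + j - l))
      = (\<Sum>l\<in>(\<lambda>k. int (a + k)) ` {0..b}. bcoef \<gamma> l i * bcoef (\<gamma> * \<beta>) p l * bcoef \<beta> q (i + j - l))"
  proof (rule sum.mono_neutral_right)
    show "\<forall>l\<in>{0..i + j} - (\<lambda>k. int (a + k)) ` {0..b}. bcoef \<gamma> l i * bcoef (\<gamma> * \<beta>) p l * bcoef \<beta> q (i + j - l) = 0"
    proof
      fix l assume l: "l \<in> {0..i + j} - (\<lambda>k. int (a + k)) ` {0..b}"
      have "l < i"
      proof (rule ccontr)
        assume "\<not> l < i"
        then have "l = int (a + nat (l - i))" "nat (l - i) \<in> {0..b}" using l ab by auto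
        then show False using l by blast
      qed
      then show "bcoef \<gamma> l i * bcoef (\<gamma> * \<beta>) p l * bcoef \<beta> q (i + j - l) = 0" using l low by simp
    qed
  qed (use ab in auto)
  also have "\<dots> = (\<Sum>k\<in>{0..b}. bcoef \<gamma> (int (a + k)) i * bcoef (\<gamma> * \<beta>) p (int (a + k)) * bcoef \<beta> q (i + j - int (a + k)))"
    by (subst sum.reindex) (auto simp: inj_on_def)
  also have "\<dots> = (\<Sum>k\<in>{0..b}. (of_int p gchoose a) * \<gamma> powi (p - i) * \<beta> powi (p + q - i - j)
      * (((of_int p - of_nat a) gchoose k) * (of_int q gchoose (b - k))))"
  proof (rule sum.cong[OF refl])
    fix k assume k: "k \<in> {0..b}"
    let ?l = "int (a + k)"
    have e: "bcoef \<gamma> ?l i = (of_nat (a + k) gchoose a) * \<gamma> powi (?l - i)"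
      "bcoef (\<gamma> * \<beta>) p ?l = (of_int p gchoose (a + k)) * (\<gamma> powi (p - ?l) * \<beta> powi (p - ?l))"
      "bcoef \<beta> q (i + j - ?l) = (of_int q gchoose (b - k)) * \<beta> powi (q - (i + j - ?l))"
      using k ab by (simp_all add: bcoef_def power_int_mult_distrib nat_diff_distrib nat_int_add)
    have c1: "((of_int p :: complex) gchoose (a + k)) * (of_nat (a + k) gchoose a)
        = (of_int p gchoose a) * ((of_int p - of_nat a) gchoose k)"
      using gbinomial_trinomial_revision[of a "a + k" "of_int p :: complex"] by simp
    have c2: "\<gamma> powi (?l - i) * \<gamma> powi (p - ?l) = \<gamma> powi (p - i)"
      using assms by (simp flip: power_int_add)
    have c3: "\<beta> powi (p - ?l) * \<beta> powi (q - (i + j - ?l)) = \<beta> powi (p + q - i - j)"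
      using assms by (simp add: algebra_simps flip: power_int_add)
    have "bcoef \<gamma> ?l i * bcoef (\<gamma> * \<beta>) p ?l * bcoef \<beta> q (i + j - ?l)
        = ((of_int p gchoose (a + k)) * (of_nat (a + k) gchoose a)) * (\<gamma> powi (?l - i) * \<gamma> powi (p - ?l))
          * (\<beta> powi (p - ?l) * \<beta> powi (q - (i + j - ?l))) * (of_int q gchoose (b - k))"
      unfolding e by (simp only: mult_ac)
    also have "\<dots> = (of_int p gchoose a) * \<gamma> powi (p - i) * \<beta> powi (p + q - i - j)
      * (((of_int p - of_nat a) gchoose k) * (of_int q gchoose (b - k)))"
      unfolding c1 c2 c3 by (simp only: mult_ac)
    finally show "bcoef \<gamma> ?l i * bcoef (\<gamma> * \<beta>) p ?l * bcoef \<beta> q (i + j - ?l)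
        = (of_int p gchoose a) * \<gamma> powi (p - i) * \<beta> powi (p + q - i - j)
      * (((of_int p - of_nat a) gchoose k) * (of_int q gchoose (b - k)))" .
  qed
  also have "\<dots> = (of_int p gchoose a) * \<gamma> powi (p - i) * \<beta> powi (p + q - i - j)
      * ((of_int p - of_nat a + of_int q) gchoose b)"
    by (simp only: gbinomial_Vandermonde flip: sum_distrib_left)
  also have "\<dots> = bcoef \<gamma> p i * bcoef \<beta> (p + q - i) j"
    using ab by (simp add: bcoef_def algebra_simps)
  finally show ?thesis .
next
  case False
  have "bcoef \<gamma> l i * bcoef (\<gamma> * \<beta>) p l * bcoef \<beta> q (i + j - l) = 0" if l: "l \<in> {0..i + j}" for l
  proof (cases "i < 0")
    case False
    then have "0 \<le> l" "l < i" "0 \<le> i" using \<open>\<not> (i \<ge> 0 \<and> j \<ge> 0)\<close> l by auto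
    then obtain m a where "l = int m" "i = int a"
      using nonneg_int_cases[OF \<open>0 \<le> l\<close>] nonneg_int_cases[OF \<open>0 \<le> i\<close>] by metis
    then show ?thesis using \<open>l < i\<close> by (simp add: bcoef_def flip: binomial_gbinomial)
  qed (simp add: bcoef_neg)
  then have "(\<Sum>l\<in>{0..i + j}. bcoef \<gamma> l i * bcoef (\<gamma> * \<beta>) p l * bcoef \<beta> q (i + j - l)) = 0"
    by (intro sum.neutral) blast
  moreover have "bcoef \<gamma> p i * bcoef \<beta> (p + q - i) j = 0"
    using False by (auto simp: bcoef_neg)
  ultimately show ?thesis by simp
qed

context cspace
begin

lemma subst_value:
  assumes "g \<in> trunc2"
  shows "subst (series_scale s) \<alpha> g i m k = subst s \<alpha> (\<lambda>i j. g i j k) i m"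
proof -
  interpret V: cspace "series_scale s" by (rule cspace_series_scale)
  show ?thesis
    using V.subst_linear[OF module_axioms, of "\<lambda>v. v k" g \<alpha>] assms by (simp add: series_scale_def)
qed

lemma trunc3_coeff:
  assumes "T \<in> trunc3"
  shows "T \<in> trunc2" "T i \<in> trunc2" "(\<lambda>i j. T i j k) \<in> trunc2"
  using assms unfolding trunc2_def trunc3_def by (auto simp: fun_eq_iff)

text \<open>Lower bounds and a fixed total degree confine both exponents to one square, so the
  double sum is finite and visibly symmetric in the two substitutions.\<close>

lemma subst_subst_eq:
  assumes T: "\<And>i j k. i < N \<or> j < N \<or> k < N \<Longrightarrow> T i j k = 0"
  shows "subst s \<alpha> (subst (series_scale s) \<beta> T j) i m
    = (\<Sum>p\<in>{N..m + i + j - 2 * N}. \<Sum>q\<in>{N..m + i + j - 2 * N}.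
        s (bcoef \<alpha> p i * bcoef \<beta> q j) (T (m + i + j - p - q) q p))"
proof -
  let ?A = "{N..m + i + j - 2 * N}"
  have T2: "T \<in> trunc2" using T unfolding trunc2_def by (auto simp: fun_eq_iff)
  have val: "subst (series_scale s) \<beta> T j n p = subst s \<beta> (\<lambda>q r. T q r p) j n" for n p
    by (rule subst_value[OF T2])
  have "subst s \<alpha> (subst (series_scale s) \<beta> T j) i m
      = (\<Sum>p\<in>?A. s (bcoef \<alpha> p i) (subst (series_scale s) \<beta> T j (m + i - p) p))"
  proof (rule subst_eq2[where M = "2 * N - j" and N = N])
    fix n p assume "n < 2 * N - j \<or> p < N"
    then show "subst (series_scale s) \<beta> T j n p = 0"
    proof
      assume "n < 2 * N - j"
      then show ?thesis unfolding val by (intro subst_low[of N]) (auto simp: T)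
    next
      assume "p < N"
      then show ?thesis unfolding val by (simp add: T subst_def)
    qed
  qed auto
  also have "\<dots> = (\<Sum>p\<in>?A. \<Sum>q\<in>?A. s (bcoef \<alpha> p i * bcoef \<beta> q j) (T (m + i + j - p - q) q p))"
  proof (rule sum.cong[OF refl])
    fix p assume p: "p \<in> ?A"
    have "subst (series_scale s) \<beta> T j (m + i - p) p
        = (\<Sum>q\<in>?A. s (bcoef \<beta> q j) (T (m + i - p + j - q) q p))"
      unfolding val by (rule subst_eq[of N]) (use p in \<open>auto simp: T\<close>)
    then show "s (bcoef \<alpha> p i) (subst (series_scale s) \<beta> T j (m + i - p) p)
        = (\<Sum>q\<in>?A. s (bcoef \<alpha> p i * bcoef \<beta> q j) (T (m + i + j - p - q) q p))"
      by (simp add: scale_sum_right algebra_simps)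
  qed
  finally show ?thesis .
qed

lemma subst_subst_commute:
  assumes "T \<in> trunc3"
  shows "subst s \<alpha> (subst (series_scale s) \<beta> T j) i
    = subst s \<beta> (subst (series_scale s) \<alpha> (\<lambda>q p1 p2. T q p2 p1) i) j"
proof
  fix m
  obtain N where N: "\<And>i j k. i < N \<or> j < N \<or> k < N \<Longrightarrow> T i j k = 0"
    using assms unfolding trunc3_def by blast
  then have N': "\<And>i j k. i < N \<or> j < N \<or> k < N \<Longrightarrow> (\<lambda>q p1 p2. T q p2 p1) i j k = 0" by blast
  let ?A = "{N..m + i + j - 2 * N}"
  have "subst s \<alpha> (subst (series_scale s) \<beta> T j) i m
      = (\<Sum>p\<in>?A. \<Sum>q\<in>?A. s (bcoef \<alpha> p i * bcoef \<beta> q j) (T (m + i + j - p - q) q p))"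
    by (rule subst_subst_eq[OF N])
  also have "\<dots> = (\<Sum>q\<in>?A. \<Sum>p\<in>?A. s (bcoef \<alpha> p i * bcoef \<beta> q j) (T (m + i + j - p - q) q p))"
    by (rule sum.swap)
  also have "\<dots> = subst s \<beta> (subst (series_scale s) \<alpha> (\<lambda>q p1 p2. T q p2 p1) i) j m"
    using subst_subst_eq[where T = "\<lambda>q p1 p2. T q p2 p1" and N = N and \<alpha> = \<beta> and \<beta> = \<alpha> and j = i and i = j and m = m, OF N'] by (simp add: algebra_simps)
  finally show "subst s \<alpha> (subst (series_scale s) \<beta> T j) i m
    = subst s \<beta> (subst (series_scale s) \<alpha> (\<lambda>q p1 p2. T q p2 p1) i) j m" .
qed

text \<open>\<open>\<gamma>(\<beta> x + x\<^sub>2) + x\<^sub>0 = \<gamma> \<beta> x + (\<gamma> x\<^sub>2 + x\<^sub>0)\<close>\<close>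

lemma subst_subst_compose:
  assumes T: "T \<in> trunc3" and nz: "\<beta> \<noteq> 0" "\<gamma> \<noteq> 0"
    and trunc: "(\<lambda>j. subst s (\<gamma> * \<beta>) (subst (series_scale s) \<beta> T j)) \<in> trunc2"
  shows "subst (series_scale s) \<gamma> (\<lambda>j. subst s (\<gamma> * \<beta>) (subst (series_scale s) \<beta> T j))
    = (\<lambda>i. subst s \<beta> (\<lambda>q. subst s \<gamma> (T q) i))"
proof (intro ext)
  fix i j m :: int
  obtain N where N: "\<And>i j k. i < N \<or> j < N \<or> k < N \<Longrightarrow> T i j k = 0"
    using T unfolding trunc3_def by blast
  let ?n = "m + i + j"
  let ?A = "{N..?n - 2 * N}"
  let ?G = "\<lambda>t l. subst s (\<gamma> * \<beta>) (subst (series_scale s) \<beta> T t) l"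
  have "?G t l m = 0" if "t < 0 \<or> l < 0" for t l
    using that
  proof
    assume "t < 0"
    then have "subst (series_scale s) \<beta> T t = 0"
      using trunc3_coeff[OF T] by (simp add: fun_eq_iff subst_value subst_neg)
    then show ?thesis by (simp add: subst_def)
  qed (simp add: subst_neg)
  \<comment> \<open>Neither of the two new exponents is negative, so the bound 0 applies and
    \<open>l\<close> runs through \<open>{0..i + j}\<close>, the range in
    \<open>bcoef_compose\<close>.\<close>
  then have "subst s \<gamma> (\<lambda>t l. ?G t l m) i j = (\<Sum>l\<in>{0..i + j}. s (bcoef \<gamma> l i) (?G (j + i - l) l m))"
    by (intro subst_eq[of 0]) auto
  also have "\<dots> = (\<Sum>l\<in>{0..i + j}. \<Sum>p\<in>?A. \<Sum>q\<in>?A.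
      s (bcoef \<gamma> l i * bcoef (\<gamma> * \<beta>) p l * bcoef \<beta> q (i + j - l)) (T (?n - p - q) q p))"
  proof (rule sum.cong[OF refl])
    fix l
    have "m + l + (j + i - l) = ?n" by simp
    then show "s (bcoef \<gamma> l i) (?G (j + i - l) l m) = (\<Sum>p\<in>?A. \<Sum>q\<in>?A.
      s (bcoef \<gamma> l i * bcoef (\<gamma> * \<beta>) p l * bcoef \<beta> q (i + j - l)) (T (?n - p - q) q p))"
      by (simp add: subst_subst_eq[OF N] scale_sum_right mult.assoc add.assoc add.commute[of j i])
  qed
  also have "\<dots> = (\<Sum>p\<in>?A. \<Sum>l\<in>{0..i + j}. \<Sum>q\<in>?A.
      s (bcoef \<gamma> l i * bcoef (\<gamma> * \<beta>) p l * bcoef \<beta> q (i + j - l)) (T (?n - p - q) q p))"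
    by (rule sum.swap)
  also have "\<dots> = (\<Sum>p\<in>?A. \<Sum>q\<in>?A. \<Sum>l\<in>{0..i + j}.
      s (bcoef \<gamma> l i * bcoef (\<gamma> * \<beta>) p l * bcoef \<beta> q (i + j - l)) (T (?n - p - q) q p))"
    by (rule sum.cong[OF refl], rule sum.swap)
  also have "\<dots> = (\<Sum>p\<in>?A. \<Sum>q\<in>?A. s (bcoef \<gamma> p i * bcoef \<beta> (p + q - i) j) (T (?n - p - q) q p))"
    by (simp only: bcoef_compose[OF nz] flip: scale_sum_left)
  \<comment> \<open>The new index r = p + q - i is the total exponent of z = \<beta> x + x_2 once
    (\<gamma> z + x_0)^p has been expanded.\<close>
  also have "\<dots> = (\<Sum>p\<in>?A. \<Sum>r\<in>{2 * N - i..m + j - N}. s (bcoef \<gamma> p i * bcoef \<beta> r j) (T (m + j - r) (r + i - p) p))"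
  proof (rule sum.cong[OF refl])
    fix p assume p: "p \<in> ?A"
    have "(\<Sum>r\<in>{2 * N - i..m + j - N}. s (bcoef \<gamma> p i * bcoef \<beta> r j) (T (m + j - r) (r + i - p) p))
        = (\<Sum>q\<in>{2 * N - p..?n - N - p}. s (bcoef \<gamma> p i * bcoef \<beta> (p + q - i) j) (T (?n - p - q) q p))"
      by (rule sum.reindex_bij_witness[of _ "\<lambda>q. p + q - i" "\<lambda>r. r + i - p"]) (auto simp: algebra_simps)
    also have "\<dots> = (\<Sum>q\<in>?A. s (bcoef \<gamma> p i * bcoef \<beta> (p + q - i) j) (T (?n - p - q) q p))"
    proof (rule sum.mono_neutral_cong)
      show "s (bcoef \<gamma> p i * bcoef \<beta> (p + q - i) j) (T (?n - p - q) q p) = 0"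
        if "q \<in> ?A - {2 * N - p..?n - N - p}" for q
      proof -
        have "?n - p - q < N" using that p by auto
        then show ?thesis by (simp add: N)
      qed
      show "s (bcoef \<gamma> p i * bcoef \<beta> (p + q - i) j) (T (?n - p - q) q p) = 0"
        if "q \<in> {2 * N - p..?n - N - p} - ?A" for q
      proof -
        have "q < N" using that p by auto
        then show ?thesis by (simp add: N)
      qed
    qed auto
    finally show "(\<Sum>q\<in>?A. s (bcoef \<gamma> p i * bcoef \<beta> (p + q - i) j) (T (?n - p - q) q p))
        = (\<Sum>r\<in>{2 * N - i..m + j - N}. s (bcoef \<gamma> p i * bcoef \<beta> r j) (T (m + j - r) (r + i - p) p))" ..
  qed
  also have "\<dots> = (\<Sum>r\<in>{2 * N - i..m + j - N}. \<Sum>p\<in>?A. s (bcoef \<gamma> p i * bcoef \<beta> r j) (T (m + j - r) (r + i - p) p))"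
    by (rule sum.swap)
  also have "\<dots> = (\<Sum>r\<in>{2 * N - i..m + j - N}. s (bcoef \<beta> r j) (subst s \<gamma> (T (m + j - r)) i r))"
  proof (rule sum.cong[OF refl])
    fix r assume r: "r \<in> {2 * N - i..m + j - N}"
    have "subst s \<gamma> (T (m + j - r)) i r = (\<Sum>p\<in>?A. s (bcoef \<gamma> p i) (T (m + j - r) (r + i - p) p))"
      by (rule subst_eq[of N]) (use r in \<open>auto simp: N\<close>)
    then show "(\<Sum>p\<in>?A. s (bcoef \<gamma> p i * bcoef \<beta> r j) (T (m + j - r) (r + i - p) p))
        = s (bcoef \<beta> r j) (subst s \<gamma> (T (m + j - r)) i r)"
      by (simp add: scale_sum_right mult.commute)
  qed
  also have "\<dots> = subst s \<beta> (\<lambda>q. subst s \<gamma> (T q) i) j m"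
  proof (rule subst_eq2[where M = N and N = "2 * N - i", symmetric])
    fix q p assume "q < N \<or> p < 2 * N - i"
    then show "subst s \<gamma> (T q) i p = 0"
    proof
      assume "p < 2 * N - i"
      then show ?thesis by (intro subst_low[of N]) (auto simp: N)
    qed (simp add: subst_def N)
  qed auto
  finally show "subst (series_scale s) \<gamma> (\<lambda>j. subst s (\<gamma> * \<beta>) (subst (series_scale s) \<beta> T j)) i j m
    = subst s \<beta> (\<lambda>q. subst s \<gamma> (T q) i) j m"
    by (simp add: subst_value[OF trunc])
qed

end

lemma lin3_simps:
  "lin3 a b c + lin3 a' b' c' = lin3 (a + a') (b + b') (c + c')"
  "lin3 a b c - lin3 a' b' c' = lin3 (a - a') (b - b') (c - c')"
  "cst3 d * lin3 a b c = lin3 (d * a) (d * b) (d * c)"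
  "lin3 a b c = lin3 a' b' c' \<longleftrightarrow> a = a' \<and> b = b' \<and> c = c'"
  by (auto simp: lin3_def)

context cspace
begin

text \<open>The form a x + b y_2 + c y_1 becomes b x_2 + (a + \<beta> b) x + c y_1, with indices in
  the order x_2, x, y_1. The variable y_1 is hidden in the coefficients during this
  substitution.\<close>

lemma subst_values_lin3:
  assumes "\<beta> \<noteq> 0" "T \<in> trunc2"
  shows "subst (series_scale s) \<beta> (act3 s (lin3 a b c) T)
    = act3 s (lin3 b (a + \<beta> * b) c) (subst (series_scale s) \<beta> T)"
proof -
  interpret V: cspace "series_scale s" by (rule cspace_series_scale)
  let ?L = "\<lambda>v k. s c (v (k - 1))"
  let ?S = "subst (series_scale s) \<beta>"
  have t: "(\<lambda>q p. T (q - 1) p) \<in> trunc2" "(\<lambda>q p. T q (p - 1)) \<in> trunc2"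
    using V.trunc2_shift[OF assms(2)] by auto
  have t3: "(\<lambda>q p. ?L (T q p)) \<in> trunc2"
    using trunc2_values_scale[OF assms(2), of "lin3 0 0 c"] by (simp add: act3_lin3)
  have eq: "act3 s (lin3 a b c) T
      = ((\<lambda>q p. series_scale s a (T (q - 1) p)) + (\<lambda>q p. series_scale s b (T q (p - 1)))) + (\<lambda>q p. ?L (T q p))"
    by (simp add: act3_lin3 series_scale_def fun_eq_iff)
  have "?S (\<lambda>q p. ?L (T q p)) = (\<lambda>i m. ?L (?S T i m))"
    by (rule V.subst_linear[OF module_series_scale _ _ assms(2)])
      (auto simp: series_scale_def scale_right_distrib mult.commute)
  then show ?thesis
    unfolding eq V.subst_add[OF V.P2.subspace_add[OF V.subspace_trunc2 V.trunc2_shift(3)[OF t(1)] V.trunc2_shift(3)[OF t(2)]] t3]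
      V.subst_add[OF V.trunc2_shift(3)[OF t(1)] V.trunc2_shift(3)[OF t(2)]]
      V.subst_scale[OF t(1)] V.subst_scale[OF t(2)] V.subst_outer V.subst_inner[OF assms]
    by (simp add: act3_lin3 series_scale_def fun_eq_iff scale_right_distrib scale_left_distrib mult.commute)
qed

lemma subst_values_act3:
  assumes "\<beta> \<noteq> 0" "T \<in> trunc2"
  shows "subst (series_scale s) \<beta> (act3 s (poly2 cst3 (lin3 a b c) (lin3 a' b' c') f) T)
    = act3 s (poly2 cst3 (lin3 b (a + \<beta> * b) c) (lin3 b' (a' + \<beta> * b') c') f) (subst (series_scale s) \<beta> T)"
proof -
  interpret V: cspace "series_scale s" by (rule cspace_series_scale)
  let ?R = "\<lambda>x y. x \<in> trunc2 \<and> y = subst (series_scale s) \<beta> x"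
  have "?R (act3 s (poly2 cst3 (lin3 a b c) (lin3 a' b' c') f) T)
      (act3 s (poly2 cst3 (lin3 b (a + \<beta> * b) c) (lin3 b' (a' + \<beta> * b') c') f) (subst (series_scale s) \<beta> T))"
  proof (rule semilinear3[where R = ?R], goal_cases)
    case (3 x y x' y')
    then show ?case by (simp add: V.subst_add V.P2.subspace_add[OF V.subspace_trunc2])
  next
    case (4 d x x')
    then have "act3 s (cst3 d) x = (\<lambda>q p. series_scale s d (x q p))"
      by (simp only: act3_cst3 series_scale_def)
    then show ?case
      using 4 V.subst_scale[of x \<beta> d] V.trunc2_shift(3)[of x d] by (simp only: act3_cst3 series_scale_def)
  qed (use assms in \<open>auto simp: subst_values_lin3 trunc2_values_scale\<close>)
  then show ?thesis by simp
qed

lemma subst_values_tri: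
  assumes "\<beta> \<noteq> 0" "T \<in> trunc2"
  shows "subst (series_scale s) \<beta> (act3 s (tri f g h (lin3 a b c) (lin3 a' b' c') (lin3 a'' b'' c'')) T)
    = act3 s (tri f g h (lin3 b (a + \<beta> * b) c) (lin3 b' (a' + \<beta> * b') c') (lin3 b'' (a'' + \<beta> * b'') c''))
        (subst (series_scale s) \<beta> T)"
  by (simp only: act3_tri subst_values_act3[OF assms(1)] assms(2) trunc2_values_scale)

text \<open>The counterpart for the two inner indices: b x + c y_1 becomes c x_1 + (b + \<alpha> c)
  x, and the outer index is a spectator, along which the relation holds coefficient by
  coefficient.\<close>

lemma subst_rel_lin3:
  assumes \<alpha>: "\<alpha> \<noteq> 0" and R: "\<And>j. subst_rel s \<alpha> (X j) (X' j)"
  shows "subst_rel s \<alpha> (act3 s (lin3 a b c) X j) (act3 s (lin3 a c (b + \<alpha> * c)) X' j)"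
proof -
  have 1: "act3 s (lin3 a b c) X j = act2 s (cst2 a) (X (j - 1)) + act2 s [:[:0, c:], [:b:]:] (X j)"
    for a b c X j
    by (simp add: act3_lin3 act_simps fun_eq_iff algebra_simps)
  have 2: "poly_subst \<alpha> (cst2 a) = cst2 a" "poly_subst \<alpha> [:[:0, c:], [:b:]:] = [:[:0, b + \<alpha> * c:], [:c:]:]"
    by (simp_all add: poly_subst_def poly2_pCons map_poly_pCons algebra_simps)
  show ?thesis
    unfolding 1 using subst_rel_add[OF \<alpha> subst_rel_act2[OF \<alpha> R] subst_rel_act2[OF \<alpha> R], of "cst2 a" _ "[:[:0, c:], [:b:]:]"]
    by (simp only: 2)
qed

lemma subst_rel_act3:
  assumes \<alpha>: "\<alpha> \<noteq> 0" and R: "\<And>j. subst_rel s \<alpha> (X j) (X' j)"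
  shows "subst_rel s \<alpha> (act3 s (poly2 cst3 (lin3 a b c) (lin3 a' b' c') f) X j)
    (act3 s (poly2 cst3 (lin3 a c (b + \<alpha> * c)) (lin3 a' c' (b' + \<alpha> * c')) f) X' j)"
proof -
  let ?R = "\<lambda>X X'. \<forall>j. subst_rel s \<alpha> (X j) (X' j)"
  have "?R (act3 s (poly2 cst3 (lin3 a b c) (lin3 a' b' c') f) X)
    (act3 s (poly2 cst3 (lin3 a c (b + \<alpha> * c)) (lin3 a' c' (b' + \<alpha> * c')) f) X')"
  proof (rule semilinear3[where R = ?R], goal_cases)
    case (3 x y x' y')
    then show ?case using subst_rel_add[OF \<alpha>] by simp
  next
    case (4 d x x')
    have "act3 s (cst3 d) x j = act2 s (cst2 d) (x j)" for x j
      by (simp add: act_simps)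
    moreover have "poly_subst \<alpha> (cst2 d) = cst2 d"
      by (simp add: poly_subst_def poly2_pCons map_poly_pCons)
    ultimately show ?case using 4 subst_rel_act2[OF \<alpha>, of _ _ "cst2 d"] by metis
  qed (simp_all add: subst_rel_lin3[OF \<alpha>] R)
  then show ?thesis by simp
qed

lemma subst_rel_tri:
  assumes \<alpha>: "\<alpha> \<noteq> 0" and R: "\<And>j. subst_rel s \<alpha> (X j) (X' j)"
  shows "subst_rel s \<alpha> (act3 s (tri f g h (lin3 a b c) (lin3 a' b' c') (lin3 a'' b'' c'')) X j)
    (act3 s (tri f g h (lin3 a c (b + \<alpha> * c)) (lin3 a' c' (b' + \<alpha> * c')) (lin3 a'' c'' (b'' + \<alpha> * c''))) X' j)"
  unfolding act3_tri by (intro subst_rel_act3 \<alpha> R)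

subsection \<open>Products of vertex operators\<close>

text \<open>\<open>\<Y>\<^sub>\<alpha>(a, x\<^sub>1) \<Y>\<^sub>\<beta>(b, x\<^sub>2) c\<close> is the value of \<open>a(y\<^sub>1) b(y\<^sub>2) c(x)\<close> at
  \<open>y\<^sub>1 = \<alpha> x + x\<^sub>1\<close>, \<open>y\<^sub>2 = \<beta> x + x\<^sub>2\<close>, once it is multiplied by the locality polynomials; and
  \<open>\<Y>\<^sub>\<beta>(\<Y>\<^sub>\<gamma>(a, x\<^sub>0) b, x\<^sub>2) c\<close> is its value at \<open>y\<^sub>1 = \<gamma> y\<^sub>2 + x\<^sub>0\<close>, \<open>y\<^sub>2 = \<beta> x + x\<^sub>2\<close>.\<close>

context
  fixes a b c :: "'u \<Rightarrow> int \<Rightarrow> 'u" and f g h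
  assumes abc: "a \<in> E_space s" "b \<in> E_space s" "c \<in> E_space s"
    and loc: "locality_poly s f a b" "locality_poly s g a c" "locality_poly s h b c"
begin

private abbreviation T3 where
  "T3 w \<equiv> act3 s (tri f g h (lin3 0 0 1) (lin3 0 1 0) (lin3 1 0 0)) (triple a b c w)"

lemma tri_iterated_left:
  assumes nz: "\<alpha> \<noteq> 0" "\<beta> \<noteq> 0" and compat: "\<And>j. compatible s a (Y_op s \<beta> b c j)"
  shows "act3 s (tri f g h (lin3 0 1 \<alpha>) (lin3 1 0 \<beta>) (lin3 0 0 1)) (\<lambda>j i. Y_op s \<alpha> a (Y_op s \<beta> b c j) i w)
    = (\<lambda>j. subst s \<alpha> (subst (series_scale s) \<beta> (T3 w) j))"
proof -
  let ?S = "subst (series_scale s) \<beta>"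
  let ?F = "poly2 cst3 (lin3 0 0 1) (lin3 0 1 0) f"
  let ?G = "poly2 cst3 (lin3 0 0 1) (lin3 1 0 0) g"
  let ?H = "poly2 cst3 (lin3 0 1 0) (lin3 1 0 0)"
  let ?d = "\<lambda>j. Y_op s \<beta> b c j w"
  have bc: "compatible s b c"
    using locality_poly_compat[OF loc(3)] abc by (auto simp: compatible_def)
  define u where "u = act2 s h (\<lambda>q p2. b (c w q) p2)"
  have u: "u \<in> trunc2"
    using locality_poly_compat[OF loc(3)] abc by (auto simp: u_def compat_poly_iff)
  have "act2 s (poly_subst \<beta> h) ?d = subst s \<beta> u"
    using subst_rel_act2[OF nz(2) Y_op_subst_rel[OF nz(2) bc], of h w] subst_rel_eq_subst[OF nz(2) _ u]
    by (simp add: u_def)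
  \<comment> \<open>Multiplication by \<open>h\<close> has truncated b(y_2) c(x) w, so the
    substitution of y_2 is a finite sum in each coefficient and passes through the linear map
    \<open>a\<close>.\<close>
  moreover have "?S (\<lambda>q p2. a (u q p2)) = (\<lambda>j m. a (subst s \<beta> u j m))"
    by (rule subst_linear[OF module_series_scale _ _ u])
      (auto simp: series_scale_def fun_eq_iff E_spaceD[OF abc(1)])
  moreover have "poly2 cst3 (lin3 0 1 0) (lin3 1 0 0) (poly_subst \<beta> h) = poly2 cst3 (lin3 1 \<beta> 0) (lin3 0 1 0) h"
    unfolding poly_subst_def
    by (subst poly2_poly2) (simp_all add: poly2_pCons map_poly_pCons map_poly_1 lin3_def)
  ultimately have S_au: "?S (\<lambda>q p2. a (u q p2)) = act3 s (poly2 cst3 (lin3 1 \<beta> 0) (lin3 0 1 0) h) (\<lambda>j m. a (?d j m))"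
    using act3_map_inner[OF abc(1), of "poly_subst \<beta> h" ?d] by simp
  have au: "(\<lambda>q p2. a (u q p2)) \<in> trunc2"
  proof -
    obtain N where "\<forall>i j. i < N \<or> j < N \<longrightarrow> u i j = 0" using u unfolding trunc2_def by blast
    then have "\<forall>i j. i < N \<or> j < N \<longrightarrow> a (u i j) = 0" by (simp add: E_space_zero[OF abc(1)])
    then show ?thesis unfolding trunc2_def by blast
  qed
  have "T3 w = act3 s ?F (act3 s ?G (\<lambda>q p2. a (u q p2)))"
    unfolding act3_tri triple_def u_def act3_map_inner[OF abc(1)] ..
  then have T1: "?S (T3 w) = act3 s (tri f g h (lin3 0 0 1) (lin3 1 \<beta> 0) (lin3 0 1 0)) (\<lambda>j m. a (?d j m))"
    by (simp add: act3_tri subst_values_act3[OF nz(2)] au trunc2_values_scale S_au del: P3.scale_scale)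
  have "subst_rel s \<alpha> (?S (T3 w) j)
      (act3 s (tri f g h (lin3 0 1 \<alpha>) (lin3 1 0 \<beta>) (lin3 0 0 1)) (\<lambda>j i. Y_op s \<alpha> a (Y_op s \<beta> b c j) i w) j)" for j
    using subst_rel_tri[OF nz(1), of "\<lambda>j m. a (?d j m)" "\<lambda>j i. Y_op s \<alpha> a (Y_op s \<beta> b c j) i w" f g h 0 0 1 1 \<beta> 0 0 1 0 j]
      Y_op_subst_rel[OF nz(1) compat, where w = w]
    by (simp add: T1)
  \<comment> \<open>For a fixed power of x_2 the series is bounded below in x and y_1, by a bound
    depending on \<open>j\<close>; hence the partial substitution of y_1 is a literal one.\<close>
  moreover have "?S (T3 w) j \<in> trunc2" for j
  proof -
    have T: "T3 w \<in> trunc3" by (rule tri_trunc3[OF abc loc])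
    then obtain N where N: "\<And>i j k. i < N \<or> j < N \<or> k < N \<Longrightarrow> T3 w i j k = 0"
      unfolding trunc3_def by blast
    have "?S (T3 w) j m k = 0" if "m < 2 * N - j \<or> k < N" for m k
      using that
    proof
      assume "m < 2 * N - j"
      then show ?thesis
        unfolding subst_value[OF trunc3_coeff(1)[OF T]] by (intro subst_low[of N] N) auto
    next
      assume "k < N"
      then show ?thesis
        unfolding subst_value[OF trunc3_coeff(1)[OF T]] by (simp add: subst_def N)
    qed
    then have "\<forall>m k. m < min N (2 * N - j) \<or> k < min N (2 * N - j) \<longrightarrow> ?S (T3 w) j m k = 0"
      by simp
    then show ?thesis unfolding trunc2_def by blast
  qed
  ultimately show ?thesis using subst_rel_eq_subst[OF nz(1)] by blast
qed

lemma tri_iterated_right: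
  assumes nz: "\<gamma> \<noteq> 0"
  shows "act3 s (tri f g h (lin3 1 0 \<gamma>) (lin3 0 0 1) (lin3 0 1 0)) (\<lambda>i q p. Y_op s \<gamma> a b i (c w q) p)
    = (\<lambda>i q. subst s \<gamma> (T3 w q) i)"
proof -
  have ab: "compatible s a b"
    using locality_poly_compat[OF loc(1)] abc by (auto simp: compatible_def)
  have T: "T3 w \<in> trunc3" by (rule tri_trunc3[OF abc loc])
  have "subst_rel s \<gamma> (T3 w q)
      (act3 s (tri f g h (lin3 0 1 \<gamma>) (lin3 0 0 1) (lin3 1 0 0)) (\<lambda>q i. Y_op s \<gamma> a b i (c w q)) q)" for q
    using subst_rel_tri[OF nz, of "triple a b c w" "\<lambda>q i. Y_op s \<gamma> a b i (c w q)" f g h 0 0 1 0 1 0 1 0 0 q]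
      Y_op_subst_rel[OF nz ab]
    by (simp add: triple_def)
  then have "act3 s (tri f g h (lin3 0 1 \<gamma>) (lin3 0 0 1) (lin3 1 0 0)) (\<lambda>q i. Y_op s \<gamma> a b i (c w q))
      = (\<lambda>q. subst s \<gamma> (T3 w q))"
    using subst_rel_eq_subst[OF nz _ trunc3_coeff(2)[OF T]] by blast
  then show ?thesis
    using act3_tri_flip_outer[of f g h 1 0 \<gamma> 0 0 1 0 1 0 "\<lambda>q i. Y_op s \<gamma> a b i (c w q)"]
    by simp
qed

lemma tri_iterated_nested:
  assumes nz: "\<beta> \<noteq> 0" "\<gamma> \<noteq> 0" and compat: "\<And>i. compatible s (Y_op s \<gamma> a b i) c"
  shows "act3 s (tri f g h (lin3 1 \<gamma> (\<gamma> * \<beta>)) (lin3 0 1 \<beta>) (lin3 0 0 1)) (\<lambda>i j. Y_op s \<beta> (Y_op s \<gamma> a b i) c j w)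
    = (\<lambda>i. subst s \<beta> (\<lambda>q. subst s \<gamma> (T3 w q) i))"
proof -
  have "subst_rel s \<beta> (\<lambda>q. subst s \<gamma> (T3 w q) i)
     (act3 s (tri f g h (lin3 1 \<gamma> (\<gamma> * \<beta>)) (lin3 0 1 \<beta>) (lin3 0 0 1)) (\<lambda>i j. Y_op s \<beta> (Y_op s \<gamma> a b i) c j w) i)" for i
    using subst_rel_tri[OF nz(1), of "\<lambda>i q p. Y_op s \<gamma> a b i (c w q) p" "\<lambda>i j. Y_op s \<beta> (Y_op s \<gamma> a b i) c j w" f g h 1 0 \<gamma> 0 0 1 0 1 0 i]
      Y_op_subst_rel[OF nz(1) compat, where w = w]
    by (simp add: tri_iterated_right[OF nz(2)] mult.commute)
  moreover have "(\<lambda>q. subst s \<gamma> (T3 w q) i) \<in> trunc2" for i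
  proof -
    obtain N where N: "\<And>i j k. i < N \<or> j < N \<or> k < N \<Longrightarrow> T3 w i j k = 0"
      using tri_trunc3[OF abc loc] unfolding trunc3_def by blast
    have "subst s \<gamma> (T3 w q) i m = 0" if "q < N \<or> m < 2 * N - i" for q m
      using that
    proof
      assume "m < 2 * N - i"
      then show ?thesis by (intro subst_low[of N] N) auto
    qed (simp add: subst_def N)
    then have "\<forall>q m. q < min N (2 * N - i) \<or> m < min N (2 * N - i) \<longrightarrow> subst s \<gamma> (T3 w q) i m = 0"
      by simp
    then show ?thesis unfolding trunc2_def by blast
  qed
  ultimately show ?thesis using subst_rel_eq_subst[OF nz(1)] by blast
qed

end

end

section \<open>Commutativity and associativity\<close>

lemma lin3_power: "lin3 a b c ^ n = poly2 cst3 (lin3 a b c) (lin3 a b c) ([:[:0, 1:]:] ^ n)"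
  by (simp add: poly2_power) (simp add: poly2_pCons map_poly_pCons map_poly_1 lin3_def)

lemma poly2_lin3_factor:
  "poly2 cst3 (lin3 a b c) (lin3 a' b' c') ([:[:0, - d:], 1:] ^ k * f0)
    = lin3 (a' - d * a) (b' - d * b) (c' - d * c) ^ k * poly2 cst3 (lin3 a b c) (lin3 a' b' c') f0"
proof -
  have "poly2 cst3 (lin3 a b c) (lin3 a' b' c') [:[:0, - d:], 1:] = lin3 (a' - d * a) (b' - d * b) (c' - d * c)"
    by (simp add: poly2_pCons map_poly_pCons map_poly_1 lin3_def)
  then show ?thesis by (simp add: poly2_mult poly2_power)
qed

text \<open>The value at x_1 = x_2 = 0, a polynomial in x. When it is nonzero, it is invertible in
  C((x)), and the polynomial is a unit of C((x))[[x_1, x_2]].\<close>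

definition const_term :: "complex poly poly poly \<Rightarrow> complex poly" where
  "const_term p = coeff (coeff p 0) 0"

lemma const_term_simps:
  "const_term (p + q) = const_term p + const_term q" "const_term (p * q) = const_term p * const_term q"
  "const_term (cst3 a) = [:a:]" "const_term (lin3 a b c) = [:0, c:]" "const_term 0 = 0"
  by (simp_all add: const_term_def coeff_mult_0 lin3_def)

lemma const_term_poly2:
  "const_term (poly2 cst3 (lin3 a b c) (lin3 a' b' c') f) = poly2 (\<lambda>a. [:a:]) [:0, c:] [:0, c':] f"
  by (subst poly2_hom) (simp_all add: const_term_simps)

context cspace
begin

lemma act3_lin3_power:
  "act3 s (lin3 a 0 0 ^ n) T = (\<lambda>i j k. s (a ^ n) (T (i - int n) j k))"
  "act3 s (lin3 0 b 0 ^ n) T = (\<lambda>i j k. s (b ^ n) (T i (j - int n) k))"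
proof (induction n)
  case (Suc n)
  have *: "act3 s (p ^ Suc n) T = act3 s p (act3 s (p ^ n) T)" for p by simp
  show "act3 s (lin3 a 0 0 ^ Suc n) T = (\<lambda>i j k. s (a ^ Suc n) (T (i - int (Suc n)) j k))"
    "act3 s (lin3 0 b 0 ^ Suc n) T = (\<lambda>i j k. s (b ^ Suc n) (T i (j - int (Suc n)) k))"
    unfolding * Suc by (simp_all add: act3_lin3 algebra_simps)
qed simp_all

text \<open>This stands for division by a unit of C((x))[[x_1, x_2]], which creates no negative
  powers. \<open>poly_act_mem_cancel\<close> is applied to the outer index directly, and to the
  second index inside each outer coefficient.\<close>

lemma act3_nonneg_cancel:
  assumes p: "const_term p \<noteq> 0" and Z: "Z \<in> laurent laurent_laurent"
    and low: "\<And>i j. i < 0 \<or> j < 0 \<Longrightarrow> act3 s p Z i j = 0" and ij: "i < 0 \<or> j < 0"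
  shows "Z i j = 0"
proof -
  have p0: "coeff p 0 \<noteq> 0" using p by (auto simp: const_term_def)
  let ?M = "{h. \<forall>j<0. h j = (0 :: int \<Rightarrow> 'u)}"
  have M: "P2.subspace ?M" by (rule P1.subspace_low_coeffs)
  have inner: "m \<in> ?M" if m: "m \<in> laurent_laurent" "act2 s (coeff p 0) m \<in> ?M" for m
  proof -
    have "m j \<in> {0}" if "j < 0" for j
    proof (rule poly_act_mem_cancel[OF P1.module_axioms _ _ _ _ m(1) _ that])
      fix v :: "int \<Rightarrow> 'u" assume v: "v \<in> laurent UNIV" "poly_act s (coeff (coeff p 0) 0) v \<in> {0}"
      then show "v \<in> {0}"
        using poly_act_inj[OF module_axioms _ v(1), of "coeff (coeff p 0) 0"] p
        by (auto simp: const_term_def scalar_zero_iff[OF module_axioms])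
    qed (use m(2) in auto)
    then show ?thesis by simp
  qed
  show ?thesis
    using ij
  proof
    assume "i < 0"
    have "Z i \<in> {0}"
    proof (rule poly_act_mem_cancel[OF P2.module_axioms _ _ _ _ Z _ \<open>i < 0\<close>])
      show "act3 s p Z k \<in> {0}" if "k < 0" for k using low that by (simp add: fun_eq_iff)
    qed (use act2_inj p0 in auto)
    then show ?thesis by simp
  next
    assume "j < 0"
    have "Z i \<in> ?M"
    proof (rule poly_act_mem_cancel[OF P2.module_axioms _ _ _ inner Z, of p "i + 1"])
      show "act3 s p Z k \<in> ?M" for k using low by simp
    qed (use P2.subspace_scale[OF M] P2.subspace_diff[OF M] P2.subspace_0[OF M] in auto)
    then show ?thesis using \<open>j < 0\<close> by simp
  qed
qed

lemma laurent_laurent_laurent_coeff: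
  "Z \<in> laurent laurent_laurent \<Longrightarrow> Z i j \<in> laurent UNIV"
  by (auto simp: laurent_def)

lemma subspace_laurent_laurent_laurent: "P3.subspace (laurent laurent_laurent)"
  by (intro P2.subspace_laurent subspace_laurent_laurent)

lemma laurent_laurent_laurentI:
  assumes "\<And>i j. i < N \<or> j < N \<Longrightarrow> Z i j = 0" "\<And>i j. Z i j \<in> laurent UNIV"
  shows "Z \<in> laurent laurent_laurent"
proof -
  have "\<forall>i<N. Z i = 0" "\<forall>i. \<forall>j<N. Z i j = 0" using assms(1) by (auto simp: fun_eq_iff)
  then show ?thesis using assms(2) unfolding laurent_def by blast
qed

lemma Y_op_zero:
  assumes "\<alpha> \<noteq> 0" "compatible s a b" "\<And>w. (\<lambda>q p. a (b w q) p) = 0"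
  shows "Y_op s \<alpha> a b i = 0"
proof -
  have "(\<lambda>i. Y_op s \<alpha> a b i w) = 0" for w
  proof -
    have "(\<lambda>i. Y_op s \<alpha> a b i w) = subst s \<alpha> 0"
      using Y_op_subst_rel[OF assms(1,2), of w] unfolding assms(3)
      by (rule subst_rel_eq_subst[OF assms(1)]) (auto simp: trunc2_def)
    then show ?thesis by (simp add: subst_def fun_eq_iff)
  qed
  then show ?thesis by (simp add: fun_eq_iff)
qed

text \<open>The operator applied first carries the uniform bound, so the product lies in the
  iterated Laurent space with outer variable x_2. For the product in the other order the outer
  variable is x_1.\<close>

lemma Y_op_iterated_left_laurent:
  assumes nz: "\<alpha> \<noteq> 0" and a: "a \<in> E_space s" and bc: "compatible s b c"
    and compat: "\<And>j. compatible s a (Y_op s \<beta> b c j)"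
  shows "\<exists>N. \<forall>j<N. \<forall>i w. Y_op s \<alpha> a (Y_op s \<beta> b c j) i w = 0"
    and "(\<lambda>j i. Y_op s \<alpha> a (Y_op s \<beta> b c j) i w) \<in> laurent laurent_laurent"
proof -
  obtain N where N: "\<forall>j<N. Y_op s \<beta> b c j = 0" using Y_op_low[OF bc] by blast
  have "Y_op s \<alpha> a (Y_op s \<beta> b c j) i = 0" if "j < N" for i j
    by (rule Y_op_zero[OF nz compat]) (simp add: N that E_space_zero[OF a] fun_eq_iff)
  then have N': "\<forall>j<N. \<forall>i w. Y_op s \<alpha> a (Y_op s \<beta> b c j) i w = 0" by simp
  then show "\<exists>N. \<forall>j<N. \<forall>i w. Y_op s \<alpha> a (Y_op s \<beta> b c j) i w = 0" by blast
  have "(\<lambda>i. Y_op s \<alpha> a (Y_op s \<beta> b c j) i w) \<in> laurent_laurent" for j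
    using subst_rel_laurent[OF Y_op_subst_rel[OF nz compat]] .
  moreover have "\<forall>j<N. (\<lambda>i. Y_op s \<alpha> a (Y_op s \<beta> b c j) i w) = 0" using N' by (simp add: fun_eq_iff)
  ultimately show "(\<lambda>j i. Y_op s \<alpha> a (Y_op s \<beta> b c j) i w) \<in> laurent laurent_laurent"
    unfolding laurent_def[of laurent_laurent] by blast
qed

lemma Y_op_iterated_right_laurent:
  assumes nz: "\<beta> \<noteq> 0" and ab: "compatible s a b" and c: "c \<in> E_space s"
    and compat: "\<And>i. compatible s (Y_op s \<gamma> a b i) c"
  shows "\<exists>N. \<forall>i<N. \<forall>j w. Y_op s \<beta> (Y_op s \<gamma> a b i) c j w = 0"
    and "(\<lambda>i j. Y_op s \<beta> (Y_op s \<gamma> a b i) c j w) \<in> laurent laurent_laurent"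
proof -
  obtain N where N: "\<forall>i<N. Y_op s \<gamma> a b i = 0" using Y_op_low[OF ab] by blast
  have "Y_op s \<beta> (Y_op s \<gamma> a b i) c j = 0" if "i < N" for i j
    by (rule Y_op_zero[OF nz compat]) (simp add: N that fun_eq_iff)
  then have N': "\<forall>i<N. \<forall>j w. Y_op s \<beta> (Y_op s \<gamma> a b i) c j w = 0" by simp
  then show "\<exists>N. \<forall>i<N. \<forall>j w. Y_op s \<beta> (Y_op s \<gamma> a b i) c j w = 0" by blast
  have "(\<lambda>j. Y_op s \<beta> (Y_op s \<gamma> a b i) c j w) \<in> laurent_laurent" for i
    using subst_rel_laurent[OF Y_op_subst_rel[OF nz compat]] .
  moreover have "\<forall>i<N. (\<lambda>j. Y_op s \<beta> (Y_op s \<gamma> a b i) c j w) = 0" using N' by (simp add: fun_eq_iff)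
  ultimately show "(\<lambda>i j. Y_op s \<beta> (Y_op s \<gamma> a b i) c j w) \<in> laurent laurent_laurent"
    unfolding laurent_def[of laurent_laurent] by blast
qed

text \<open>
  At \<open>y\<^sub>1 = \<alpha> x + x\<^sub>1\<close>, \<open>y\<^sub>2 = \<beta> x + x\<^sub>2\<close> the three locality polynomials become monomials in
  \<open>x\<^sub>1 - (\<alpha>/\<beta>) x\<^sub>2\<close>, \<open>x\<^sub>1\<close> and \<open>x\<^sub>2\<close>, times a factor \<open>Q\<close> that is invertible in
  \<open>\<complex>((x))[[x\<^sub>1, x\<^sub>2]]\<close>.
\<close>

lemma weak_commutativity:
  assumes nz: "\<alpha> \<noteq> 0" "\<beta> \<noteq> 0" and abc: "a \<in> E_space s" "b \<in> E_space s" "c \<in> E_space s"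
    and f: "f = [:[:0, - (\<beta> / \<alpha>):], 1:] ^ k * f0" "poly2 (\<lambda>a. [:a:]) [:0, \<alpha>:] [:0, \<beta>:] f0 \<noteq> 0"
    and loc: "locality_poly s f a b" "locality_poly s g a c" "locality_poly s h b c"
    and compat_bc: "\<And>j. compatible s a (Y_op s \<beta> b c j)"
    and compat_ac: "\<And>i. compatible s b (Y_op s \<alpha> a c i)"
  defines "\<Delta> \<equiv> lin3 1 (- (\<beta> / \<alpha>)) 0"
  defines "A \<equiv> \<lambda>w j i. Y_op s \<alpha> a (Y_op s \<beta> b c j) i w"
  defines "B \<equiv> \<lambda>w j i. Y_op s \<beta> b (Y_op s \<alpha> a c i) j w"
  shows "act3 s (\<Delta> ^ k) (A w) = act3 s (\<Delta> ^ k) (B w)"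
    and "\<exists>N. \<forall>w i j. i < N \<or> j < N \<longrightarrow> act3 s (\<Delta> ^ k) (A w) i j = 0"
proof -
  have g0: "g \<noteq> 0" "h \<noteq> 0" using loc by (auto simp: locality_poly_def)
  obtain r g0 where g: "g = [:[:0, - (1 / \<alpha>):], 1:] ^ r * g0"
    "poly2 (\<lambda>a. [:a:]) [:0, \<alpha>:] [:0, 1:] g0 \<noteq> 0"
    using poly2_factor[OF nz(1) one_neq_zero g0(1)] by blast
  obtain t h0 where h: "h = [:[:0, - (1 / \<beta>):], 1:] ^ t * h0"
    "poly2 (\<lambda>a. [:a:]) [:0, \<beta>:] [:0, 1:] h0 \<noteq> 0"
    using poly2_factor[OF nz(2) one_neq_zero g0(2)] by blast
  have ac: "compatible s a c" and bc: "compatible s b c"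
    using locality_poly_compat[OF loc(2)] locality_poly_compat[OF loc(3)] abc
    by (auto simp: compatible_def)
  let ?y3 = "lin3 0 0 1"
  let ?N1 = "lin3 0 (- (1 / \<alpha>)) 0 ^ r * lin3 (- (1 / \<beta>)) 0 0 ^ t"
  let ?N = "\<Delta> ^ k * ?N1"
  let ?Q = "tri f0 g0 h0 (lin3 0 1 \<alpha>) (lin3 1 0 \<beta>) ?y3"
  let ?P = "tri f g h (lin3 0 1 \<alpha>) (lin3 1 0 \<beta>) ?y3"
  let ?\<Delta>' = "lin3 (- (\<beta> / \<alpha>)) 1 0"
  let ?N1' = "lin3 (- (1 / \<alpha>)) 0 0 ^ r * lin3 0 (- (1 / \<beta>)) 0 ^ t"
  let ?N' = "?\<Delta>' ^ k * ?N1'"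
  let ?Q' = "tri f0 g0 h0 (lin3 1 0 \<alpha>) (lin3 0 1 \<beta>) ?y3"
  let ?P' = "tri f g h (lin3 1 0 \<alpha>) (lin3 0 1 \<beta>) ?y3"
  have P: "?P = ?Q * ?N" "?P' = ?Q' * ?N'"
    unfolding tri_def f(1) g(1) h(1) \<Delta>_def poly2_lin3_factor using nz by (simp_all add: mult_ac)
  have Q: "const_term ?Q \<noteq> 0" "const_term ?Q' \<noteq> 0"
    using f(2) g(2) h(2) by (simp_all add: tri_def const_term_simps const_term_poly2)
  \<comment> \<open>Only with its indices exchanged, so that x_1 is outermost, is the second product
    known to lie in an iterated Laurent space.\<close>
  define A' where "A' = (\<lambda>w i j. B w j i)"
  have lau: "A w \<in> laurent laurent_laurent" "A' w \<in> laurent laurent_laurent" for w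
    unfolding A_def A'_def B_def
    by (rule Y_op_iterated_left_laurent[OF nz(1) abc(1) bc compat_bc]
        Y_op_iterated_left_laurent[OF nz(2) abc(2) ac compat_ac])+
  let ?S = "subst (series_scale s)"
  let ?T = "\<lambda>w. act3 s (tri f g h (lin3 0 0 1) (lin3 0 1 0) (lin3 1 0 0)) (triple a b c w)"
  let ?T' = "\<lambda>w. act3 s (tri (poly_swap f) h g (lin3 0 0 1) (lin3 0 1 0) (lin3 1 0 0)) (triple b a c w)"
  have PA: "act3 s ?P (A w) = (\<lambda>j. subst s \<alpha> (?S \<beta> (?T w) j))" for w
    unfolding A_def by (rule tri_iterated_left[OF abc loc nz compat_bc])
  have PA': "act3 s ?P' (A' w) = (\<lambda>i. subst s \<beta> (?S \<alpha> (?T' w) i))" for w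
  proof -
    have "?P' = tri (poly_swap f) h g (lin3 0 1 \<beta>) (lin3 1 0 \<alpha>) ?y3"
      by (simp add: tri_def mult_ac)
    then show ?thesis
      unfolding A'_def B_def
      using tri_iterated_left[OF abc(2,1,3) locality_poly_swap[OF loc(1)] loc(3,2) nz(2,1) compat_ac]
      by simp
  qed
  have zero: "subst s \<alpha> (?S \<beta> T j) i = 0" if "i < 0 \<or> j < 0" "T \<in> trunc3" for \<alpha> \<beta> i j T
    using that(1)
  proof
    assume "j < 0"
    then have "?S \<beta> T j = 0" by (simp add: fun_eq_iff subst_value[OF trunc3_coeff(1)[OF that(2)]] subst_neg)
    then show ?thesis by (simp add: subst_def fun_eq_iff)
  qed (simp add: subst_neg fun_eq_iff)
  have T: "?T w \<in> trunc3" "?T' w \<in> trunc3" for w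
    by (rule tri_trunc3[OF abc loc] tri_trunc3[OF abc(2,1,3) locality_poly_swap[OF loc(1)] loc(3,2)])+
  \<comment> \<open>Multiplied by the unit \<open>?Q\<close>, this is a substituted series, which
    has no negative powers of x_1 and x_2; removing the unit keeps it so.\<close>
  have NA: "act3 s ?N (A w) j i = 0" if "j < 0 \<or> i < 0" for w i j
  proof (rule act3_nonneg_cancel[OF Q(1) _ _ that])
    show "act3 s ?N (A w) \<in> laurent laurent_laurent"
      by (rule P3.subspace_scale[OF subspace_laurent_laurent_laurent lau(1)])
    show "act3 s ?Q (act3 s ?N (A w)) j i = 0" if "j < 0 \<or> i < 0" for i j
      using zero[OF _ T(1), of i j \<alpha> \<beta> w] that PA[of w] by (simp only: P P3.scale_scale disj_commute)
  qed
  have NA': "act3 s ?N' (A' w) i j = 0" if "i < 0 \<or> j < 0" for w i j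
  proof (rule act3_nonneg_cancel[OF Q(2) _ _ that])
    show "act3 s ?N' (A' w) \<in> laurent laurent_laurent"
      by (rule P3.subspace_scale[OF subspace_laurent_laurent_laurent lau(2)])
    show "act3 s ?Q' (act3 s ?N' (A' w)) i j = 0" if "i < 0 \<or> j < 0" for i j
      using zero[OF _ T(2), of j i \<beta> \<alpha> w] that PA'[of w] by (simp only: P P3.scale_scale disj_commute)
  qed
  have flip_power: "act3 s (lin3 a b c ^ n) (\<lambda>i j. X j i) = (\<lambda>i j. act3 s (lin3 b a c ^ n) X j i)" for a b c n X
    unfolding lin3_power using act3_flip_outer[of a b c a b c _ X] by simp
  have flip: "act3 s ?N (B w) = (\<lambda>j i. act3 s ?N' (A' w) i j)" for w
  proof -
    let ?X = "act3 s (lin3 0 (- (1 / \<beta>)) 0 ^ t) (A' w)"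
    let ?Y = "act3 s (lin3 (- (1 / \<alpha>)) 0 0 ^ r) ?X"
    have "act3 s ?N (B w) = act3 s (\<Delta> ^ k) (act3 s (lin3 0 (- (1 / \<alpha>)) 0 ^ r)
        (act3 s (lin3 (- (1 / \<beta>)) 0 0 ^ t) (\<lambda>i j. A' w j i)))"
      by (simp add: A'_def mult.assoc)
    also have "\<dots> = (\<lambda>i j. act3 s (?\<Delta>' ^ k) ?Y j i)"
      unfolding \<Delta>_def flip_power[of _ _ _ _ "A' w"] flip_power[of _ _ _ _ ?X] flip_power[of _ _ _ _ ?Y] ..
    finally show ?thesis by (simp add: mult.assoc)
  qed
  have PB: "act3 s ?P (B w) = act3 s ?P (A w)" for w
  proof -
    have "act3 s ?P (\<lambda>i j k. A' w j i k) = (\<lambda>j i k. act3 s ?P' (A' w) i j k)"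
      by (rule act3_tri_flip_outer)
    then have "act3 s ?P (B w) = (\<lambda>j i. act3 s ?P' (A' w) i j)"
      by (simp add: A'_def)
    also have "\<dots> = (\<lambda>j i. subst s \<beta> (?S \<alpha> (?T' w) i) j)" unfolding PA' ..
    also have "\<dots> = (\<lambda>j i. subst s \<alpha> (?S \<beta> (?T w) j) i)"
      using subst_subst_commute[OF T(2), of \<beta> \<alpha> w] tri_flip[OF abc loc, of w] by simp
    finally show ?thesis unfolding PA .
  qed
  \<comment> \<open>Having no negative powers in either variable, the two series now lie in a common
    iterated Laurent space, and \<open>?Q\<close> can be cancelled from their difference.\<close>
  have NAB: "act3 s ?N (A w) = act3 s ?N (B w)" for w
  proof -
    let ?D = "act3 s ?N (A w) - act3 s ?N (B w)"
    have in_laurent: "act3 s ?N (A w) j i \<in> laurent UNIV" "act3 s ?N' (A' w) i j \<in> laurent UNIV" for i j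
      using P3.subspace_scale[OF subspace_laurent_laurent_laurent lau(1)]
        P3.subspace_scale[OF subspace_laurent_laurent_laurent lau(2)] laurent_laurent_laurent_coeff by blast+
    have "?D \<in> laurent laurent_laurent"
    proof (rule laurent_laurent_laurentI[where N = 0])
      show "?D j i = 0" if "j < 0 \<or> i < 0" for i j
        using NA[of j i w] NA'[of i j w] that by (auto simp: flip)
      show "?D j i \<in> laurent UNIV" for i j
        using P1.subspace_diff[OF subspace_laurent[OF subspace_UNIV] in_laurent] by (simp add: flip)
    qed
    moreover have "act3 s ?Q ?D = 0"
      using PB[of w] by (simp add: P P3.scale_right_diff_distrib)
    moreover have "?Q \<noteq> 0" using Q(1) by (auto simp: const_term_simps)
    ultimately show ?thesis using act3_inj by fastforce
  qed
  have N1: "act3 s ?N X = (\<lambda>i j l. s ((- (1 / \<alpha>)) ^ r * (- (1 / \<beta>)) ^ t)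
      (act3 s (\<Delta> ^ k) X (i - int t) (j - int r) l))" for X
  proof -
    have "act3 s ?N X = act3 s (lin3 0 (- (1 / \<alpha>)) 0 ^ r) (act3 s (lin3 (- (1 / \<beta>)) 0 0 ^ t) (act3 s (\<Delta> ^ k) X))"
      by (simp add: mult_ac)
    then show ?thesis unfolding act3_lin3_power by simp
  qed

  show "act3 s (\<Delta> ^ k) (A w) = act3 s (\<Delta> ^ k) (B w)"
  proof (intro ext)
    fix i j k'
    have "act3 s ?N (A w) (i + int t) (j + int r) k' = act3 s ?N (B w) (i + int t) (j + int r) k'"
      unfolding NAB ..
    then have "s ((- (1 / \<alpha>)) ^ r * (- (1 / \<beta>)) ^ t)
      (act3 s (\<Delta> ^ k) (A w) i j k' - act3 s (\<Delta> ^ k) (B w) i j k') = 0"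
      by (simp add: N1 scale_right_diff_distrib)
    then show "act3 s (\<Delta> ^ k) (A w) i j k' = act3 s (\<Delta> ^ k) (B w) i j k'"
      using nz by (simp add: scalar_zero_iff[OF module_axioms])
  qed
  \<comment> \<open>The monomial x_1^r x_2^t merely shifts the indices. Its exponents come from
    \<open>g\<close> and \<open>h\<close>, so the resulting bound is the same for all
    \<open>w\<close>.\<close>
  have "act3 s (\<Delta> ^ k) (A w) i j = 0" if ij: "i < - int t - int r \<or> j < - int t - int r" for w i j
  proof
    fix k'
    have "act3 s ?N (A w) (i + int t) (j + int r) k' = 0"
      using NA[of "i + int t" "j + int r" w] ij by auto
    then have "s ((- (1 / \<alpha>)) ^ r * (- (1 / \<beta>)) ^ t) (act3 s (\<Delta> ^ k) (A w) i j k') = 0"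
      by (simp add: N1)
    then show "act3 s (\<Delta> ^ k) (A w) i j k' = 0 k'"
      using nz by (simp add: scalar_zero_iff[OF module_axioms])
  qed
  then show "\<exists>N. \<forall>w i j. i < N \<or> j < N \<longrightarrow> act3 s (\<Delta> ^ k) (A w) i j = 0" by blast
qed

end

lemma const_term_poly2_nonzero:
  assumes "c \<noteq> 0" "c' \<noteq> 0" "f \<noteq> 0" "a' \<noteq> c' / c * a \<or> b' \<noteq> c' / c * b"
  shows "poly2 cst3 (lin3 a b c) (lin3 a' b' c') f \<noteq> 0"
proof (rule poly2_nonzero[where \<psi> = const_term and \<alpha> = c and \<beta> = c'])
  show "lin3 a' b' c' \<noteq> cst3 (c' / c) * lin3 a b c" unfolding lin3_simps using assms(4) by blast
qed (use assms in \<open>simp_all add: const_term_simps\<close>)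

text \<open>The second form has no component in the third variable, so \<open>const_term\<close>
  would send it to 0. Setting only the first variable to 0 leaves \<open>g\<close> with one variable
  rescaled by \<gamma>, and the rescaling can be undone.\<close>

lemma poly2_separate_nonzero:
  assumes "\<gamma> \<noteq> 0" "g \<noteq> 0"
  shows "poly2 cst3 (lin3 a 0 \<gamma>) (lin3 0 1 0) g \<noteq> 0"
proof
  assume "poly2 cst3 (lin3 a 0 \<gamma>) (lin3 0 1 0) g = 0"
  moreover have "coeff (poly2 cst3 (lin3 a 0 \<gamma>) (lin3 0 1 0) g) 0 = poly2 cst2 [:[:0, \<gamma>:]:] [:0, 1:] g"
    by (subst poly2_hom) (simp_all add: coeff_mult_0, simp add: lin3_def one_pCons)
  ultimately have "poly2 cst2 [:[:0, 1 / \<gamma>:]:] [:0, 1:] (poly2 cst2 [:[:0, \<gamma>:]:] [:0, 1:] g) = 0"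
    by simp
  moreover have "poly2 cst2 [:[:0, 1 / \<gamma>:]:] [:0, 1:] [:[:0, \<gamma>:]:] = [:[:0, 1:]:]"
    using assms(1) by (simp add: poly2_pCons map_poly_pCons)
  moreover have "poly2 cst2 [:[:0, 1 / \<gamma>:]:] [:0, 1:] [:0, 1:] = [:0, 1:]"
    by (simp add: poly2_pCons map_poly_pCons one_pCons)
  ultimately show False using assms(2) by (simp add: poly2_poly2)
qed

context cspace
begin

text \<open>Multiplied by \<open>?R'\<close>, both sides become the value of the cleared triple
  product at y_1 = \<gamma>\<beta> x + \<gamma> x_2 + x_0, y_2 = \<beta> x + x_2: the left side as a
  nested operator, the right side by putting x_1 = \<gamma> x_2 + x_0 into the product. That
  substitution turns x_2 - x_1/\<gamma> into -x_0/\<gamma>, which explains the powers on the two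
  sides.\<close>

lemma weak_associativity:
  fixes w :: 'u
  assumes nz: "\<beta> \<noteq> 0" "\<gamma> \<noteq> 0" and abc: "a \<in> E_space s" "b \<in> E_space s" "c \<in> E_space s"
    and f: "f = [:[:0, - (1 / \<gamma>):], 1:] ^ k * f0"
    and loc: "locality_poly s f a b" "locality_poly s g a c" "locality_poly s h b c"
    and compat_bc: "\<And>j. compatible s a (Y_op s \<beta> b c j)"
    and compat_ab: "\<And>i. compatible s (Y_op s \<gamma> a b i) c"
  defines "A \<equiv> \<lambda>j i. Y_op s (\<gamma> * \<beta>) a (Y_op s \<beta> b c j) i w"
  assumes low: "\<And>i j. i < N \<or> j < N \<Longrightarrow> act3 s (lin3 1 (- (1 / \<gamma>)) 0 ^ k) A i j = 0"
  shows "act3 s (lin3 (- (1 / \<gamma>)) 0 0 ^ k) (\<lambda>i j. Y_op s \<beta> (Y_op s \<gamma> a b i) c j w)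
    = subst (series_scale s) \<gamma> (act3 s (lin3 1 (- (1 / \<gamma>)) 0 ^ k) A)"
proof -
  interpret V: cspace "series_scale s" by (rule cspace_series_scale)
  let ?S = "subst (series_scale s)"
  let ?C = "\<lambda>i j. Y_op s \<beta> (Y_op s \<gamma> a b i) c j w"
  let ?T = "act3 s (tri f g h (lin3 0 0 1) (lin3 0 1 0) (lin3 1 0 0)) (triple a b c w)"
  let ?H = "act3 s (lin3 1 (- (1 / \<gamma>)) 0 ^ k) A"
  let ?R = "tri f0 g h (lin3 0 1 (\<gamma> * \<beta>)) (lin3 1 0 \<beta>) (lin3 0 0 1)"
  let ?R' = "tri f0 g h (lin3 1 \<gamma> (\<gamma> * \<beta>)) (lin3 0 1 \<beta>) (lin3 0 0 1)"
  have nz': "\<gamma> * \<beta> \<noteq> 0" using nz by simp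
  have T: "?T \<in> trunc3" by (rule tri_trunc3[OF abc loc])
  let ?G = "\<lambda>j. subst s (\<gamma> * \<beta>) (?S \<beta> ?T j)"
  have G: "?G = act3 s ?R ?H"
  proof -
    have "?G = act3 s (tri f g h (lin3 0 1 (\<gamma> * \<beta>)) (lin3 1 0 \<beta>) (lin3 0 0 1)) A"
      unfolding A_def by (rule tri_iterated_left[OF abc loc nz' nz(1) compat_bc, symmetric])
    also have "tri f g h (lin3 0 1 (\<gamma> * \<beta>)) (lin3 1 0 \<beta>) (lin3 0 0 1) = ?R * lin3 1 (- (1 / \<gamma>)) 0 ^ k"
      unfolding tri_def f poly2_lin3_factor using nz by (simp add: mult_ac)
    finally show ?thesis by simp
  qed
  have "?G \<in> trunc2"
  proof -
    have "?G j i = 0" if "j < 0 \<or> i < 0" for i j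
      using that
    proof
      assume "j < 0"
      then have "?S \<beta> ?T j = 0" by (simp add: fun_eq_iff subst_value[OF trunc3_coeff(1)[OF T]] subst_neg)
      then show ?thesis by (simp add: subst_def fun_eq_iff)
    qed (simp add: subst_neg fun_eq_iff)
    then show ?thesis unfolding trunc2_def by blast
  qed
  then have "?S \<gamma> ?G = (\<lambda>i. subst s \<beta> (\<lambda>q. subst s \<gamma> (?T q) i))"
    by (rule subst_subst_compose[OF T nz])
  also have "\<dots> = act3 s (tri f g h (lin3 1 \<gamma> (\<gamma> * \<beta>)) (lin3 0 1 \<beta>) (lin3 0 0 1)) ?C"
    by (rule tri_iterated_nested[OF abc loc nz compat_ab, symmetric])
  also have "tri f g h (lin3 1 \<gamma> (\<gamma> * \<beta>)) (lin3 0 1 \<beta>) (lin3 0 0 1) = ?R' * lin3 (- (1 / \<gamma>)) 0 0 ^ k"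
    unfolding tri_def f poly2_lin3_factor using nz by (simp add: mult_ac)
  finally have 1: "?S \<gamma> ?G = act3 s ?R' (act3 s (lin3 (- (1 / \<gamma>)) 0 0 ^ k) ?C)" by simp
  \<comment> \<open>The substitution of x_1 is applied to \<open>?H\<close> and not to
    \<open>A\<close>, since it is the power of x_2 - x_1/\<gamma> that provides the bounds in both
    variables.\<close>
  have H: "?H \<in> trunc2" using low unfolding trunc2_def by blast
  have "?S \<gamma> ?G = act3 s ?R' (?S \<gamma> ?H)"
    unfolding G subst_values_tri[OF nz(2) H] by simp
  with 1 have eq: "act3 s ?R' (act3 s (lin3 (- (1 / \<gamma>)) 0 0 ^ k) ?C - ?S \<gamma> ?H) = 0"
    by (simp add: P3.scale_right_diff_distrib del: P3.scale_scale)
  have bc: "compatible s b c" and ab: "compatible s a b"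
    using locality_poly_compat[OF loc(1)] locality_poly_compat[OF loc(3)] abc by (auto simp: compatible_def)
  have "A \<in> laurent laurent_laurent"
    unfolding A_def by (rule Y_op_iterated_left_laurent[OF nz' abc(1) bc compat_bc])
  then have "?H i j \<in> laurent UNIV" for i j
    by (intro laurent_laurent_laurent_coeff P3.subspace_scale[OF subspace_laurent_laurent_laurent])
  moreover have "series_scale s d v = poly_act s [:d:] v" for d v
    by (simp add: act_simps series_scale_def fun_eq_iff)
  moreover have "?S \<gamma> ?H i m = (\<Sum>p\<in>{N..m + i - N}. series_scale s (bcoef \<gamma> p i) (?H (m + i - p) p))" for i m
    by (rule V.subst_eq[of N]) (use low in auto)
  ultimately have "?S \<gamma> ?H i m \<in> laurent UNIV" for i m
    by (simp only:) (intro P1.subspace_sum P1.subspace_scale subspace_laurent subspace_UNIV)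
  then have SH: "?S \<gamma> ?H \<in> laurent laurent_laurent"
    using V.subst_in_laurent_laurent[OF H, of \<gamma>] unfolding laurent_def by blast
  have "?C \<in> laurent laurent_laurent"
    by (rule Y_op_iterated_right_laurent(2)[OF nz(1) ab abc(3) compat_ab])
  then have "act3 s (lin3 (- (1 / \<gamma>)) 0 0 ^ k) ?C - ?S \<gamma> ?H \<in> laurent laurent_laurent"
    by (intro P3.subspace_diff P3.subspace_scale subspace_laurent_laurent_laurent SH)
  moreover have "?R' \<noteq> 0"
  proof -
    have "f0 \<noteq> 0" "g \<noteq> 0" "h \<noteq> 0" using loc f by (auto simp: locality_poly_def)
    then have "poly2 cst3 (lin3 1 \<gamma> (\<gamma> * \<beta>)) (lin3 0 1 \<beta>) f0 \<noteq> 0"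
      "poly2 cst3 (lin3 1 \<gamma> (\<gamma> * \<beta>)) (lin3 0 0 1) g \<noteq> 0" "poly2 cst3 (lin3 0 1 \<beta>) (lin3 0 0 1) h \<noteq> 0"
      using nz by (simp_all add: const_term_poly2_nonzero)
    then show ?thesis by (simp add: tri_def)
  qed
  ultimately show ?thesis using act3_inj[OF eq] by simp
qed

text \<open>Let \<open>e\<close> be the lowest exponent of \<open>P\<close>. If \<open>R\<close>
  annihilates all coefficients before \<open>N + n\<close>, then applying \<open>R\<close> to the
  coefficient of the product at \<open>N + n + e\<close> leaves only \<open>coeff P e\<close> acting
  on the coefficient of \<open>D\<close> at \<open>N + n\<close>, so \<open>coeff P e * R\<close>
  reaches one step further. The choice never involves \<open>w\<close>.\<close>

lemma leading_annihilator:
  assumes P: "P \<noteq> 0" and low: "\<And>w i. i < N \<Longrightarrow> D w i = 0" and 0: "\<And>w. act3 s P (D w) = 0"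
  shows "\<exists>r. r \<noteq> 0 \<and> (\<forall>w. act2 s r (D w i) = 0)"
proof -
  define e where "e = (LEAST i. coeff P i \<noteq> 0)"
  have "\<exists>i. coeff P i \<noteq> 0" using P by (auto simp: poly_eq_iff)
  then have e: "coeff P e \<noteq> 0" unfolding e_def by (rule LeastI_ex)
  have lowP: "coeff P i = 0" if "i < e" for i using that not_less_Least unfolding e_def by blast
  have "\<exists>R. R \<noteq> 0 \<and> (\<forall>w. \<forall>i < N + int n. act2 s R (D w i) = 0)" for n
  proof (induction n)
    case 0
    then show ?case by (intro exI[of _ 1]) (simp add: low)
  next
    case (Suc n)
    then obtain R where R: "R \<noteq> 0" "\<And>w i. i < N + int n \<Longrightarrow> act2 s R (D w i) = 0" by blast
    have "act2 s (coeff P e * R) (D w (N + int n)) = 0" for w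
    proof -
      let ?i = "N + int n + int e"
      let ?t = "\<lambda>j. act2 s R (act2 s (coeff P j) (D w (?i - int j)))"
      have "0 = act2 s R (act3 s P (D w) ?i)" by (simp add: 0)
      also have "\<dots> = (\<Sum>j\<le>max e (degree P). ?t j)"
        by (simp add: P2.poly_act_eq[of P "max e (degree P)"] P2.scale_sum_right)
      also have "\<dots> = (\<Sum>j\<in>{e}. ?t j)"
      proof (rule sum.mono_neutral_right)
        show "\<forall>j\<in>{..max e (degree P)} - {e}. ?t j = 0"
        proof
          fix j assume "j \<in> {..max e (degree P)} - {e}"
          then consider "j < e" | "e < j" by fastforce
          then show "?t j = 0"
          proof cases
            case 2
            have "?t j = act2 s (coeff P j) (act2 s R (D w (?i - int j)))" by (simp add: mult.commute)
            also have "\<dots> = 0" using 2 by (subst R(2)) simp_all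
            finally show ?thesis .
          qed (simp add: lowP)
        qed
      qed auto
      finally show ?thesis by (simp add: mult.commute)
    qed
    moreover have "act2 s (coeff P e * R) (D w i) = 0" if "i < N + int n" for w i
      using R(2)[OF that] by (simp flip: P2.scale_scale)
    ultimately have "act2 s (coeff P e * R) (D w i) = 0" if "i < N + int (Suc n)" for w i
      using that by (cases "i = N + int n") auto
    then show ?case using R(1) e by (intro exI[of _ "coeff P e * R"]) simp
  qed
  from this[of "nat (i - N + 1)"] obtain R where
    "R \<noteq> 0" "\<forall>w. \<forall>i' < N + int (nat (i - N + 1)). act2 s R (D w i') = 0" by blast
  moreover have "i < N + int (nat (i - N + 1))" by linarith
  ultimately show ?thesis by blast
qed

text \<open>Dong's lemma. The coefficients of \<open>\<Y>\<^sub>\<gamma>(a, x\<^sub>0) b c - c \<Y>\<^sub>\<gamma>(a, x\<^sub>0) b\<close> are annihilated one after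
  the other, starting from the lowest power of \<open>x\<^sub>0\<close>.\<close>

lemma Y_op_quasi_local:
  assumes \<gamma>: "\<gamma> \<noteq> 0" and abc: "a \<in> E_space s" "b \<in> E_space s" "c \<in> E_space s"
    and loc: "mutually_quasi_local s a b" "mutually_quasi_local s a c" "mutually_quasi_local s b c"
  shows "mutually_quasi_local s (Y_op s \<gamma> a b i) c"
proof -
  obtain f g h where loc: "locality_poly s f a b" "locality_poly s g a c" "locality_poly s h b c"
    using loc unfolding mutually_quasi_local_iff by blast
  then have fgh: "f \<noteq> 0" "g \<noteq> 0" "h \<noteq> 0" by (auto simp: locality_poly_def)
  have ab: "compatible s a b"
    using locality_poly_compat[OF loc(1)] abc by (auto simp: compatible_def)
  let ?P = "tri f g h (lin3 1 0 \<gamma>) (lin3 0 0 1) (lin3 0 1 0)"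
  let ?T = "\<lambda>w. act3 s (tri f g h (lin3 0 0 1) (lin3 0 1 0) (lin3 1 0 0)) (triple a b c w)"
  let ?X = "\<lambda>w i q p. Y_op s \<gamma> a b i (c w q) p"
  let ?Y = "\<lambda>w i q p. c (Y_op s \<gamma> a b i w p) q"
  have X: "act3 s ?P (?X w) = (\<lambda>i q. subst s \<gamma> (?T w q) i)" for w
    by (rule tri_iterated_right[OF abc loc \<gamma>])
  have Y: "act3 s ?P (?Y w) = (\<lambda>i q. subst s \<gamma> (?T w q) i)" for w
  proof -
    \<comment> \<open>With \<open>c\<close> on the left the substitution takes place inside its
      argument. By \<open>tri_rotate\<close> the cleared series is the same as for the other
      order.\<close>
    have "subst_rel s \<gamma> (\<lambda>p2 p1. c (a (b w p2) p1) q) (\<lambda>i p2. c (Y_op s \<gamma> a b i w p2) q)" for q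
      by (rule subst_rel_linear[OF module_axioms _ _ Y_op_subst_rel[OF \<gamma> ab]]) (simp_all add: E_spaceD[OF abc(3)])
    then have "subst_rel s \<gamma> (?T w q)
       (act3 s (tri f g h (lin3 0 1 \<gamma>) (lin3 0 0 1) (lin3 1 0 0)) (\<lambda>q i p2. c (Y_op s \<gamma> a b i w p2) q) q)" for q
      using subst_rel_tri[OF \<gamma>, of "\<lambda>q p2 p1. c (a (b w p2) p1) q" "\<lambda>q i p2. c (Y_op s \<gamma> a b i w p2) q" f g h 0 0 1 0 1 0 1 0 0 q]
      by (simp add: tri_rotate[OF abc loc])
    then have "act3 s (tri f g h (lin3 0 1 \<gamma>) (lin3 0 0 1) (lin3 1 0 0)) (\<lambda>q i p2. c (Y_op s \<gamma> a b i w p2) q)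
        = (\<lambda>q. subst s \<gamma> (?T w q))"
      using subst_rel_eq_subst[OF \<gamma> _ trunc3_coeff(2)[OF tri_trunc3[OF abc loc]]] by blast
    then show ?thesis
      using act3_tri_flip_outer[of f g h 1 0 \<gamma> 0 0 1 0 1 0 "\<lambda>q i p2. c (Y_op s \<gamma> a b i w p2) q"]
      by simp
  qed
  have "?P \<noteq> 0"
  proof -
    have "poly2 cst3 (lin3 1 0 \<gamma>) (lin3 0 0 1) f \<noteq> 0"
      using \<gamma> fgh by (simp add: const_term_poly2_nonzero)
    then show ?thesis
      using poly2_separate_nonzero[OF \<gamma> fgh(2)] poly2_separate_nonzero[OF one_neq_zero fgh(3)]
      by (simp add: tri_def)
  qed
  moreover obtain N where N: "\<forall>i<N. Y_op s \<gamma> a b i = 0" using Y_op_low[OF ab] by blast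
  moreover have "act3 s ?P (?X w - ?Y w) = 0" for w
    by (simp only: P3.scale_right_diff_distrib X Y diff_self)
  \<comment> \<open>The two terms are lower truncated in different variables, so \<open>?P\<close>
    cannot be cancelled; an annihilating polynomial for each coefficient is what quasi locality asks
    for.\<close>
  ultimately obtain r where r: "r \<noteq> 0" "\<And>w. act2 s r ((?X w - ?Y w) i) = 0"
    using leading_annihilator[of ?P N "\<lambda>w. ?X w - ?Y w" i] E_space_zero[OF abc(3)] by (auto simp: fun_eq_iff)
  have "act2 s r (\<lambda>q p. Y_op s \<gamma> a b i (c w q) p) = act2 s r (\<lambda>q p. c (Y_op s \<gamma> a b i w p) q)" for w
    using r(2)[of w] by (simp add: P2.scale_right_diff_distrib)
  then show ?thesis
    using r(1) unfolding mutually_quasi_local_iff locality_poly_def by blast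
qed

end

section \<open>Delta functions\<close>

lemma gbinomial_nat_symmetric: "(of_nat (k + e) :: complex) gchoose e = of_nat (k + e) gchoose k"
proof -
  have "(k + e) choose e = (k + e) choose k" using binomial_symmetric[of k "k + e"] by simp
  then show ?thesis by (simp only: flip: binomial_gbinomial)
qed

text \<open>The left side compares the two expansions of (x_1 - \<gamma> x_2)^(-K-1). For K < 0 this
  is a polynomial and the expansions agree; for K \<ge> 0 at most one of the two terms is present,
  and upper negation of the binomial coefficient turns it into the right side. The cases are the
  possible positions of \<open>d\<close> relative to 0 and K.\<close>

lemma delta_coeff_identity:
  assumes \<gamma>: "\<gamma> \<noteq> 0"
  shows "(if d \<ge> K then (of_int (- K - 1) gchoose nat (d - K)) * (- \<gamma>) ^ nat (d - K) else 0)
    - (if d \<le> - 1 then (of_int (- K - 1) gchoose nat (- 1 - d)) * (- \<gamma>) powi (d - K) else 0)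
    = bcoef \<gamma> d K"
proof -
  have pow: "(- \<gamma>) powi (d - K) = (- 1) powi (d - K) * \<gamma> powi (d - K)"
    by (simp flip: power_int_mult_distrib)
  have pow': "(- \<gamma>) ^ nat (d - K) = (- \<gamma>) powi (d - K)" if "d \<ge> K"
    using that by (simp add: power_int_def)
  consider (pp) "K \<ge> 0" "d \<ge> K" | (pl) "K \<ge> 0" "d \<ge> 0" "d < K" | (pn) "K \<ge> 0" "d < 0"
    | (np) "K < 0" "d \<ge> 0" | (nl) "K < 0" "d < 0" "d \<ge> K" | (nn) "K < 0" "d < K" by linarith
  then show ?thesis
  proof cases
    case pp
    have aux: "(u * y) * v = y * w" if "u * v = w" for u v w y :: complex
      unfolding that[symmetric] by (simp add: algebra_simps)
    obtain k e where k: "K = int k" "d = int (k + e)"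
      using pp by (intro that[of "nat K" "nat (d - K)"]) auto
    have "(of_int (- K - 1) :: complex) = - (of_nat k + 1)" using k by simp
    then have "(of_int (- K - 1) :: complex) gchoose e = (- 1) ^ e * (of_nat (k + e) gchoose e)"
      by (simp only: gbinomial_minus) simp
    also note gbinomial_nat_symmetric
    finally have G: "(of_int (- K - 1) :: complex) gchoose e = (- 1) ^ e * (of_nat (k + e) gchoose k)" .
    have "(- 1) ^ e * (- \<gamma>) ^ e = \<gamma> ^ e" by (simp flip: power_mult_distrib)
    then have "((- 1) ^ e * (of_nat (k + e) gchoose k)) * (- \<gamma>) ^ e = (of_nat (k + e) gchoose k) * \<gamma> ^ e"
      by (rule aux)
    moreover have "nat (d - K) = e" "d - K = int e" "\<not> d \<le> - 1" "nat K = k" "(of_int d :: complex) = of_nat (k + e)"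
      using k by auto
    ultimately show ?thesis
      using pp(1) by (simp only: bcoef_def G) simp
  next
    case pl
    then obtain k e where "K = int k" "d = int e" by (intro that[of "nat K" "nat d"]) auto
    then show ?thesis using pl by (simp add: bcoef_def flip: binomial_gbinomial)
  next
    case pn
    have aux: "0 - (u * y) * (v * g) = (w * y) * g" if "- (u * v) = w" for u v w y g :: complex
      unfolding that[symmetric] by (simp add: algebra_simps)
    obtain k e where k: "K = int k" "d = - 1 - int e"
      using pn by (intro that[of "nat K" "nat (- 1 - d)"]) auto
    have "(of_int (- K - 1) :: complex) = - (of_nat k + 1)" "(of_int d :: complex) = - (of_nat e + 1)"
      using k by simp_all
    then have 1: "(of_int (- K - 1) :: complex) gchoose e = (- 1) ^ e * (of_nat (k + e) gchoose e)"
      and 2: "(of_int d :: complex) gchoose k = (- 1) ^ k * (of_nat (k + e) gchoose k)"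
      by (simp_all only: gbinomial_minus) (simp_all add: add.commute)
    note 3 = gbinomial_nat_symmetric[of k e]
    have "- ((- 1 :: complex) ^ e * (- 1) powi (d - K)) = (- 1) ^ k"
    proof -
      have "d - K = - int (Suc (e + k))" using k by simp
      then have "(- 1 :: complex) powi (d - K) = inverse ((- 1) ^ Suc (e + k))"
        by (simp only: power_int_minus power_int_of_nat)
      also have "\<dots> = (- 1) ^ Suc (e + k)" by (simp flip: power_inverse)
      finally have "(- 1 :: complex) powi (d - K) = - ((- 1) ^ e * (- 1) ^ k)" by (simp add: power_add)
      moreover have "(- 1 :: complex) ^ e * (- 1) ^ e = 1" by (simp flip: power_mult_distrib)
      ultimately show ?thesis by (simp flip: mult.assoc)
    qed
    then have "0 - ((- 1) ^ e * (of_nat (k + e) gchoose k)) * ((- 1) powi (d - K) * \<gamma> powi (d - K))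
        = ((- 1) ^ k * (of_nat (k + e) gchoose k)) * \<gamma> powi (d - K)"
      by (rule aux)
    moreover have "nat (- 1 - d) = e" "nat K = k" "\<not> d \<ge> K" "d \<le> - 1" using pn k by auto
    ultimately show ?thesis
      using pn(1) by (simp only: bcoef_def 1 2 3 pow if_True if_False)
  next
    case np
    then obtain k e where "- K - 1 = int k" "d = int e" by (intro that[of "nat (- K - 1)" "nat d"]) auto
    moreover from this have "nat (d - K) > k" by simp
    ultimately show ?thesis using np by (simp add: bcoef_neg flip: binomial_gbinomial)
  next
    case nl
    then obtain k e where k: "- K - 1 = int (k + e)" "- 1 - d = int e"
      by (intro that[of "nat (d - K)" "nat (- 1 - d)"]) auto
    have "nat (d - K) = k" "nat (- 1 - d) = e" using k by auto
    moreover note gbinomial_nat_symmetric[of k e]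
    ultimately show ?thesis
      using nl k(1) pow' by (simp add: bcoef_neg) 
  next
    case nn
    then obtain k e where "- K - 1 = int k" "- 1 - d = int e"
      by (intro that[of "nat (- K - 1)" "nat (- 1 - d)"]) auto
    moreover from this have "e > k" using nn by simp
    ultimately show ?thesis using nn by (simp add: bcoef_neg flip: binomial_gbinomial)
  qed
qed

text \<open>The product of two powers of \<gamma> x_2 + x_0; below, n = -L-1 comes from the third
  delta function and \<open>p\<close> from the series it multiplies.\<close>

lemma bcoef_Vandermonde:
  assumes \<gamma>: "\<gamma> \<noteq> 0" and K: "K \<ge> 0"
  shows "(\<Sum>j\<le>nat K. (of_int n gchoose j) * \<gamma> powi (n - int j) * bcoef \<gamma> p (K - int j)) = bcoef \<gamma> (n + p) K"
proof -
  have "(\<Sum>j\<le>nat K. (of_int n gchoose j) * \<gamma> powi (n - int j) * bcoef \<gamma> p (K - int j))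
      = (\<Sum>j\<in>{0..nat K}. \<gamma> powi (n + p - K) * ((of_int n gchoose j) * (of_int p gchoose (nat K - j))))"
    unfolding atLeast0AtMost
  proof (rule sum.cong[OF refl])
    fix j assume j: "j \<in> {..nat K}"
    have "\<gamma> powi (n - int j) * \<gamma> powi (p - (K - int j)) = \<gamma> powi (n + p - K)"
      using \<gamma> by (simp add: algebra_simps flip: power_int_add)
    moreover have "nat (K - int j) = nat K - j" "K - int j \<ge> 0" using j K by auto
    ultimately show "(of_int n gchoose j) * \<gamma> powi (n - int j) * bcoef \<gamma> p (K - int j)
        = \<gamma> powi (n + p - K) * ((of_int n gchoose j) * (of_int p gchoose (nat K - j)))"
      by (simp add: bcoef_def)
  qed
  also have "\<dots> = bcoef \<gamma> (n + p) K"
    using K by (simp add: gbinomial_Vandermonde bcoef_def flip: sum_distrib_left)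
  finally show ?thesis .
qed

context cspace
begin

text \<open>Every coefficient of a product with one of the delta functions is a sum of this shape
  with a fixed upper argument \<open>n\<close>. Pascal's rule in \<open>n\<close> then accounts for
  multiplication by one more linear factor.\<close>

definition bsum :: "complex \<Rightarrow> (nat \<Rightarrow> 'u) \<Rightarrow> 'u" where
  "bsum n X = (\<Sum>j. s (n gchoose j) (X j))"

lemma bsum_eq:
  assumes "finite A" "\<And>j. j \<notin> A \<Longrightarrow> X j = 0"
  shows "bsum n X = (\<Sum>j\<in>A. s (n gchoose j) (X j))"
  unfolding bsum_def
proof (rule Sum_any.expand_superset[OF assms(1)])
  show "{j. s (n gchoose j) (X j) \<noteq> 0} \<subseteq> A" using assms(2) by force
qed

lemma bsum_cong: "(\<And>j. X j = Y j) \<Longrightarrow> bsum n X = bsum n Y"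
  by (simp add: bsum_def)

lemma bsum_scale:
  assumes "\<And>j. j \<ge> J \<Longrightarrow> X j = 0"
  shows "bsum n (\<lambda>j. s c (X j)) = s c (bsum n X)"
  by (subst (1 2) bsum_eq[of "{..<J}"]) (use assms in \<open>auto simp: scale_sum_right mult.commute not_less\<close>)

lemma bsum_add:
  assumes "\<And>j. j \<ge> J \<Longrightarrow> X j = 0" "\<And>j. j \<ge> J \<Longrightarrow> Y j = 0"
  shows "bsum n (\<lambda>j. X j + Y j) = bsum n X + bsum n Y"
  by (subst (1 2 3) bsum_eq[of "{..<J}"]) (use assms in \<open>auto simp: scale_right_distrib sum.distrib not_less\<close>)

lemma bsum_pascal:
  assumes "\<And>j. j \<ge> J \<Longrightarrow> X j = 0"
  shows "bsum (n + 1) X = bsum n X + bsum n (\<lambda>j. X (Suc j))"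
proof -
  have X: "bsum m X = X 0 + (\<Sum>j\<in>{..<J}. s (m gchoose Suc j) (X (Suc j)))" for m
  proof -
    have "bsum m X = (\<Sum>j\<in>{..<Suc J}. s (m gchoose j) (X j))"
      by (rule bsum_eq) (use assms in auto)
    then show ?thesis by (simp only: sum.lessThan_Suc_shift) simp
  qed
  have "bsum n (\<lambda>j. X (Suc j)) = (\<Sum>j\<in>{..<J}. s (n gchoose j) (X (Suc j)))"
    by (rule bsum_eq) (use assms in auto)
  then show ?thesis
    by (simp add: X gbinomial_Suc_Suc scale_left_distrib sum.distrib)
qed

lemma scale_bsum_pascal:
  assumes "\<And>j. j \<ge> J \<Longrightarrow> X j = 0"
  shows "s c (bsum (n + 1) X) = bsum n (\<lambda>j. s c (X j + X (Suc j)))"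
proof -
  have X': "X (Suc j) = 0" if "j \<ge> J" for j using assms that by simp
  have "bsum (n + 1) X = bsum n (\<lambda>j. X j + X (Suc j))"
    by (simp only: bsum_pascal[OF assms] bsum_add[OF assms X'])
  moreover have "X j + X (Suc j) = 0" if "j \<ge> J" for j using assms X' that by simp
  ultimately show ?thesis using bsum_scale[of J "\<lambda>j. X j + X (Suc j)"] by simp
qed

text \<open>\<open>delta1\<close>, \<open>delta2\<close> and \<open>delta3\<close> are the
  coefficients of x_0^K x_1^L x_2^M in the three terms of the Jacobi identity. \<open>A\<close> and
  \<open>B\<close> are indexed by (x_2, x_1), and \<open>C\<close> by (x_0, x_2).\<close>

definition delta1 where
  "delta1 \<gamma> A K L M = bsum (of_int (- K - 1)) (\<lambda>j. s ((- \<gamma>) ^ j) (A (M - int j) (L + K + 1 + int j)))"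

definition delta2 where
  "delta2 \<gamma> B K L M = bsum (of_int (- K - 1)) (\<lambda>j. s ((- \<gamma>) powi (- K - 1 - int j)) (B (M + K + 1 + int j) (L - int j)))"

definition delta3 where
  "delta3 \<gamma> C K L M = bsum (of_int (- L - 1)) (\<lambda>j. s (\<gamma> powi (- L - 1 - int j)) (C (K - int j) (M + L + 1 + int j)))"

lemma series_mult_delta_fst:
  "series_mult s (delta_fst \<gamma>) (in_x1_x2 A) (K, L, M) = delta1 \<gamma> (\<lambda>q p. A (p, q)) K L M"
proof -
  let ?h = "\<lambda>j::nat. (K, - K - 1 - int j, int j)"
  have "series_mult s (delta_fst \<gamma>) (in_x1_x2 A) (K, L, M)
      = (\<Sum>j. s (delta_fst \<gamma> (?h j)) (in_x1_x2 A ((K, L, M) - ?h j)))"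
    unfolding series_mult_def
  proof (rule Sum_any_reindex_inj)
    fix x :: "int \<times> int \<times> int"
    assume nz: "s (delta_fst \<gamma> x) (in_x1_x2 A ((K, L, M) - x)) \<noteq> 0"
    obtain k l m where x: "x = (k, l, m)" by (cases x) auto
    from nz x have "k = K" "m \<ge> 0" "l + m = - k - 1"
      by (auto simp: delta_fst_def binom_series_def in_x1_x2_def split: if_splits)
    then show "x \<in> range ?h" using x by (intro image_eqI[of _ _ "nat m"]) auto
  qed (auto simp: inj_def)
  also have "\<dots> = delta1 \<gamma> (\<lambda>q p. A (p, q)) K L M"
    unfolding delta1_def bsum_def
    by (rule Sum_any.cong) (simp add: delta_fst_def binom_series_def in_x1_x2_def algebra_simps)
  finally show ?thesis .
qed

lemma series_mult_delta_snd:
  "series_mult s (delta_snd \<gamma>) (in_x1_x2 A) (K, L, M) = delta2 \<gamma> (\<lambda>q p. A (p, q)) K L M"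
proof -
  let ?h = "\<lambda>j::nat. (K, int j, - K - 1 - int j)"
  have "series_mult s (delta_snd \<gamma>) (in_x1_x2 A) (K, L, M)
      = (\<Sum>j. s (delta_snd \<gamma> (?h j)) (in_x1_x2 A ((K, L, M) - ?h j)))"
    unfolding series_mult_def
  proof (rule Sum_any_reindex_inj)
    fix x :: "int \<times> int \<times> int"
    assume nz: "s (delta_snd \<gamma> x) (in_x1_x2 A ((K, L, M) - x)) \<noteq> 0"
    obtain k l m where x: "x = (k, l, m)" by (cases x) auto
    from nz x have "k = K" "l \<ge> 0" "m + l = - k - 1"
      by (auto simp: delta_snd_def binom_series_def in_x1_x2_def split: if_splits)
    then show "x \<in> range ?h" using x by (intro image_eqI[of _ _ "nat l"]) auto
  qed (auto simp: inj_def)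
  also have "\<dots> = delta2 \<gamma> (\<lambda>q p. A (p, q)) K L M"
    unfolding delta2_def bsum_def
    by (rule Sum_any.cong) (simp add: delta_snd_def binom_series_def in_x1_x2_def algebra_simps)
  finally show ?thesis .
qed

lemma series_mult_delta_trd:
  "series_mult s (delta_trd \<gamma>) (in_x0_x2 C) (K, L, M) = delta3 \<gamma> (\<lambda>i m. C (i, m)) K L M"
proof -
  let ?h = "\<lambda>j::nat. (int j, L, - L - 1 - int j)"
  have "series_mult s (delta_trd \<gamma>) (in_x0_x2 C) (K, L, M)
      = (\<Sum>j. s (delta_trd \<gamma> (?h j)) (in_x0_x2 C ((K, L, M) - ?h j)))"
    unfolding series_mult_def
  proof (rule Sum_any_reindex_inj)
    fix x :: "int \<times> int \<times> int"
    assume nz: "s (delta_trd \<gamma> x) (in_x0_x2 C ((K, L, M) - x)) \<noteq> 0"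
    obtain k l m where x: "x = (k, l, m)" by (cases x) auto
    from nz x have "l = L" "k \<ge> 0" "m + k = - l - 1"
      by (auto simp: delta_trd_def binom_series_def in_x0_x2_def split: if_splits)
    then show "x \<in> range ?h" using x by (intro image_eqI[of _ _ "nat k"]) auto
  qed (auto simp: inj_def)
  also have "\<dots> = delta3 \<gamma> (\<lambda>i m. C (i, m)) K L M"
    unfolding delta3_def bsum_def
    by (rule Sum_any.cong) (simp add: delta_trd_def binom_series_def in_x0_x2_def algebra_simps)
  finally show ?thesis .
qed

text \<open>\<open>\<delta>\<close>-function identity
  \<open>x\<^sub>0\<^sup>-\<^sup>1 \<delta>((x\<^sub>1 - \<gamma> x\<^sub>2) / x\<^sub>0) - x\<^sub>0\<^sup>-\<^sup>1 \<delta>((-\<gamma> x\<^sub>2 + x\<^sub>1) / x\<^sub>0) = x\<^sub>1\<^sup>-\<^sup>1 \<delta>((\<gamma> x\<^sub>2 + x\<^sub>0) / x\<^sub>1)\<close>,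
  applied to a series in \<open>U((x\<^sub>1, x\<^sub>2))\<close>\<close>

lemma delta_identity:
  assumes \<gamma>: "\<gamma> \<noteq> 0" and H: "H \<in> trunc2"
  shows "delta1 \<gamma> H K L M - delta2 \<gamma> H K L M = delta3 \<gamma> (subst s \<gamma> H) K L M"
proof -
  obtain N where N: "\<And>i j. i < N \<or> j < N \<Longrightarrow> H i j = 0" using H unfolding trunc2_def by blast
  \<comment> \<open>Only coefficients of \<open>H\<close> of this total degree enter. Each of the
    three terms becomes a sum over the exponent \<open>p\<close> of x_1, and the coefficients can be
    compared one by one.\<close>
  define n where "n = L + M + K + 1"
  let ?A = "{N..n - N}"
  have fin: "(\<Sum>p. s (c p) (H (n - p) p)) = (\<Sum>p\<in>?A. s (c p) (H (n - p) p))" for c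
  proof (rule Sum_any.expand_superset)
    show "{p. s (c p) (H (n - p) p) \<noteq> 0} \<subseteq> ?A"
    proof
      fix p assume "p \<in> {p. s (c p) (H (n - p) p) \<noteq> 0}"
      then have "H (n - p) p \<noteq> 0" by auto
      then show "p \<in> ?A" using N[of "n - p" p] by (cases "p < N \<or> n - p < N") auto
    qed
  qed auto
  define c1 where "c1 = (\<lambda>p. if p - L - 1 \<ge> K
    then (of_int (- K - 1) gchoose nat (p - L - 1 - K)) * (- \<gamma>) ^ nat (p - L - 1 - K) else 0)"
  define c2 where "c2 = (\<lambda>p. if p - L - 1 \<le> - 1
    then (of_int (- K - 1) gchoose nat (- 1 - (p - L - 1))) * (- \<gamma>) powi (p - L - 1 - K) else 0)"
  have 1: "delta1 \<gamma> H K L M = (\<Sum>p. s (c1 p) (H (n - p) p))"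
  proof -
    let ?h = "\<lambda>j::nat. L + K + 1 + int j"
    have "(\<Sum>p. s (c1 p) (H (n - p) p)) = (\<Sum>j. s (c1 (?h j)) (H (n - ?h j) (?h j)))"
    proof (rule Sum_any_reindex_inj)
      fix p assume "s (c1 p) (H (n - p) p) \<noteq> 0"
      then have "p - L - 1 \<ge> K" by (auto simp: c1_def split: if_splits)
      then show "p \<in> range ?h" by (intro image_eqI[of _ _ "nat (p - L - 1 - K)"]) auto
    qed (auto simp: inj_def)
    also have "\<dots> = delta1 \<gamma> H K L M"
      unfolding delta1_def bsum_def
      by (rule Sum_any.cong) (simp add: c1_def n_def algebra_simps)
    finally show ?thesis ..
  qed
  have 2: "delta2 \<gamma> H K L M = (\<Sum>p. s (c2 p) (H (n - p) p))"
  proof -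
    let ?h = "\<lambda>j::nat. L - int j"
    have "(\<Sum>p. s (c2 p) (H (n - p) p)) = (\<Sum>j. s (c2 (?h j)) (H (n - ?h j) (?h j)))"
    proof (rule Sum_any_reindex_inj)
      fix p assume "s (c2 p) (H (n - p) p) \<noteq> 0"
      then have "p - L - 1 \<le> - 1" by (auto simp: c2_def split: if_splits)
      then show "p \<in> range ?h" by (intro image_eqI[of _ _ "nat (L - p)"]) auto
    qed (auto simp: inj_def)
    also have "\<dots> = delta2 \<gamma> H K L M"
      unfolding delta2_def bsum_def
    proof (rule Sum_any.cong)
      fix j
      have "?h j - L - 1 - K = - K - 1 - int j" "n - ?h j = M + K + 1 + int j"
        "nat (- 1 - (?h j - L - 1)) = j" "?h j - L - 1 \<le> - 1"
        by (simp_all add: n_def)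
      then show "s (c2 (?h j)) (H (n - ?h j) (?h j)) = s (of_int (- K - 1) gchoose j)
          (s ((- \<gamma>) powi (- K - 1 - int j)) (H (M + K + 1 + int j) (L - int j)))"
        by (simp only: c2_def if_True scale_scale)
    qed
    finally show ?thesis ..
  qed
  have 3: "delta3 \<gamma> (subst s \<gamma> H) K L M = (\<Sum>p\<in>?A. s (bcoef \<gamma> (p - L - 1) K) (H (n - p) p))"
  proof (cases "K \<ge> 0")
    case True
    have "delta3 \<gamma> (subst s \<gamma> H) K L M = (\<Sum>j\<in>{..nat K}.
        s (of_int (- L - 1) gchoose j) (s (\<gamma> powi (- L - 1 - int j)) (subst s \<gamma> H (K - int j) (M + L + 1 + int j))))"
      unfolding delta3_def by (rule bsum_eq) (use True in \<open>auto simp: subst_neg\<close>)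
    also have "\<dots> = (\<Sum>j\<in>{..nat K}. \<Sum>p\<in>?A.
        s ((of_int (- L - 1) gchoose j) * \<gamma> powi (- L - 1 - int j) * bcoef \<gamma> p (K - int j)) (H (n - p) p))"
    proof (rule sum.cong[OF refl])
      fix j
      have n: "M + L + 1 + int j + (K - int j) = n" by (simp add: n_def)
      have "subst s \<gamma> H (K - int j) (M + L + 1 + int j) = (\<Sum>p\<in>?A. s (bcoef \<gamma> p (K - int j)) (H (n - p) p))"
        using subst_eq[of N H ?A "M + L + 1 + int j" "K - int j" \<gamma>] N by (simp add: n)
      then show "s (of_int (- L - 1) gchoose j) (s (\<gamma> powi (- L - 1 - int j)) (subst s \<gamma> H (K - int j) (M + L + 1 + int j)))
        = (\<Sum>p\<in>?A. s ((of_int (- L - 1) gchoose j) * \<gamma> powi (- L - 1 - int j) * bcoef \<gamma> p (K - int j)) (H (n - p) p))"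
        by (simp add: scale_sum_right mult.assoc)
    qed
    also have "\<dots> = (\<Sum>p\<in>?A. s (bcoef \<gamma> (p - L - 1) K) (H (n - p) p))"
    proof (subst sum.swap, rule sum.cong[OF refl])
      fix p
      have "- L - 1 + p = p - L - 1" by simp
      then show "(\<Sum>j\<in>{..nat K}. s ((of_int (- L - 1) gchoose j) * \<gamma> powi (- L - 1 - int j) * bcoef \<gamma> p (K - int j)) (H (n - p) p))
          = s (bcoef \<gamma> (p - L - 1) K) (H (n - p) p)"
        by (simp only: bcoef_Vandermonde[OF \<gamma> True] flip: scale_sum_left)
    qed
    finally show ?thesis .
  next
    case False
    then show ?thesis by (simp add: delta3_def bsum_def subst_neg bcoef_neg)
  qed
  have "c1 p - c2 p = bcoef \<gamma> (p - L - 1) K" for p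
    unfolding c1_def c2_def by (rule delta_coeff_identity[OF \<gamma>])
  then show ?thesis
    unfolding 1 2 3 fin by (simp flip: sum_subtractf scale_left_diff_distrib)
qed

text \<open>Next to the delta function x_1 - \<gamma> x_2 equals x_0; the factor here is -1/\<gamma>
  times that, the normal form produced by \<open>poly2_factor\<close>. The bound on the outer index
  makes the binomial sum finite; in \<open>delta2_shift\<close> the inner index takes this
  role.\<close>

lemma delta1_shift:
  assumes "\<gamma> \<noteq> 0" "\<And>i. i < N \<Longrightarrow> A i = 0"
  shows "delta1 \<gamma> (act2 s [:[:0, - (1 / \<gamma>):], 1:] A) K L M = s (- (1 / \<gamma>)) (delta1 \<gamma> A (K - 1) L M)"
proof -
  let ?n = "of_int (- K - 1) :: complex"
  define X where "X = (\<lambda>j. s ((- \<gamma>) ^ j) (A (M - int j) (L + K + int j)))"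
  have X: "X j = 0" if "j \<ge> nat (M - N) + 1" for j
    using assms(2)[of "M - int j"] that by (simp add: X_def)
  have eq: "(of_int (- (K - 1) - 1) :: complex) = ?n + 1" by simp
  have "delta1 \<gamma> A (K - 1) L M = bsum (?n + 1) X"
    unfolding delta1_def eq by (rule bsum_cong) (simp add: X_def algebra_simps)
  then have "s (- (1 / \<gamma>)) (delta1 \<gamma> A (K - 1) L M) = bsum ?n (\<lambda>j. s (- (1 / \<gamma>)) (X j + X (Suc j)))"
    by (simp only:) (rule scale_bsum_pascal[where J = "nat (M - N) + 1"], rule X)
  also have "\<dots> = delta1 \<gamma> (act2 s [:[:0, - (1 / \<gamma>):], 1:] A) K L M"
    unfolding delta1_def
    by (rule bsum_cong) (use assms(1) in \<open>simp add: X_def act_simps scale_right_distrib algebra_simps\<close>)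
  finally show ?thesis ..
qed

lemma delta2_shift:
  assumes "\<gamma> \<noteq> 0" "\<And>i j. j < N \<Longrightarrow> B i j = 0"
  shows "delta2 \<gamma> (act2 s [:[:0, - (1 / \<gamma>):], 1:] B) K L M = s (- (1 / \<gamma>)) (delta2 \<gamma> B (K - 1) L M)"
proof -
  let ?n = "of_int (- K - 1) :: complex"
  define X where "X = (\<lambda>j. s ((- \<gamma>) powi (- K - int j)) (B (M + K + int j) (L - int j)))"
  have X: "X j = 0" if "j \<ge> nat (L - N) + 1" for j
    using assms(2)[of "L - int j"] that by (simp add: X_def)
  have eq: "(of_int (- (K - 1) - 1) :: complex) = ?n + 1" by simp
  have "delta2 \<gamma> B (K - 1) L M = bsum (?n + 1) X"
    unfolding delta2_def eq by (rule bsum_cong) (simp add: X_def algebra_simps)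
  then have "s (- (1 / \<gamma>)) (delta2 \<gamma> B (K - 1) L M) = bsum ?n (\<lambda>j. s (- (1 / \<gamma>)) (X j + X (Suc j)))"
    by (simp only:) (rule scale_bsum_pascal[where J = "nat (L - N) + 1"], rule X)
  also have "\<dots> = delta2 \<gamma> (act2 s [:[:0, - (1 / \<gamma>):], 1:] B) K L M"
    unfolding delta2_def
  proof (rule bsum_cong)
    fix j
    have "(- \<gamma>) powi (- K - int j) = (- \<gamma>) * (- \<gamma>) powi (- K - 1 - int j)"
      using assms(1) power_int_add_1'[of "- \<gamma>" "- K - 1 - int j"] by (simp add: algebra_simps)
    then have 1: "X j = s (- \<gamma>) (s ((- \<gamma>) powi (- K - 1 - int j)) (B (M + K + int j) (L - int j)))"
      by (simp add: X_def)
    have 2: "X (Suc j) = s ((- \<gamma>) powi (- K - 1 - int j)) (B (M + K + 1 + int j) (L - int j - 1))"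
      by (simp add: X_def algebra_simps)
    show "s (- (1 / \<gamma>)) (X j + X (Suc j))
        = s ((- \<gamma>) powi (- K - 1 - int j)) (act2 s [:[:0, - (1 / \<gamma>):], 1:] B (M + K + 1 + int j) (L - int j))"
      unfolding 1 2 using assms(1) by (simp add: act_simps scale_right_distrib algebra_simps)
  qed
  finally show ?thesis ..
qed

text \<open>Next to the third delta function \<gamma> x_2 + x_0 equals x_1.\<close>

lemma delta3_shift:
  assumes "\<gamma> \<noteq> 0" "\<And>i. i < N \<Longrightarrow> C i = 0"
  shows "delta3 \<gamma> (act2 s [:[:0, \<gamma>:], 1:] C) K L M = delta3 \<gamma> C K (L - 1) M"
proof -
  let ?n = "of_int (- L - 1) :: complex"
  define X where "X = (\<lambda>j. s (\<gamma> powi (- L - int j)) (C (K - int j) (M + L + int j)))"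
  have X: "X j = 0" if "j \<ge> nat (K - N) + 1" for j
    using assms(2)[of "K - int j"] that by (simp add: X_def)
  have eq: "(of_int (- (L - 1) - 1) :: complex) = ?n + 1" by simp
  have "delta3 \<gamma> C K (L - 1) M = bsum (?n + 1) X"
    unfolding delta3_def eq by (rule bsum_cong) (simp add: X_def algebra_simps)
  also have "\<dots> = bsum ?n (\<lambda>j. X j + X (Suc j))"
    using scale_bsum_pascal[where J = "nat (K - N) + 1" and X = X and c = 1 and n = ?n] X by simp
  also have "\<dots> = delta3 \<gamma> (act2 s [:[:0, \<gamma>:], 1:] C) K L M"
    unfolding delta3_def
  proof (rule bsum_cong)
    fix j
    have "\<gamma> powi (- L - int j) = \<gamma> * \<gamma> powi (- L - 1 - int j)"
      using assms(1) power_int_add_1'[of "\<gamma>" "- L - 1 - int j"] by (simp add: algebra_simps)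
    then have 1: "X j = s \<gamma> (s (\<gamma> powi (- L - 1 - int j)) (C (K - int j) (M + L + int j)))"
      by (simp add: X_def)
    have 2: "X (Suc j) = s (\<gamma> powi (- L - 1 - int j)) (C (K - int j - 1) (M + L + 1 + int j))"
      by (simp add: X_def algebra_simps)
    show "X j + X (Suc j)
        = s (\<gamma> powi (- L - 1 - int j)) (act2 s [:[:0, \<gamma>:], 1:] C (K - int j) (M + L + 1 + int j))"
      unfolding 1 2 by (simp add: act_simps scale_right_distrib algebra_simps)
  qed
  finally show ?thesis ..
qed

lemma delta1_power:
  assumes "\<gamma> \<noteq> 0" "\<And>i. i < N \<Longrightarrow> A i = 0"
  shows "delta1 \<gamma> (act2 s ([:[:0, - (1 / \<gamma>):], 1:] ^ k) A) K L M = s ((- (1 / \<gamma>)) ^ k) (delta1 \<gamma> A (K - int k) L M)"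
proof (induction k arbitrary: K)
  case (Suc k)
  have eq: "act2 s ([:[:0, - (1 / \<gamma>):], 1:] ^ Suc k) A
      = act2 s [:[:0, - (1 / \<gamma>):], 1:] (act2 s ([:[:0, - (1 / \<gamma>):], 1:] ^ k) A)" by simp
  show ?case
    unfolding eq
    by (subst delta1_shift[OF assms(1), of N]) (simp_all add: act2_low[OF assms(2)] Suc algebra_simps)
qed simp

lemma delta2_power:
  assumes "\<gamma> \<noteq> 0" "\<And>i j. j < N \<Longrightarrow> B i j = 0"
  shows "delta2 \<gamma> (act2 s ([:[:0, - (1 / \<gamma>):], 1:] ^ k) B) K L M = s ((- (1 / \<gamma>)) ^ k) (delta2 \<gamma> B (K - int k) L M)"
proof (induction k arbitrary: K)
  case (Suc k)
  have eq: "act2 s ([:[:0, - (1 / \<gamma>):], 1:] ^ Suc k) B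
      = act2 s [:[:0, - (1 / \<gamma>):], 1:] (act2 s ([:[:0, - (1 / \<gamma>):], 1:] ^ k) B)" by simp
  show ?case
    unfolding eq
    by (subst delta2_shift[OF assms(1), of N]) (simp_all add: act2_low_inner[OF assms(2)] Suc algebra_simps)
qed simp

lemma delta3_scale:
  assumes "\<And>i. i < N \<Longrightarrow> C i = 0"
  shows "delta3 \<gamma> (\<lambda>i j. s d (C i j)) K L M = s d (delta3 \<gamma> C K L M)"
proof -
  let ?X = "\<lambda>j. s (\<gamma> powi (- L - 1 - int j)) (C (K - int j) (M + L + 1 + int j))"
  have "bsum (of_int (- L - 1)) (\<lambda>j. s d (?X j)) = s d (bsum (of_int (- L - 1)) ?X)"
  proof (rule bsum_scale)
    fix j assume "j \<ge> nat (K - N) + 1"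
    then show "?X j = 0" using assms[of "K - int j"] by simp
  qed
  then show ?thesis unfolding delta3_def by (simp add: mult.commute)
qed

lemma delta3_add:
  assumes "\<And>i. i < N \<Longrightarrow> C i = 0" "\<And>i. i < N \<Longrightarrow> D i = 0"
  shows "delta3 \<gamma> (C + D) K L M = delta3 \<gamma> C K L M + delta3 \<gamma> D K L M"
  unfolding delta3_def
proof (subst bsum_add[symmetric, where J = "nat (K - N) + 1"])
  fix j assume j: "j \<ge> nat (K - N) + 1"
  show "s (\<gamma> powi (- L - 1 - int j)) (C (K - int j) (M + L + 1 + int j)) = 0"
    "s (\<gamma> powi (- L - 1 - int j)) (D (K - int j) (M + L + 1 + int j)) = 0"
    using assms[of "K - int j"] j by simp_all
qed (simp add: scale_right_distrib)

text \<open>Multiplication by \<open>(x\<^sub>1 - \<gamma> x\<^sub>2)\<^sup>k\<close>, which acts as \<open>x\<^sub>0\<^sup>k\<close> on all three terms, reduces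
  the Jacobi identity to the identity of \<open>\<delta>\<close>-functions.\<close>

lemma jacobi_identityI:
  assumes \<gamma>: "\<gamma> \<noteq> 0" and A: "\<And>i. i < N \<Longrightarrow> A i = 0" and B: "\<And>i j. j < N \<Longrightarrow> B i j = 0"
    and C: "\<And>i. i < N \<Longrightarrow> C i = 0"
    and comm: "act2 s ([:[:0, - (1 / \<gamma>):], 1:] ^ k) A = act2 s ([:[:0, - (1 / \<gamma>):], 1:] ^ k) B"
    and trunc: "act2 s ([:[:0, - (1 / \<gamma>):], 1:] ^ k) A \<in> trunc2"
    and assoc: "subst s \<gamma> (act2 s ([:[:0, - (1 / \<gamma>):], 1:] ^ k) A) = (\<lambda>i j. s ((- (1 / \<gamma>)) ^ k) (C (i - int k) j))"
  shows "delta1 \<gamma> A K L M - delta2 \<gamma> B K L M = delta3 \<gamma> C K L M"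
proof -
  let ?d = "(- (1 / \<gamma>)) ^ k"
  let ?K = "K + int k"
  have C': "C (i - int k) = 0" if "i < N" for i using C[of "i - int k"] that by simp
  let ?H = "act2 s ([:[:0, - (1 / \<gamma>):], 1:] ^ k) A"
  have "delta1 \<gamma> ?H ?K L M = s ?d (delta1 \<gamma> A K L M)"
    using delta1_power[of \<gamma> N A k ?K L M] \<gamma> A by simp
  moreover have "delta2 \<gamma> ?H ?K L M = s ?d (delta2 \<gamma> B K L M)"
    unfolding comm using delta2_power[of \<gamma> N B k ?K L M] \<gamma> B by simp
  ultimately have "s ?d (delta1 \<gamma> A K L M - delta2 \<gamma> B K L M) = delta1 \<gamma> ?H ?K L M - delta2 \<gamma> ?H ?K L M"
    by (simp only: scale_right_diff_distrib)
  also have "\<dots> = delta3 \<gamma> (\<lambda>i j. s ?d (C (i - int k) j)) ?K L M"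
    using delta_identity[OF \<gamma> trunc] by (simp only: assoc)
  also have "\<dots> = s ?d (delta3 \<gamma> (\<lambda>i. C (i - int k)) ?K L M)"
    by (rule delta3_scale) (rule C')
  also have "delta3 \<gamma> (\<lambda>i. C (i - int k)) ?K L M = delta3 \<gamma> C K L M"
    unfolding delta3_def by (rule bsum_cong) simp
  finally have "s ?d (delta1 \<gamma> A K L M - delta2 \<gamma> B K L M - delta3 \<gamma> C K L M) = 0"
    by (simp add: scale_right_diff_distrib)
  then show ?thesis using \<gamma> by (simp add: scalar_zero_iff[OF module_axioms])
qed

text \<open>The third term of the quasi module identity carries a factor f(x_1, x_2). The delta
  function allows x_1 to be replaced by \<gamma> x_2 + x_0, which turns \<open>f\<close> into
  \<open>poly_subst \<gamma> f\<close> acting on \<open>C\<close> alone.\<close>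

lemma act3_delta3:
  assumes \<gamma>: "\<gamma> \<noteq> 0" and C: "\<forall>i<N. C i = 0"
  shows "act3 s (poly2 cst3 (lin3 0 0 1) (lin3 0 1 0) f) (\<lambda>K M L. delta3 \<gamma> C K L M)
    = (\<lambda>K M L. delta3 \<gamma> (act2 s (poly_subst \<gamma> f) C) K L M)"
proof -
  let ?R = "\<lambda>x y. (\<forall>i<N. x i = 0) \<and> y = (\<lambda>K M L. delta3 \<gamma> x K L M)"
  have low: "\<forall>i<N. act2 s p x i = 0" if "\<forall>i<N. x i = 0" for p x
    using act2_low[of N x] that by blast
  have "?R (act2 s (poly_subst \<gamma> f) C) (act3 s (poly2 cst3 (lin3 0 0 1) (lin3 0 1 0) f) (\<lambda>K M L. delta3 \<gamma> C K L M))"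
    unfolding poly_subst_def
  proof (rule semilinear23[where R = ?R], goal_cases)
    case (3 x y x' y')
    then show ?case using delta3_add[of N x y] by (auto simp: fun_eq_iff)
  next
    case (4 a x x')
    have "act2 s (cst2 a) x = (\<lambda>i j. s a (x i j))" by (simp add: act_simps)
    then show ?case using low[of x "cst2 a"] 4 delta3_scale[of N x] by (simp add: act3_cst3)
  next
    case (5 x x')
    then show ?case using low[of x "[:[:0, \<gamma>:], 1:]"] delta3_shift[OF \<gamma>, of N x] by (simp add: act3_lin3)
  next
    case (6 x x')
    have "act2 s [:[:0, 1:]:] x = (\<lambda>i j. x i (j - 1))" by (simp add: act_simps)
    then show ?case
      using low[of x "[:[:0, 1:]:]"] 6 by (simp add: act3_lin3 delta3_def algebra_simps)
  qed (use C in auto)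
  then show ?thesis by simp
qed

text \<open>The product of f(x_1, x_2) with a series in x_0 and x_2 involves all three variables,
  here ordered x_0, x_2, x_1. The product with the delta function exists because the powers of x_1
  are bounded on both sides and those of x_0 from below.\<close>

definition delta_trd_mult where
  "delta_trd_mult \<gamma> E = (\<lambda>K M L. series_mult s (delta_trd \<gamma>) (\<lambda>(k, l, m). E k m l) (K, L, M))"

lemma delta_trd_mult_finite:
  assumes E: "\<forall>i<N. E i = 0" "\<forall>i m l. \<bar>l\<bar> > B \<longrightarrow> E i m l = 0"
  shows "finite {k. s (delta_trd \<gamma> k) ((\<lambda>(k, l, m). E k m l) ((K, L, M) - k)) \<noteq> 0}"
proof (rule finite_subset)
  show "{k. s (delta_trd \<gamma> k) ((\<lambda>(k, l, m). E k m l) ((K, L, M) - k)) \<noteq> 0}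
      \<subseteq> (\<lambda>(k, l). (k, l, - l - 1 - k)) ` ({0..K - N} \<times> {L - B..L + B})"
  proof
    fix x assume x: "x \<in> {k. s (delta_trd \<gamma> k) ((\<lambda>(k, l, m). E k m l) ((K, L, M) - k)) \<noteq> 0}"
    obtain k l m where klm: "x = (k, l, m)" by (cases x) auto
    then have nz: "delta_trd \<gamma> (k, l, m) \<noteq> 0" "E (K - k) (M - m) (L - l) \<noteq> 0" using x by auto
    then have "k \<ge> 0" "m = - l - 1 - k" by (auto simp: delta_trd_def binom_series_def split: if_splits)
    moreover have "\<not> K - k < N" "\<not> \<bar>L - l\<bar> > B" using nz(2) E by (auto simp: fun_eq_iff)
    ultimately show "x \<in> (\<lambda>(k, l). (k, l, - l - 1 - k)) ` ({0..K - N} \<times> {L - B..L + B})"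
      using klm by (intro image_eqI[of _ _ "(k, l)"]) auto
  qed
qed auto

lemma act3_delta_trd_mult:
  assumes E: "\<forall>i<N. E i = 0" "\<forall>i m l. \<bar>l\<bar> > B \<longrightarrow> E i m l = 0"
  shows "act3 s (poly2 cst3 (lin3 0 0 1) (lin3 0 1 0) f) (delta_trd_mult \<gamma> E)
    = delta_trd_mult \<gamma> (act3 s (poly2 cst3 (lin3 0 0 1) (lin3 0 1 0) f) E)"
proof -
  let ?fin = "\<lambda>E B. (\<forall>i<N. E i = 0) \<and> (\<forall>i m l. \<bar>l\<bar> > B \<longrightarrow> E i m l = 0)"
  let ?R = "\<lambda>x y. (\<exists>B. ?fin x B) \<and> y = delta_trd_mult \<gamma> x"
  have "?R (act3 s (poly2 cst3 (lin3 0 0 1) (lin3 0 1 0) f) E)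
    (act3 s (poly2 cst3 (lin3 0 0 1) (lin3 0 1 0) f) (delta_trd_mult \<gamma> E))"
  proof (rule semilinear3[where R = ?R], goal_cases)
    case (3 x y x' y')
    then obtain B B' where B: "?fin x B" "?fin y B'" by blast
    then have B': "?fin x (max B B')" "?fin y (max B B')" by auto
    then have "\<exists>B. ?fin (x + y) B" by (intro exI[of _ "max B B'"]) auto
    moreover have "delta_trd_mult \<gamma> (x + y) = delta_trd_mult \<gamma> x + delta_trd_mult \<gamma> y"
    proof (intro ext)
      fix K M L
      have "s (delta_trd \<gamma> k) ((\<lambda>(k, l, m). (x + y) k m l) ((K, L, M) - k))
          = s (delta_trd \<gamma> k) ((\<lambda>(k, l, m). x k m l) ((K, L, M) - k))
            + s (delta_trd \<gamma> k) ((\<lambda>(k, l, m). y k m l) ((K, L, M) - k))" for k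
        by (cases k) (simp add: scale_right_distrib)
      then show "delta_trd_mult \<gamma> (x + y) K M L = (delta_trd_mult \<gamma> x + delta_trd_mult \<gamma> y) K M L"
        using Sum_any.distrib[OF delta_trd_mult_finite[of N x, OF conjunct1[OF B(1)] conjunct2[OF B(1)]]
            delta_trd_mult_finite[of N y, OF conjunct1[OF B(2)] conjunct2[OF B(2)]], of \<gamma> K L M \<gamma> K L M]
        by (simp add: delta_trd_mult_def series_mult_def)
    qed
    ultimately show ?case using 3 by simp
  next
    case (4 a x x')
    then obtain B where B: "?fin x B" by blast
    have F: "?fin (\<lambda>i j k. s a (x i j k)) B" using B by (auto simp: fun_eq_iff)
    have D: "delta_trd_mult \<gamma> (\<lambda>i j k. s a (x i j k)) K M L = s a (delta_trd_mult \<gamma> x K M L)" for K M L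
    proof -
      let ?f = "\<lambda>k. s (delta_trd \<gamma> k) ((\<lambda>(k, l, m). x k m l) ((K, L, M) - k))"
      have f: "finite {k. ?f k \<noteq> 0}"
        by (rule delta_trd_mult_finite) (use B in auto)
      have "s (delta_trd \<gamma> k) ((\<lambda>(k, l, m). s a (x k m l)) ((K, L, M) - k)) = s a (?f k)" for k
        by (cases k) (simp add: mult.commute)
      then have "delta_trd_mult \<gamma> (\<lambda>i j k. s a (x i j k)) K M L = (\<Sum>k. s a (?f k))"
        by (simp add: delta_trd_mult_def series_mult_def)
      also have "\<dots> = (\<Sum>k\<in>{k. ?f k \<noteq> 0}. s a (?f k))"
        by (rule Sum_any.expand_superset[OF f]) (auto simp del: scale_scale)
      also have "\<dots> = s a (delta_trd_mult \<gamma> x K M L)"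
        by (simp add: delta_trd_mult_def series_mult_def Sum_any.expand_set scale_sum_right)
      finally show ?thesis .
    qed
    show ?case
      unfolding act3_cst3
    proof (intro conjI)
      show "\<exists>B. ?fin (\<lambda>i j k. s a (x i j k)) B" using F by blast
      have "x' = delta_trd_mult \<gamma> x" using 4 by blast
      then show "(\<lambda>i j k. s a (x' i j k)) = delta_trd_mult \<gamma> (\<lambda>i j k. s a (x i j k))"
        by (intro ext) (simp only: D)
    qed
  next
    case (5 x x')
    then obtain B where B: "?fin x B" by blast
    have eq: "act3 s (lin3 0 0 1) x = (\<lambda>i j k. x i j (k - 1))" for x by (simp add: act3_lin3)
    have "?fin (\<lambda>i j k. x i j (k - 1)) (\<bar>B\<bar> + 1)" using B by (auto simp: fun_eq_iff)
    then have F: "\<exists>B. ?fin (\<lambda>i j k. x i j (k - 1)) B" by blast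
    have D: "delta_trd_mult \<gamma> (\<lambda>i j k. x i j (k - 1)) = (\<lambda>K M L. delta_trd_mult \<gamma> x K M (L - 1))"
      by (simp add: delta_trd_mult_def series_mult_def fun_eq_iff split_beta algebra_simps)
    have "x' = delta_trd_mult \<gamma> x" using 5 by blast
    then have "(\<lambda>i j k. x' i j (k - 1)) = delta_trd_mult \<gamma> (\<lambda>i j k. x i j (k - 1))" unfolding D by simp
    with F show ?case unfolding eq by (rule conjI)
  next
    case (6 x x')
    then obtain B where B: "?fin x B" by blast
    have eq: "act3 s (lin3 0 1 0) x = (\<lambda>i j k. x i (j - 1) k)" for x by (simp add: act3_lin3)
    have "?fin (\<lambda>i j k. x i (j - 1) k) B" using B by (auto simp: fun_eq_iff)
    then have F: "\<exists>B. ?fin (\<lambda>i j k. x i (j - 1) k) B" by blast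
    have D: "delta_trd_mult \<gamma> (\<lambda>i j k. x i (j - 1) k) = (\<lambda>K M L. delta_trd_mult \<gamma> x K (M - 1) L)"
      by (simp add: delta_trd_mult_def series_mult_def fun_eq_iff split_beta algebra_simps)
    have "x' = delta_trd_mult \<gamma> x" using 6 by blast
    then have "(\<lambda>i j k. x' i (j - 1) k) = delta_trd_mult \<gamma> (\<lambda>i j k. x i (j - 1) k)" unfolding D by simp
    with F show ?case unfolding eq by (rule conjI)
  qed (use E in auto)
  then show ?thesis by simp
qed

lemma series_mult_in_x1_x2_poly_series:
  "series_mult s (in_x1_x2 (poly_series f)) D (k, l, m) = act2 s f (\<lambda>m l. D (k, l, m)) m l"
proof -
  let ?h = "\<lambda>(p, q). (0 :: int, p :: int, q :: int)"
  have "series_mult s (in_x1_x2 (poly_series f)) D (k, l, m)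
      = (\<Sum>pq. s (in_x1_x2 (poly_series f) (?h pq)) (D ((k, l, m) - ?h pq)))"
    unfolding series_mult_def
  proof (rule Sum_any_reindex_inj)
    fix x :: "int \<times> int \<times> int" assume "s (in_x1_x2 (poly_series f) x) (D ((k, l, m) - x)) \<noteq> 0"
    then show "x \<in> range ?h" by (cases x) (auto simp: in_x1_x2_def split: if_splits intro: image_eqI[of _ _ "(a, b)" for a b])
  qed (auto simp: inj_def)
  also have "\<dots> = series_mult s (poly_series f) (\<lambda>(l, m). D (k, l, m)) (l, m)"
    unfolding series_mult_def by (rule Sum_any.cong) (auto simp: in_x1_x2_def)
  finally show ?thesis by (simp add: series_mult_poly_series)
qed

lemma series_mult_poly_in_x1_x2:
  "series_mult s (in_x1_x2 (poly_series f)) (in_x1_x2 A) = in_x1_x2 (\<lambda>(l, m). act2 s f (\<lambda>q p. A (p, q)) m l)"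
proof (rule ext, clarify)
  fix k l m :: int
  have "(\<lambda>m l. in_x1_x2 A (k, l, m)) = (if k = 0 then (\<lambda>q p. A (p, q)) else 0)"
    by (auto simp: in_x1_x2_def fun_eq_iff)
  then have "series_mult s (in_x1_x2 (poly_series f)) (in_x1_x2 A) (k, l, m)
      = act2 s f (if k = 0 then (\<lambda>q p. A (p, q)) else 0) m l"
    by (simp only: series_mult_in_x1_x2_poly_series)
  then show "series_mult s (in_x1_x2 (poly_series f)) (in_x1_x2 A) (k, l, m)
      = in_x1_x2 (\<lambda>(l, m). act2 s f (\<lambda>q p. A (p, q)) m l) (k, l, m)"
    by (cases "k = 0") (simp_all add: in_x1_x2_def)
qed

lemma series_mult_delta_trd_poly:
  assumes \<gamma>: "\<gamma> \<noteq> 0" and C: "\<forall>i<N. (\<lambda>m. C (i, m)) = 0"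
  shows "series_mult s (delta_trd \<gamma>) (series_mult s (in_x1_x2 (poly_series f)) (in_x0_x2 C)) (K, L, M)
    = delta3 \<gamma> (act2 s (poly_subst \<gamma> f) (\<lambda>i m. C (i, m))) K L M"
proof -
  let ?p = "poly2 cst3 (lin3 0 0 1) (lin3 0 1 0) f"
  let ?E = "\<lambda>k m l. in_x0_x2 C (k, l, m)"
  have E: "\<forall>i<N. ?E i = 0" "\<forall>i m l. \<bar>l\<bar> > 0 \<longrightarrow> ?E i m l = 0"
    using C by (auto simp: in_x0_x2_def fun_eq_iff)
  have 1: "series_mult s (in_x1_x2 (poly_series f)) (in_x0_x2 C) = (\<lambda>(k, l, m). act3 s ?p ?E k m l)"
    by (auto simp: fun_eq_iff series_mult_in_x1_x2_poly_series act3_bystander_first)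
  have "delta_trd_mult \<gamma> ?E = (\<lambda>K M L. delta3 \<gamma> (\<lambda>i m. C (i, m)) K L M)"
    using series_mult_delta_trd[of \<gamma> C] by (simp add: delta_trd_mult_def fun_eq_iff split_beta')
  moreover have "\<forall>i<N. (\<lambda>i m. C (i, m)) i = 0" using C by simp
  ultimately have "delta_trd_mult \<gamma> (act3 s ?p ?E) = (\<lambda>K M L. delta3 \<gamma> (act2 s (poly_subst \<gamma> f) (\<lambda>i m. C (i, m))) K L M)"
    using act3_delta_trd_mult[OF E, of f \<gamma>] act3_delta3[OF \<gamma>, of N "\<lambda>i m. C (i, m)" f] by simp
  then show ?thesis
    unfolding 1 by (simp add: delta_trd_mult_def fun_eq_iff)
qed

end

section \<open>The vertex algebra structure\<close>

lemma subgroup_Cx_closed: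
  assumes \<Gamma>: "subgroup \<Gamma> Cx" and "\<alpha> \<in> \<Gamma>" "\<beta> \<in> \<Gamma>"
  shows "\<alpha> \<noteq> 0" "inverse \<beta> * \<alpha> \<in> \<Gamma>"
proof -
  have G: "group Cx"
    by (rule groupI) (auto simp: Cx_def intro!: bexI[of _ "inverse x" for x])
  have nz: "x \<noteq> 0" if "x \<in> \<Gamma>" for x
    using subgroup.mem_carrier[OF \<Gamma> that] by (simp add: Cx_def)
  then show "\<alpha> \<noteq> 0" using assms by blast
  have "inv\<^bsub>Cx\<^esub> \<beta> = inverse \<beta>"
    using nz[OF assms(3)] by (intro group.inv_equality[OF G]) (auto simp: Cx_def)
  then have "inverse \<beta> \<in> \<Gamma>" using subgroup.m_inv_closed[OF \<Gamma> assms(3)] by simp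
  from subgroup.m_closed[OF \<Gamma> this assms(2)] show "inverse \<beta> * \<alpha> \<in> \<Gamma>" by (simp add: Cx_def)
qed

context cspace
begin

section \<open>Bilinearity, the vacuum and the Jacobi identities\<close>

lemma module_E_scale: "module (E_scale s)"
  using module_pointwise[OF module_series_scale] by (simp add: E_scale_def[abs_def])

lemma cspace_E_scale: "cspace (E_scale s)"
  by (simp add: cspace_def module_E_scale)

lemma E_scale_apply: "E_scale s d b w m = s d (b w m)"
  by (simp add: E_scale_def series_scale_def)

lemma Y_op_eqI:
  assumes \<alpha>: "\<alpha> \<noteq> 0" and c: "compatible s a b"
    and rel: "\<And>w. subst_rel s \<alpha> (\<lambda>q p. a (b w q) p) (\<lambda>i. Z i w)"
  shows "Y_op s \<alpha> a b i = Z i"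
  using fun_cong[OF subst_rel_unique[OF \<alpha> Y_op_subst_rel[OF \<alpha> c] rel]] by blast

lemma Y_op_add_right:
  assumes \<alpha>: "\<alpha> \<noteq> 0" and a: "a \<in> E_space s"
    and c: "compatible s a b" "compatible s a b'" "compatible s a (b + b')"
  shows "Y_op s \<alpha> a (b + b') i = Y_op s \<alpha> a b i + Y_op s \<alpha> a b' i"
  using subst_rel_add[OF \<alpha> Y_op_subst_rel[OF \<alpha> c(1)] Y_op_subst_rel[OF \<alpha> c(2)]]
  by (intro Y_op_eqI[OF \<alpha> c(3), where Z = "\<lambda>i. Y_op s \<alpha> a b i + Y_op s \<alpha> a b' i"])
    (simp add: E_spaceD[OF a] plus_fun_def)

lemma Y_op_add_left:
  assumes \<alpha>: "\<alpha> \<noteq> 0" and c: "compatible s a b" "compatible s a' b" "compatible s (a + a') b"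
  shows "Y_op s \<alpha> (a + a') b i = Y_op s \<alpha> a b i + Y_op s \<alpha> a' b i"
  using subst_rel_add[OF \<alpha> Y_op_subst_rel[OF \<alpha> c(1)] Y_op_subst_rel[OF \<alpha> c(2)]]
  by (intro Y_op_eqI[OF \<alpha> c(3), where Z = "\<lambda>i. Y_op s \<alpha> a b i + Y_op s \<alpha> a' b i"])
    (simp add: plus_fun_def)

lemma Y_op_scale_right:
  assumes \<alpha>: "\<alpha> \<noteq> 0" and a: "a \<in> E_space s" and c: "compatible s a b" "compatible s a (E_scale s d b)"
  shows "Y_op s \<alpha> a (E_scale s d b) i = E_scale s d (Y_op s \<alpha> a b i)"
  using subst_rel_linear[OF module_axioms _ _ Y_op_subst_rel[OF \<alpha> c(1)], of "s d"]
  by (intro Y_op_eqI[OF \<alpha> c(2), where Z = "\<lambda>i. E_scale s d (Y_op s \<alpha> a b i)"])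
    (simp add: E_spaceD[OF a] E_scale_def series_scale_def scale_right_distrib mult.commute)

lemma Y_op_scale_left:
  assumes \<alpha>: "\<alpha> \<noteq> 0" and c: "compatible s a b" "compatible s (E_scale s d a) b"
  shows "Y_op s \<alpha> (E_scale s d a) b i = E_scale s d (Y_op s \<alpha> a b i)"
  using subst_rel_linear[OF module_axioms _ _ Y_op_subst_rel[OF \<alpha> c(1)], of "s d"]
  by (intro Y_op_eqI[OF \<alpha> c(2), where Z = "\<lambda>i. E_scale s d (Y_op s \<alpha> a b i)"])
    (simp add: E_scale_def series_scale_def scale_right_distrib mult.commute)

lemma const_series_in_E_space: "const_series \<in> E_space s"
  by (rule E_spaceI) (auto simp: const_series_def intro: exI[of _ 0])

lemma const_series_quasi_local:
  assumes "c \<in> E_space s"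
  shows "mutually_quasi_local s const_series c"
proof -
  have "locality_poly s 1 const_series c"
    by (auto simp: locality_poly_def const_series_def fun_eq_iff E_space_zero[OF assms])
  then show ?thesis unfolding mutually_quasi_local_iff by blast
qed

lemma Y_op_const_left:
  assumes \<alpha>: "\<alpha> \<noteq> 0" and b: "b \<in> E_space s"
  shows "Y_op s \<alpha> const_series b = const_series b"
proof -
  have c: "compatible s const_series b"
    by (intro quasi_local_compatible const_series_quasi_local const_series_in_E_space b)
  have "Y_op s \<alpha> const_series b i w m = const_series b i w m" for i w m
  proof -
    let ?g = "\<lambda>q p. const_series (b w q) p"
    obtain N where N: "\<forall>n<N. b w n = 0" using E_spaceD(3)[OF b] by blast
    have "\<forall>i j. i < min N 0 \<or> j < min N 0 \<longrightarrow> ?g i j = 0" using N by (auto simp: const_series_def)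
    then have "?g \<in> trunc2" unfolding trunc2_def by blast
    then have "Y_op s \<alpha> const_series b i w m = subst s \<alpha> ?g i m"
      using subst_rel_eq_subst[OF \<alpha> Y_op_subst_rel[OF \<alpha> c, of w]] by metis
    also have "\<dots> = s (bcoef \<alpha> 0 i) (b w (m + i))"
      unfolding subst_def
      by (subst Sum_any.expand_superset[of "{0}"]) (auto simp: const_series_def split: if_splits)
    also have "\<dots> = const_series b i w m"
      by (cases "i < 0") (auto simp: const_series_def bcoef_def gbinomial_0_left)
    finally show ?thesis .
  qed
  then show ?thesis by (simp add: fun_eq_iff)
qed

text \<open>The product with the identity is a(x_1) itself, which is already truncated, so the value
  is a(\<alpha> x + x_0). It has no negative powers of x_0, and for \<alpha> = 1 the term at x_0^0
  is \<open>a\<close>: these are the creation axioms.\<close>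

lemma Y_op_const_right:
  assumes \<alpha>: "\<alpha> \<noteq> 0" and a: "a \<in> E_space s"
  shows "Y_op s \<alpha> a const_series i w m = s (bcoef \<alpha> (m + i) i) (a w (m + i))"
proof -
  have c: "compatible s a const_series"
    by (rule quasi_local_compatible[OF mutually_quasi_local_sym[OF const_series_quasi_local[OF a]] a const_series_in_E_space])
  let ?g = "\<lambda>q p. a (const_series w q) p"
  obtain N where N: "\<forall>n<N. a w n = 0" using E_spaceD(3)[OF a] by blast
  have "\<forall>i j. i < min N 0 \<or> j < min N 0 \<longrightarrow> ?g i j = 0"
    using N by (auto simp: const_series_def E_space_zero[OF a])
  then have "?g \<in> trunc2" unfolding trunc2_def by blast
  then have "Y_op s \<alpha> a const_series i w m = subst s \<alpha> ?g i m"
    using subst_rel_eq_subst[OF \<alpha> Y_op_subst_rel[OF \<alpha> c, of w]] by metis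
  also have "\<dots> = s (bcoef \<alpha> (m + i) i) (a w (m + i))"
    unfolding subst_def
    by (subst Sum_any.expand_superset[of "{m + i}"])
      (auto simp: const_series_def E_space_zero[OF a] split: if_splits)
  finally show ?thesis .
qed

lemma act2_series_scale:
  "act2 (series_scale s) p T = act3 s (poly2 cst3 (lin3 0 1 0) (lin3 1 0 0) p) T"
proof -
  interpret V: cspace "series_scale s" by (rule cspace_series_scale)
  have "act3 s (poly2 cst3 (lin3 0 1 0) (lin3 1 0 0) p) T = act2 (series_scale s) (poly2 cst2 [:[:0, 1:]:] [:0, 1:] p) T"
    by (rule poly2_semilinear[OF V.P2.module_axioms P3.module_axioms, where R = "\<lambda>x y. y = x"])
      (auto simp: act3_lin3 act3_cst3 V.act_simps series_scale_def fun_eq_iff)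
  then show ?thesis by simp
qed

text \<open>Applying an operator identity to \<open>w\<close> exposes the exponent of x as a third
  index. This is the passage from series with coefficients in E(W) to the three-variable statements
  of weak commutativity and associativity.\<close>

lemma act2_E_scale:
  "act2 (E_scale s) ([:[:0, - (1 / \<gamma>):], 1:] ^ k) X j i w
    = act3 s (lin3 1 (- (1 / \<gamma>)) 0 ^ k) (\<lambda>j i. X j i w) j i"
proof -
  interpret ES: cspace "E_scale s" by (rule cspace_E_scale)
  have "poly2 cst3 (lin3 0 1 0) (lin3 1 0 0) ([:[:0, - (1 / \<gamma>):], 1:] ^ k * 1) = lin3 1 (- (1 / \<gamma>)) 0 ^ k"
    unfolding poly2_lin3_factor by (simp add: poly2_1)
  moreover have "act2 (series_scale s) p (\<lambda>j i. X j i w) = (\<lambda>j i. act2 (E_scale s) p X j i w)" for p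
    by (rule ES.act2_linear[OF module_series_scale]) (auto simp: E_scale_def)
  ultimately show ?thesis unfolding act2_series_scale by (metis mult.right_neutral)
qed

text \<open>With \<alpha> = \<gamma>\<beta> the ratio \<beta>/\<alpha> is 1/\<gamma>, so the linear
  factor of weak commutativity is the one in \<open>jacobi_identityI\<close>. That lemma is applied
  with E(W)-valued coefficients, for which the exponent \<open>k\<close> and the bounds have to be
  independent of \<open>w\<close>.\<close>

lemma Y_op_jacobi:
  assumes nz: "\<beta> \<noteq> 0" "\<gamma> \<noteq> 0" and abc: "a \<in> E_space s" "b \<in> E_space s" "c \<in> E_space s"
    and loc: "mutually_quasi_local s a b" "mutually_quasi_local s a c" "mutually_quasi_local s b c"
    and compat_bc: "\<And>j. compatible s a (Y_op s \<beta> b c j)"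
    and compat_ac: "\<And>i. compatible s b (Y_op s (\<gamma> * \<beta>) a c i)"
    and compat_ab: "\<And>i. compatible s (Y_op s \<gamma> a b i) c"
  shows "cspace.delta1 (E_scale s) \<gamma> (\<lambda>j i. Y_op s (\<gamma> * \<beta>) a (Y_op s \<beta> b c j) i) K L M
    - cspace.delta2 (E_scale s) \<gamma> (\<lambda>j i. Y_op s \<beta> b (Y_op s (\<gamma> * \<beta>) a c i) j) K L M
    = cspace.delta3 (E_scale s) \<gamma> (\<lambda>i j. Y_op s \<beta> (Y_op s \<gamma> a b i) c j) K L M"
proof -
  interpret V: cspace "series_scale s" by (rule cspace_series_scale)
  interpret ES: cspace "E_scale s" by (rule cspace_E_scale)
  let ?A = "\<lambda>j i. Y_op s (\<gamma> * \<beta>) a (Y_op s \<beta> b c j) i"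
  let ?B = "\<lambda>j i. Y_op s \<beta> b (Y_op s (\<gamma> * \<beta>) a c i) j"
  let ?C = "\<lambda>i j. Y_op s \<beta> (Y_op s \<gamma> a b i) c j"
  let ?\<delta> = "[:[:0, - (1 / \<gamma>):], 1:]"
  have nz': "\<gamma> * \<beta> \<noteq> 0" "\<beta> / (\<gamma> * \<beta>) = 1 / \<gamma>" using nz by simp_all
  obtain f g h where fgh: "locality_poly s f a b" "locality_poly s g a c" "locality_poly s h b c"
    using loc unfolding mutually_quasi_local_iff by blast
  then have "f \<noteq> 0" by (simp add: locality_poly_def)
  then obtain k f0 where f: "f = ?\<delta> ^ k * f0" "poly2 (\<lambda>a. [:a:]) [:0, \<gamma> * \<beta>:] [:0, \<beta>:] f0 \<noteq> 0"
    using poly2_factor[OF nz'(1) nz(1), of f] unfolding nz'(2) by blast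
  note wc = weak_commutativity[OF nz'(1) nz(1) abc _ f(2) fgh compat_bc compat_ac, where k = k, unfolded nz'(2), OF f(1)]
  have comm: "act2 (E_scale s) (?\<delta> ^ k) ?A = act2 (E_scale s) (?\<delta> ^ k) ?B"
    by (intro ext) (simp only: act2_E_scale wc(1))
  obtain N where N: "\<And>w i j. i < N \<or> j < N \<Longrightarrow> act3 s (lin3 1 (- (1 / \<gamma>)) 0 ^ k) (\<lambda>j i. ?A j i w) i j = 0"
    using wc(2) by blast
  have trunc: "act2 (E_scale s) (?\<delta> ^ k) ?A \<in> trunc2"
  proof -
    have "\<forall>j i. j < N \<or> i < N \<longrightarrow> act2 (E_scale s) (?\<delta> ^ k) ?A j i = 0"
      by (simp add: fun_eq_iff act2_E_scale N)
    then show ?thesis unfolding trunc2_def by blast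
  qed
  have assoc: "subst (E_scale s) \<gamma> (act2 (E_scale s) (?\<delta> ^ k) ?A)
      = (\<lambda>i j. E_scale s ((- (1 / \<gamma>)) ^ k) (?C (i - int k) j))"
  proof (intro ext)
    fix i j w m
    have "subst (E_scale s) \<gamma> (act2 (E_scale s) (?\<delta> ^ k) ?A) i j w
        = subst (series_scale s) \<gamma> (\<lambda>j i. act2 (E_scale s) (?\<delta> ^ k) ?A j i w) i j"
      using ES.subst_linear[OF module_series_scale _ _ trunc, of "\<lambda>u. u w" \<gamma>] by (simp add: E_scale_def)
    also have "(\<lambda>j i. act2 (E_scale s) (?\<delta> ^ k) ?A j i w) = act3 s (lin3 1 (- (1 / \<gamma>)) 0 ^ k) (\<lambda>j i. ?A j i w)"
      by (intro ext) (simp only: act2_E_scale)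
    also have "subst (series_scale s) \<gamma> \<dots> = act3 s (lin3 (- (1 / \<gamma>)) 0 0 ^ k) (\<lambda>i j. ?C i j w)"
      by (rule weak_associativity[OF nz abc f(1) fgh compat_bc compat_ab N, symmetric])
    also have "\<dots> = (\<lambda>i j m. s ((- (1 / \<gamma>)) ^ k) (?C (i - int k) j w m))"
      by (rule act3_lin3_power)
    finally have "subst (E_scale s) \<gamma> (act2 (E_scale s) (?\<delta> ^ k) ?A) i j w
        = (\<lambda>m. s ((- (1 / \<gamma>)) ^ k) (?C (i - int k) j w m))" .
    from fun_cong[OF this, of m]
    show "subst (E_scale s) \<gamma> (act2 (E_scale s) (?\<delta> ^ k) ?A) i j w m
        = E_scale s ((- (1 / \<gamma>)) ^ k) (?C (i - int k) j) w m"
      unfolding E_scale_apply[of "(- (1 / \<gamma>)) ^ k" "?C (i - int k) j" w m] .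
  qed
  have ab: "compatible s a b" and ac: "compatible s a c" and bc: "compatible s b c"
    using loc abc quasi_local_compatible by blast+
  obtain N1 where N1: "\<forall>j<N1. \<forall>i w. ?A j i w = 0"
    using Y_op_iterated_left_laurent(1)[OF nz'(1) abc(1) bc compat_bc] by blast
  obtain N2 where N2: "\<forall>i<N2. \<forall>j w. ?B j i w = 0"
    using Y_op_iterated_left_laurent(1)[OF nz(1) abc(2) ac compat_ac] by blast
  obtain N3 where N3: "\<forall>i<N3. \<forall>j w. ?C i j w = 0"
    using Y_op_iterated_right_laurent(1)[OF nz(1) ab abc(3) compat_ab] by blast
  let ?N = "min N1 (min N2 N3)"
  show ?thesis
  proof (rule ES.jacobi_identityI[OF nz(2) _ _ _ comm trunc assoc])
    show "?A i = 0" if "i < ?N" for i using N1 that by (simp add: fun_eq_iff)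
    show "?B i j = 0" if "j < ?N" for i j using N2 that by (simp add: fun_eq_iff)
    show "?C i = 0" if "i < ?N" for i using N3 that by (simp add: fun_eq_iff)
  qed
qed

text \<open>The locality polynomial makes the two orders equal and truncated, so
  \<open>delta_identity\<close> applies at once, without a power of x_1 - \<gamma> x_2. Since
  \<open>f\<close> depends only on \<open>a\<close> and \<open>b\<close>, it serves all elements of
  \<Gamma> simultaneously.\<close>

lemma quasi_jacobi_identity:
  assumes \<gamma>: "\<gamma> \<noteq> 0" and ab: "a \<in> E_space s" "b \<in> E_space s" and f: "locality_poly s f a b"
  shows "series_mult s (delta_fst \<gamma>) (series_mult s (in_x1_x2 (poly_series f)) (in_x1_x2 (prod_ab a b w)))
    - series_mult s (delta_snd \<gamma>) (series_mult s (in_x1_x2 (poly_series f)) (in_x1_x2 (prod_ba a b w)))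
    = series_mult s (delta_trd \<gamma>) (series_mult s (in_x1_x2 (poly_series f))
        (in_x0_x2 (\<lambda>(k, m). Y_op s \<gamma> a b k w m)))"
proof (rule ext, clarify)
  fix K L M :: int
  let ?H = "act2 s f (\<lambda>q p. a (b w q) p)"
  have c: "compatible s a b" and H: "?H \<in> trunc2"
    using locality_poly_compat[OF f ab] by (auto simp: compatible_def compat_poly_iff)
  have H': "act2 s f (\<lambda>q p. b (a w p) q) = ?H" using f by (simp add: locality_poly_def)
  obtain N where N: "\<forall>i<N. Y_op s \<gamma> a b i = 0" using Y_op_low[OF c] by blast
  have "act2 s (poly_subst \<gamma> f) (\<lambda>i. Y_op s \<gamma> a b i w) = subst s \<gamma> ?H"
    by (rule subst_rel_eq_subst[OF \<gamma> subst_rel_act2[OF \<gamma> Y_op_subst_rel[OF \<gamma> c]] H])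
  moreover have "\<forall>i<N. (\<lambda>m. (\<lambda>(k, m). Y_op s \<gamma> a b k w m) (i, m)) = 0" using N by (simp add: fun_eq_iff)
  note series_mult_delta_trd_poly[OF \<gamma> this, of f K L M]
  ultimately have "series_mult s (delta_trd \<gamma>) (series_mult s (in_x1_x2 (poly_series f))
        (in_x0_x2 (\<lambda>(k, m). Y_op s \<gamma> a b k w m))) (K, L, M) = delta3 \<gamma> (subst s \<gamma> ?H) K L M"
    by (simp only: prod.case)
  then show "(series_mult s (delta_fst \<gamma>) (series_mult s (in_x1_x2 (poly_series f)) (in_x1_x2 (prod_ab a b w)))
    - series_mult s (delta_snd \<gamma>) (series_mult s (in_x1_x2 (poly_series f)) (in_x1_x2 (prod_ba a b w)))) (K, L, M)
    = series_mult s (delta_trd \<gamma>) (series_mult s (in_x1_x2 (poly_series f))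
        (in_x0_x2 (\<lambda>(k, m). Y_op s \<gamma> a b k w m))) (K, L, M)"
    using delta_identity[OF \<gamma> H, of K L M]
    by (simp add: series_mult_poly_in_x1_x2 series_mult_delta_fst series_mult_delta_snd prod_ab_def prod_ba_def H')
qed

lemma gamma_structures:
  assumes \<Gamma>: "subgroup \<Gamma> Cx" and V: "Y_closed s \<Gamma> V" "quasi_local s V" "const_series \<in> V"
  shows "gamma_vertex_algebra (E_scale s) \<Gamma> V (Y_op s) const_series"
    and "gamma_quasi_module (E_scale s) \<Gamma> V (Y_op s) const_series s (\<lambda>\<alpha> a. a)"
proof -
  interpret ES: cspace "E_scale s" by (rule cspace_E_scale)
  have E: "a \<in> E_space s" if "a \<in> V" for a using V(1) that by (auto simp: Y_closed_def)
  have sub: "ES.subspace V" using V(1) by (simp add: Y_closed_def)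
  have c: "compatible s a b" if "a \<in> V" "b \<in> V" for a b
    using V(1) that by (auto simp: Y_closed_def pairwise_compatible_def)
  have Y: "Y_op s \<alpha> a b i \<in> V" if "a \<in> V" "b \<in> V" "\<alpha> \<in> \<Gamma>" for a b \<alpha> i
    using V(1) that by (auto simp: Y_closed_def Y_op_def)
  have loc: "mutually_quasi_local s a b" if "a \<in> V" "b \<in> V" for a b
    using V(2) that by (auto simp: quasi_local_def)
  note nz = subgroup_Cx_closed(1)[OF \<Gamma>]
  note closed = subgroup_Cx_closed(2)[OF \<Gamma>]
  have add: "a + b \<in> V" if "a \<in> V" "b \<in> V" for a b using ES.subspace_add[OF sub that] .
  have scale: "E_scale s d a \<in> V" if "a \<in> V" for d a using ES.subspace_scale[OF sub that] .
  show GVA: "gamma_vertex_algebra (E_scale s) \<Gamma> V (Y_op s) const_series"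
  proof (intro gamma_vertex_algebra.intro gamma_vertex_algebra_axioms.intro)
    show "vector_space (E_scale s)" using module_E_scale module_iff_vector_space by blast
  next
    fix \<alpha> u assume \<alpha>: "\<alpha> \<in> \<Gamma>" and u: "u \<in> V"
    have "linear_on (E_scale s) (series_scale (E_scale s)) V (Y_op s \<alpha> u)"
      unfolding linear_on_def
      using nz[OF \<alpha> \<alpha>] u E c add scale
      by (auto simp: fun_eq_iff Y_op_add_right Y_op_scale_right series_scale_def)
    moreover have "Y_op s \<alpha> u v \<in> laurent V" if "v \<in> V" for v
      using Y[OF u that \<alpha>] Y_op_low[OF c[OF u that]] by (auto simp: laurent_def)
    ultimately show "Y_op s \<alpha> u \<in> hom_laurent (E_scale s) V" by (auto simp: hom_laurent_def)
  next
    fix \<alpha> v assume \<alpha>: "\<alpha> \<in> \<Gamma>" and v: "v \<in> V"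
    show "linear_on (E_scale s) (series_scale (E_scale s)) V (\<lambda>u. Y_op s \<alpha> u v)"
      unfolding linear_on_def
      using nz[OF \<alpha> \<alpha>] v c add scale
      by (auto simp: fun_eq_iff Y_op_add_left Y_op_scale_left series_scale_def)
    show "Y_op s \<alpha> const_series v = const_series v" by (rule Y_op_const_left[OF nz[OF \<alpha> \<alpha>] E[OF v]])
    show "Y_op s \<alpha> v const_series n = 0" if "n < 0" for n
      using that by (simp add: fun_eq_iff Y_op_const_right[OF nz[OF \<alpha> \<alpha>] E[OF v]] bcoef_neg)
  next
    fix v assume v: "v \<in> V"
    show "Y_op s 1 v const_series 0 = v"
      by (simp add: fun_eq_iff Y_op_const_right[OF one_neq_zero E[OF v]] bcoef_def)
  next
    fix \<alpha> \<beta> a b c' assume \<alpha>\<beta>: "\<alpha> \<in> \<Gamma>" "\<beta> \<in> \<Gamma>" and abc: "a \<in> V" "b \<in> V" "c' \<in> V"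
    let ?\<gamma> = "inverse \<beta> * \<alpha>"
    have \<gamma>: "?\<gamma> \<in> \<Gamma>" "?\<gamma> \<noteq> 0" "?\<gamma> * \<beta> = \<alpha>" "\<beta> \<noteq> 0"
      using closed[OF \<alpha>\<beta>] nz[OF \<alpha>\<beta>] nz[OF \<alpha>\<beta>(2) \<alpha>\<beta>(1)] by auto
    have "ES.delta1 ?\<gamma> (\<lambda>j i. Y_op s \<alpha> a (Y_op s \<beta> b c' j) i) K L M
      - ES.delta2 ?\<gamma> (\<lambda>j i. Y_op s \<beta> b (Y_op s \<alpha> a c' i) j) K L M
      = ES.delta3 ?\<gamma> (\<lambda>i j. Y_op s \<beta> (Y_op s ?\<gamma> a b i) c' j) K L M" for K L M
      using Y_op_jacobi[OF \<gamma>(4,2), of a b c' K L M] abc \<alpha>\<beta> \<gamma>(1) unfolding \<gamma>(3)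
      by (simp add: E loc c Y)
    then show "series_mult (E_scale s) (delta_fst ?\<gamma>) (in_x1_x2 (prod_ab (Y_op s \<alpha> a) (Y_op s \<beta> b) c'))
      - series_mult (E_scale s) (delta_snd ?\<gamma>) (in_x1_x2 (prod_ba (Y_op s \<alpha> a) (Y_op s \<beta> b) c'))
      = series_mult (E_scale s) (delta_trd ?\<gamma>)
          (in_x0_x2 (\<lambda>(k, m). Y_op s \<beta> (Y_op s ?\<gamma> a b k) c' m))"
      by (intro ext, clarify)
        (simp add: ES.series_mult_delta_fst ES.series_mult_delta_snd ES.series_mult_delta_trd prod_ab_def prod_ba_def)
  qed (use \<Gamma> sub V in auto)
  show "gamma_quasi_module (E_scale s) \<Gamma> V (Y_op s) const_series s (\<lambda>\<alpha> a. a)"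
  proof (intro gamma_quasi_module.intro gamma_quasi_module_axioms.intro GVA)
    show "vector_space s" using module_axioms module_iff_vector_space by blast
    show "linear_on (E_scale s) (series_scale s) V (\<lambda>u. u w)" for w
      by (simp add: linear_on_def E_scale_def)
    show "u \<in> hom_laurent s UNIV" if "u \<in> V" for u using E[OF that] by (simp add: E_space_def)
  next
    fix a b assume ab: "a \<in> V" "b \<in> V"
    obtain f where f: "locality_poly s f a b" using loc[OF ab] unfolding mutually_quasi_local_iff by blast
    show "\<exists>f. f \<noteq> 0 \<and> (\<forall>\<alpha>\<in>\<Gamma>. \<forall>\<beta>\<in>\<Gamma>. \<forall>w.
      series_mult s (delta_fst (inverse \<beta> * \<alpha>))
        (series_mult s (in_x1_x2 (poly_series f)) (in_x1_x2 (prod_ab a b w)))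
      - series_mult s (delta_snd (inverse \<beta> * \<alpha>))
        (series_mult s (in_x1_x2 (poly_series f)) (in_x1_x2 (prod_ba a b w)))
      = series_mult s (delta_trd (inverse \<beta> * \<alpha>))
        (series_mult s (in_x1_x2 (poly_series f))
          (in_x0_x2 (\<lambda>(k, m). Y_op s (inverse \<beta> * \<alpha>) a b k w m))))"
    proof (intro exI[of _ f] conjI ballI allI)
      fix \<alpha> \<beta> w assume "\<alpha> \<in> \<Gamma>" "\<beta> \<in> \<Gamma>"
      then have "inverse \<beta> * \<alpha> \<noteq> 0" using nz closed by blast
      then show "series_mult s (delta_fst (inverse \<beta> * \<alpha>))
        (series_mult s (in_x1_x2 (poly_series f)) (in_x1_x2 (prod_ab a b w)))
      - series_mult s (delta_snd (inverse \<beta> * \<alpha>))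
        (series_mult s (in_x1_x2 (poly_series f)) (in_x1_x2 (prod_ba a b w)))
      = series_mult s (delta_trd (inverse \<beta> * \<alpha>))
        (series_mult s (in_x1_x2 (poly_series f))
          (in_x0_x2 (\<lambda>(k, m). Y_op s (inverse \<beta> * \<alpha>) a b k w m)))"
        by (rule quasi_jacobi_identity[OF _ E[OF ab(1)] E[OF ab(2)] f])
    qed (use f in \<open>simp add: locality_poly_def\<close>)
  qed simp_all
qed

section \<open>Existence of the generated closed subspace\<close>

lemma mutually_quasi_local_add:
  assumes c: "c \<in> E_space s" and "mutually_quasi_local s a c" "mutually_quasi_local s a' c"
  shows "mutually_quasi_local s (a + a') c"
proof -
  obtain f f' where f: "locality_poly s f a c" "locality_poly s f' a' c"
    using assms unfolding mutually_quasi_local_iff by blast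
  have "act2 s (f * f') (\<lambda>q p. (a + a') (c w q) p) = act2 s (f * f') (\<lambda>q p. c ((a + a') w p) q)" for w
  proof -
    have "act2 s (f * f') ((\<lambda>q p. a (c w q) p) + (\<lambda>q p. a' (c w q) p))
        = act2 s f' (act2 s f (\<lambda>q p. a (c w q) p)) + act2 s f (act2 s f' (\<lambda>q p. a' (c w q) p))"
      by (simp add: P2.scale_right_distrib mult.commute)
    also have "\<dots> = act2 s f' (act2 s f (\<lambda>q p. c (a w p) q)) + act2 s f (act2 s f' (\<lambda>q p. c (a' w p) q))"
      using f by (simp only: locality_poly_def)
    also have "\<dots> = act2 s (f * f') ((\<lambda>q p. c (a w p) q) + (\<lambda>q p. c (a' w p) q))"
      by (simp add: P2.scale_right_distrib mult.commute)
    finally show ?thesis by (simp add: E_spaceD[OF c] plus_fun_def)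
  qed
  moreover have "f * f' \<noteq> 0" using f by (simp add: locality_poly_def)
  ultimately show ?thesis unfolding mutually_quasi_local_iff locality_poly_def by blast
qed

lemma mutually_quasi_local_scale:
  assumes c: "c \<in> E_space s" and "mutually_quasi_local s a c"
  shows "mutually_quasi_local s (E_scale s d a) c"
proof -
  obtain f where f: "locality_poly s f a c"
    using assms unfolding mutually_quasi_local_iff by blast
  have sd: "act2 s f (\<lambda>q p. s d (g q p)) = (\<lambda>q p. s d (act2 s f g q p))" for g
    by (rule act2_linear[OF module_axioms]) (auto simp: scale_right_distrib mult.commute)
  have "act2 s f (\<lambda>q p. E_scale s d a (c w q) p) = act2 s f (\<lambda>q p. c (E_scale s d a w p) q)" for w
    using f by (simp add: E_scale_def series_scale_def E_spaceD[OF c] sd locality_poly_def)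
  then show ?thesis using f unfolding mutually_quasi_local_iff locality_poly_def by blast
qed

lemma E_space_add: "a \<in> E_space s \<Longrightarrow> b \<in> E_space s \<Longrightarrow> a + b \<in> E_space s"
proof (rule E_spaceI)
  fix u assume ab: "a \<in> E_space s" "b \<in> E_space s"
  obtain N M where "\<forall>n<N. a u n = 0" "\<forall>n<M. b u n = 0" using E_spaceD(3)[OF ab(1)] E_spaceD(3)[OF ab(2)] by blast
  then show "\<exists>N. \<forall>n<N. (a + b) u n = 0" by (intro exI[of _ "min N M"]) simp
qed (simp_all add: E_spaceD[of a] E_spaceD[of b] scale_right_distrib)

lemma E_space_scale: "a \<in> E_space s \<Longrightarrow> E_scale s d a \<in> E_space s"
proof (rule E_spaceI)
  fix u assume a: "a \<in> E_space s"
  obtain N where "\<forall>n<N. a u n = 0" using E_spaceD(3)[OF a] by blast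
  then show "\<exists>N. \<forall>n<N. E_scale s d a u n = 0" by (intro exI[of _ N]) (simp add: E_scale_apply)
qed (simp_all add: E_spaceD[of a] E_scale_def series_scale_def scale_right_distrib mult.commute)

text \<open>A maximal quasi local set is a closed subspace, since every vertex operator that is local
  with whatever is local with the whole set belongs to it.\<close>

lemma quasi_local_closure:
  assumes \<Gamma>: "subgroup \<Gamma> Cx" and S: "quasi_local s S"
  shows "\<exists>U. Y_closed s \<Gamma> U \<and> quasi_local s U \<and> S \<subseteq> U \<and> const_series \<in> U"
proof -
  interpret ES: cspace "E_scale s" by (rule cspace_E_scale)
  let ?F = "{U. quasi_local s U \<and> insert const_series S \<subseteq> U}"
  have S_E: "a \<in> E_space s" if "a \<in> S" for a using S that by (auto simp: quasi_local_def)
  have "mutually_quasi_local s a b" if "a \<in> insert const_series S" "b \<in> insert const_series S" for a b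
    using that S const_series_quasi_local[OF S_E] const_series_quasi_local[OF const_series_in_E_space]
      mutually_quasi_local_sym[OF const_series_quasi_local[OF S_E]]
    by (auto simp: quasi_local_def)
  then have "insert const_series S \<in> ?F"
    using S const_series_in_E_space by (auto simp: quasi_local_def)
  then have ne: "?F \<noteq> {}" by blast
  have chain: "\<Union>\<C> \<in> ?F" if "\<C> \<noteq> {}" "subset.chain ?F \<C>" for \<C>
  proof -
    have ql: "quasi_local s U" "insert const_series S \<subseteq> U" if "U \<in> \<C>" for U
      using \<open>subset.chain ?F \<C>\<close> that by (auto simp: subset.chain_def)
    have loc: "mutually_quasi_local s a b" if ab: "a \<in> U" "b \<in> U'" "U \<in> \<C>" "U' \<in> \<C>" for a b U U'
    proof -
      have "U \<subseteq> U' \<or> U' \<subseteq> U" using \<open>subset.chain ?F \<C>\<close> ab(3,4) by (meson subset_chain_def)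
      then obtain U'' where "U'' \<in> \<C>" "a \<in> U''" "b \<in> U''" using ab by blast
      then show ?thesis using ql(1)[of U''] by (simp add: quasi_local_def)
    qed
    have "\<Union>\<C> \<subseteq> E_space s" using ql(1) unfolding quasi_local_def by blast
    moreover have "\<forall>a\<in>\<Union>\<C>. \<forall>b\<in>\<Union>\<C>. mutually_quasi_local s a b" using loc by blast
    moreover have "insert const_series S \<subseteq> \<Union>\<C>" using ql(2) that(1) by blast
    ultimately show ?thesis by (simp add: quasi_local_def)
  qed
  have "\<exists>M\<in>?F. \<forall>X\<in>?F. M \<subseteq> X \<longrightarrow> X = M"
    by (rule subset_Zorn_nonempty[OF ne chain])
  then obtain M where M: "M \<in> ?F" "\<forall>X\<in>?F. M \<subseteq> X \<longrightarrow> X = M" by (rule bexE)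
  from M(1) have ME: "a \<in> E_space s" and Mloc: "b \<in> M \<Longrightarrow> mutually_quasi_local s a b" if "a \<in> M" for a b
    using that by (auto simp: quasi_local_def)
  \<comment> \<open>The hypothesis on \<open>x\<close> is used twice: first with \<open>c\<close> in
    \<open>M\<close>, and then, \<open>x\<close> being known to be local with \<open>M\<close>, with
    \<open>c = x\<close>, which yields locality of \<open>x\<close> with itself.\<close>
  have mem: "x \<in> M" if x: "x \<in> E_space s"
    and loc: "\<And>c. c \<in> E_space s \<Longrightarrow> (\<And>m. m \<in> M \<Longrightarrow> mutually_quasi_local s m c) \<Longrightarrow> mutually_quasi_local s x c" for x
  proof -
    have 1: "mutually_quasi_local s x m" if "m \<in> M" for m using loc[OF ME] Mloc that by blast
    then have 2: "mutually_quasi_local s m x" if "m \<in> M" for m using mutually_quasi_local_sym that by blast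
    then have "mutually_quasi_local s x x" using loc[OF x] by blast
    then have "insert x M \<in> ?F" using 1 2 x M(1) by (auto simp: quasi_local_def)
    then have "insert x M = M" using M(2) by blast
    then show ?thesis by blast
  qed
  have compat: "compatible s a b" if "a \<in> M" "b \<in> M" for a b
    using quasi_local_compatible[OF Mloc ME ME] that by blast
  have add: "a + b \<in> M" if "a \<in> M" "b \<in> M" for a b
    by (rule mem[OF E_space_add[OF ME ME]]) (use that in \<open>auto intro: mutually_quasi_local_add\<close>)
  have scale: "E_scale s d a \<in> M" if "a \<in> M" for a d
    by (rule mem[OF E_space_scale[OF ME]]) (use that in \<open>auto intro: mutually_quasi_local_scale\<close>)
  have const: "const_series \<in> M" and SM: "S \<subseteq> M" using M(1) by auto
  have "0 \<in> M" using scale[OF const, of 0] by simp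
  then have "ES.subspace M" by (intro ES.subspaceI add scale)
  moreover have "nth_prod s \<alpha> n a b \<in> M" if ab: "a \<in> M" "b \<in> M" "\<alpha> \<in> \<Gamma>" for a b \<alpha> n
  proof -
    have \<alpha>: "\<alpha> \<noteq> 0" using subgroup_Cx_closed(1)[OF \<Gamma>] ab by blast
    have "Y_op s \<alpha> a b (- n - 1) \<in> M"
    proof (rule mem)
      show "Y_op s \<alpha> a b (- n - 1) \<in> E_space s"
        using Y_op_in_E_space[OF \<alpha> compat ME ME] ab by blast
      show "mutually_quasi_local s (Y_op s \<alpha> a b (- n - 1)) c"
        if "c \<in> E_space s" "\<And>m. m \<in> M \<Longrightarrow> mutually_quasi_local s m c" for c
        using Y_op_quasi_local[OF \<alpha> ME ME that(1) Mloc] ab that(2) by blast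
    qed
    then show ?thesis by (simp add: Y_op_def)
  qed
  ultimately have "Y_closed s \<Gamma> M"
    using ME compat by (auto simp: Y_closed_def pairwise_compatible_def)
  then show ?thesis using M(1) by blast
qed

text \<open>The intersection of all admissible subspaces is the least one. That the family is
  nonempty is the point supplied by \<open>quasi_local_closure\<close>: from a member the
  intersection inherits quasi locality and pairwise compatibility.\<close>

lemma generated_closed:
  assumes \<Gamma>: "subgroup \<Gamma> Cx" and S: "quasi_local s S"
  shows "Y_closed s \<Gamma> (generated s \<Gamma> S) \<and> quasi_local s (generated s \<Gamma> S) \<and> const_series \<in> generated s \<Gamma> S"
proof -
  interpret ES: cspace "E_scale s" by (rule cspace_E_scale)
  let ?P = "\<lambda>U. Y_closed s \<Gamma> U \<and> quasi_local s U \<and> S \<subseteq> U \<and> const_series \<in> U"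
  let ?I = "\<Inter>{U. ?P U}"
  obtain U where U: "?P U" using quasi_local_closure[OF assms] by blast
  then have sub: "?I \<subseteq> U" by blast
  have "ES.subspace ?I" by (rule ES.subspace_Inter) (auto simp: Y_closed_def)
  moreover have "?I \<subseteq> E_space s" using sub U by (auto simp: Y_closed_def)
  moreover have "pairwise_compatible s ?I"
    using sub U unfolding Y_closed_def pairwise_compatible_def by blast
  moreover have "nth_prod s \<alpha> n a b \<in> ?I" if "a \<in> ?I" "b \<in> ?I" "\<alpha> \<in> \<Gamma>" for a b \<alpha> n
    using that by (auto simp: Y_closed_def)
  ultimately have "Y_closed s \<Gamma> ?I" by (simp only: Y_closed_def) blast
  moreover have "quasi_local s ?I" using sub U unfolding quasi_local_def by blast
  ultimately have P: "?P ?I" by blast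
  have "generated s \<Gamma> S = ?I"
    unfolding generated_def by (rule Least_equality) (use P in blast)+
  with P show ?thesis by simp
qed

end

theorem theorem6p4:
  fixes s :: "complex \<Rightarrow> 'w::ab_group_add \<Rightarrow> 'w"
    and \<Gamma> :: "complex set"
  assumes "vector_space s"
    and "subgroup \<Gamma> Cx"
  shows "(\<forall>V. Y_closed s \<Gamma> V \<and> quasi_local s V \<and> const_series \<in> V \<longrightarrow>
            gamma_vertex_algebra (E_scale s) \<Gamma> V (Y_op s) const_series \<and>
            gamma_quasi_module (E_scale s) \<Gamma> V (Y_op s) const_series s (\<lambda>\<alpha> a. a)) \<and>
         (\<forall>S. quasi_local s S \<longrightarrow>
            gamma_vertex_algebra (E_scale s) \<Gamma> (generated s \<Gamma> S) (Y_op s) const_series \<and>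
            gamma_quasi_module (E_scale s) \<Gamma> (generated s \<Gamma> S) (Y_op s) const_series s
              (\<lambda>\<alpha> a. a))"
proof -
  interpret cspace s
    using assms(1) by (simp add: cspace_def module_iff_vector_space)
  show ?thesis
    using gamma_structures[OF assms(2)] generated_closed[OF assms(2)] by blast
qed

end
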